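(* Let $\Lambda=\Lambda(\Omega)$ be a model set (with respect to a cut and project scheme $(\mathbb R^m,\mathbb R^n,\tilde L)$) based on a window $\Omega\subset\mathbb R^n$ that is compact, satisfies $\Omega=\overline{\mathrm{int}(\Omega)}$, and whose boundary has Lebesgue measure $0$. Let $Q$ be a linear similarity of $\mathbb R^m$ compatible with $\Lambda$ and let $A:=Q^*$. Then there is a unique $Q$-invariant density $p$ for $\Lambda$ lying in $\mathcal C(\Lambda)$. It is given by $p=p_f$, i.e. $p(x)=\mathrm{vol}(\Omega)\cdot f(x^* )$ for $x\in\Lambda$ and $p(x)=0$ for $x\in L\setminus\Lambda$, where $f$ is the infinite convolution product $$f=\mathop{\ast}_{N=0}^{\infty}\frac{\mathbf 1_{A^N\Omega_Q}}{\mathrm{vol}(A^N\Omega_Q)}.$$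
   Context: Cut and project scheme: $\mathbb R^m$ (physical space) and $\mathbb R^n$ (internal space) are Euclidean spaces, $\mathbb R^m\times\mathbb R^n$ is their orthogonal sum, $\pi_1,\pi_2$ are the projections onto $\mathbb R^m$ and $\mathbb R^n$, and $\tilde L\subset\mathbb R^m\times\mathbb R^n$ is a lattice such that $\pi_1|_{\tilde L}$ is injective and $\pi_2(\tilde L)$ is dense in $\mathbb R^n$. Put $L=\pi_1(\tilde L)$ and let $(\,)^*=\pi_2\circ(\pi_1|_{\tilde L})^{-1}:L\to\mathbb R^n$. For $\Omega\subset\mathbb R^n$, $\Lambda(\Omega)=\{x\in L\mid x^*\in\Omega\}$; it is called a model set if $\Omega$ is compact, $\Omega=\overline{\mathrm{int}(\Omega)}$, and $\partial\Omega$ has Lebesgue measure $0$. Standing assumptions: $0\in\Lambda$ and $0\in\mathrm{int}(\Omega)$. A linear similarity is $Q=qR$ with $R$ an orthogonal transformation of $\mathbb R^m$ and $q$ real (the inflation factor). It is assumed that $QL=L$. Then $Q$ induces an automorphism of the lattice $\tilde L$ and a linear map $A=Q^*$ of $\mathbb R^n$ with $(Qx)^*=A(x^* )$ for $x\in L$; it is assumed that all eigenvalues of $A$ have absolute value less than $1$. Define $\Omega_Q=\{u\in\mathbb R^n\mid A\Omega+u\subset\Omega\}$. $Q$ is compatible with $\Lambda$ if $\mathrm{int}(\Omega_Q)\neq\emptyset$. It is always assumed that $\partial\Omega_Q$ has Lebesgue measure $0$. Put $T=T_Q=\{v\in L\mid v^*\in\Omega_Q\}$, and for $v\in T$ let $t_v(x)=Qx+v$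 (these are exactly the affine maps with linear part $Q$ that map $\Lambda$ into itself). For $S\subset\mathbb R^m$ and $s\ge0$, put $S_s=\{x\in S\mid |x|\le s\}$; $\#$ denotes cardinality. Averaging and invariant densities: for a function $p$ on $L$ vanishing off $\Lambda$, define $$(\mathcal A p)(x)=\lim_{s\to\infty}\frac{|\det(Q)|}{\# T_s}\sum_{v\in T_s}p(t_v^{-1}x)$$ for $x\in L$, provided the limit exists. A function $p:L\to\mathbb R$ vanishing off $\Lambda$ is a $Q$-invariant density on $\Lambda$ if (1) $p$ is non-negative on $\Lambda$; (2) $\mathcal Ap=p$; (3) $\lim_{s\to\infty}\frac1{\#\Lambda_s}\sum_{x\in\Lambda_s}p(x)=1$. $\mathcal C(\Omega)$ is the space of continuous complex-valued functions on $\mathbb R^n$ with support in $\Omega$. $\mathcal C(\Lambda)$ is the space of functions $p_f$ on $L$, $f\in\mathcal C(\Omega)$, where $p_f(x)=\mathrm{vol}(\Omega)f(x^* )$ for $x\in\Lambda$ and $p_f(x)=0$ otherwise. $\mathbf 1_S$ is the characteristic function of $S$ and vol is Lebesgue measure. With $\hat f(k)=\int_{\mathbb R^n}e^{-2\pi i k\cdot x}f(x)\,dx$, the infinite convolution product is understood as the function $f$ whose Fourier transform is the infinite product $\hat f(k)=\prod_{N=0}^\infty \hat{\mathbf 1}_{\Omega_Q}((A^t)^Nk)/\mathrm{vol}(\Omega_Q)$, which converges uniformly on compact sets. *)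

theory Defs
  imports "HOL-Analysis.Analysis"
begin

definition is_lattice :: "'a::euclidean_space set \<Rightarrow> bool" where
  "is_lattice M \<longleftrightarrow>
     (\<exists>B. independent B \<and> span B = UNIV \<and>
          M = {v. \<exists>c :: 'a \<Rightarrow> int. v = (\<Sum>b\<in>B. of_int (c b) *\<^sub>R b)})"

definition cut_and_project_scheme :: "((real^'m) \<times> (real^'n)) set \<Rightarrow> bool" where
  "cut_and_project_scheme M \<longleftrightarrow>
     is_lattice M \<and> inj_on fst M \<and> closure (snd ` M) = UNIV"

definition phys_lattice :: "((real^'m) \<times> (real^'n)) set \<Rightarrow> (real^'m) set" where
  "phys_lattice M = fst ` M"

definition star :: "((real^'m) \<times> (real^'n)) set \<Rightarrow> real^'m \<Rightarrow> real^'n" where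
  "star M x = snd (inv_into M fst x)"

definition model_points ::
    "((real^'m) \<times> (real^'n)) set \<Rightarrow> (real^'n) set \<Rightarrow> (real^'m) set" where
  "model_points M W = {x \<in> phys_lattice M. star M x \<in> W}"

definition model_window :: "(real^'n) set \<Rightarrow> bool" where
  "model_window W \<longleftrightarrow>
     compact W \<and> W = closure (interior W) \<and> frontier W \<in> null_sets lebesgue"

definition linear_similarity :: "(real^'m \<Rightarrow> real^'m) \<Rightarrow> bool" where
  "linear_similarity Q \<longleftrightarrow>
     (\<exists>q R. orthogonal_transformation R \<and> Q = (\<lambda>x. q *\<^sub>R R x))"

text \<open>The map \<open>A\<close> below is determined by \<open>Q\<close>, because \<open>snd ` M\<close> is dense.\<close>

definition is_star_map :: "((real^'m) \<times> (real^'n)) set \<Rightarrow>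
    (real^'m \<Rightarrow> real^'m) \<Rightarrow> (real^'n \<Rightarrow> real^'n) \<Rightarrow> bool" where
  "is_star_map M Q A \<longleftrightarrow>
     linear A \<and> (\<forall>x \<in> phys_lattice M. star M (Q x) = A (star M x))"

text \<open>Eigenvalues are complex, i.e. those of the complexification of \<open>A\<close>.\<close>

definition complex_eigenvalue :: "(real^'n \<Rightarrow> real^'n) \<Rightarrow> complex \<Rightarrow> bool" where
  "complex_eigenvalue A c \<longleftrightarrow>
     (\<exists>v. v \<noteq> 0 \<and> map_matrix complex_of_real (matrix A) *v v = c *s v)"

definition translation_window ::
    "(real^'n \<Rightarrow> real^'n) \<Rightarrow> (real^'n) set \<Rightarrow> (real^'n) set" where
  "translation_window A W = {u. (\<lambda>x. A x + u) ` W \<subseteq> W}"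

definition truncate :: "(real^'m) set \<Rightarrow> real \<Rightarrow> (real^'m) set" where
  "truncate S s = {x \<in> S. norm x \<le> s}"

definition affine_map :: "(real^'m \<Rightarrow> real^'m) \<Rightarrow> real^'m \<Rightarrow> real^'m \<Rightarrow> real^'m" where
  "affine_map Q v x = Q x + v"

text \<open>Functions on \<open>phys_lattice M\<close> that vanish off the model set are represented by total
  functions on the physical space that vanish off the model set. The relation
  \<open>has_average M T Q p g\<close> says that, for every point of \<open>phys_lattice M\<close>, the limit defining the
  average of \<open>p\<close> over \<open>T\<close> exists and equals \<open>g\<close>.\<close>

definition has_average :: "((real^'m) \<times> (real^'n)) set \<Rightarrow> (real^'m) set \<Rightarrow>
    (real^'m \<Rightarrow> real^'m) \<Rightarrow> (real^'m \<Rightarrow> real) \<Rightarrow> (real^'m \<Rightarrow> real) \<Rightarrow> bool" where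
  "has_average M T Q p g \<longleftrightarrow>
     (\<forall>x \<in> phys_lattice M.
        ((\<lambda>s. \<bar>det (matrix Q)\<bar> / real (card (truncate T s))
               * (\<Sum>v \<in> truncate T s. p (inv (affine_map Q v) x))) \<longlongrightarrow> g x) at_top)"

definition invariant_density :: "((real^'m) \<times> (real^'n)) set \<Rightarrow> (real^'n) set \<Rightarrow>
    (real^'m \<Rightarrow> real^'m) \<Rightarrow> (real^'n \<Rightarrow> real^'n) \<Rightarrow> (real^'m \<Rightarrow> real) \<Rightarrow> bool" where
  "invariant_density M W Q A p \<longleftrightarrow>
     (\<forall>x. x \<notin> model_points M W \<longrightarrow> p x = 0) \<and>
     (\<forall>x \<in> model_points M W. 0 \<le> p x) \<and>
     has_average M (model_points M (translation_window A W)) Q p p \<and>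
     ((\<lambda>s. 1 / real (card (truncate (model_points M W) s))
            * (\<Sum>x \<in> truncate (model_points M W) s. p x)) \<longlongrightarrow> 1) at_top"

definition window_functions :: "(real^'n) set \<Rightarrow> (real^'n \<Rightarrow> complex) set" where
  "window_functions W = {f. continuous_on UNIV f \<and> closure {y. f y \<noteq> 0} \<subseteq> W}"

definition pullback :: "((real^'m) \<times> (real^'n)) set \<Rightarrow> (real^'n) set \<Rightarrow>
    (real^'n \<Rightarrow> complex) \<Rightarrow> real^'m \<Rightarrow> complex" where
  "pullback M W f x =
     (if x \<in> model_points M W then of_real (measure lebesgue W) * f (star M x) else 0)"

definition model_functions ::
    "((real^'m) \<times> (real^'n)) set \<Rightarrow> (real^'n) set \<Rightarrow> (real^'m \<Rightarrow> complex) set" where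
  "model_functions M W = pullback M W ` window_functions W"

definition fourier :: "(real^'n \<Rightarrow> complex) \<Rightarrow> real^'n \<Rightarrow> complex" where
  "fourier f k = (\<integral>x. exp (- (2 * of_real pi * \<i> * of_real (k \<bullet> x))) * f x \<partial>lebesgue)"

definition conv_factor ::
    "(real^'n \<Rightarrow> real^'n) \<Rightarrow> (real^'n) set \<Rightarrow> nat \<Rightarrow> real^'n \<Rightarrow> complex" where
  "conv_factor A V N k =
     fourier (indicator V) ((adjoint A ^^ N) k) / of_real (measure lebesgue V)"

text \<open>The factor \<open>conv_factor A V N\<close> is the Fourier transform of the normalised indicator of
  \<open>(A ^^ N) ` V\<close>, so \<open>f\<close> below is the infinite convolution product of these normalised
  indicators. The Fourier transform determines \<open>f\<close> almost everywhere; a continuous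
  representative has to be asked for separately.\<close>

definition has_infinite_convolution ::
    "(real^'n \<Rightarrow> real^'n) \<Rightarrow> (real^'n) set \<Rightarrow> (real^'n \<Rightarrow> complex) \<Rightarrow> bool" where
  "has_infinite_convolution A V f \<longleftrightarrow>
     integrable lebesgue f \<and>
     (\<forall>k. (\<lambda>N. conv_factor A V N k) has_prod fourier f k) \<and>
     (\<forall>K. compact K \<longrightarrow>
        uniform_limit K (\<lambda>n k. \<Prod>N<n. conv_factor A V N k) (fourier f) sequentially)"

end

theory Submission
  imports Defs "HOL-Complex_Analysis.Great_Picard"
begin

text \<open>The points \<open>star M x\<close> with \<open>norm x \<le> s\<close> equidistribute in internal space: their counting sums are
  asymptotically invariant under the dense group of translations by \<open>star M t\<close>, so both
  \<open>(\<integral>h) \<cdot> \<Sum>g\<close> and \<open>(\<integral>g) \<cdot> \<Sum>h\<close> are asymptotic to the sum of the convolution of \<open>g\<close> and \<open>h\<close>.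
  By equidistribution, averaging a density given by \<open>f\<close> amounts to the operator
  \<open>avg f y = (\<integral> indicator V (y - A w) * f w) / vol V\<close> with \<open>V\<close> the translation window (the Jacobian of
  \<open>A\<close> cancels \<open>\<bar>det Q\<bar>\<close>, which is itself read off from equidistribution). On the Fourier side
  \<open>avg\<close> multiplies the function at \<open>adjoint A k\<close> by the first factor of the convolution product. Hence
  a normalised fixed point is unique and has the infinite product as its Fourier transform; it exists
  because the iterates of \<open>avg\<close> are equicontinuous, so that some subsequence converges uniformly.\<close>

section \<open>Lattices and packing\<close>

text \<open>Counting sums over the ball of radius s are compared up to errors o(s^m). Translations
  cause only such errors because an annulus of fixed width contains o(s^m) points of a strip;
  dividing by a count is legitimate because every ball in internal space is hit at least c s^m
  times. These two growth facts replace an asymptotic formula for the number of points. The kernel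
  of \<open>avg\<close> comes from the affine maps: the preimage of x under
  \<open>affine_map Q v\<close> has as its star the image of \<open>star M x - star M v\<close>
  under the inverse of A, and the points \<open>star M v\<close> equidistribute in V. The infinite
  product is not known to be integrable, so Fourier inversion cannot supply f, and compactness has
  to. A subsequential limit need not be fixed by \<open>avg\<close> for topological reasons alone;
  it is fixed because the transforms of the entire sequence converge to the product, whichever
  subsequence was selected. Injectivity of the transform is needed only for continuous functions of
  bounded support, where Stone-Weierstrass with trigonometric polynomials of arbitrary real
  frequencies suffices.\<close>

lemma lattice_coordinates:
  fixes B :: "'a::euclidean_space set"
  assumes "independent B" "span B = UNIV"
  obtains r where "\<And>b. linear (\<lambda>x. r x b)"
    "\<And>x. x = (\<Sum>b\<in>B. r x b *\<^sub>R b)"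
    "\<And>c b. b \<in> B \<Longrightarrow> r (\<Sum>b\<in>B. c b *\<^sub>R b) b = c b"
proof
  have fin: "finite B" using assms by (simp add: independent_imp_finite)
  show "linear (\<lambda>x. representation B x b)" for b
    using assms by (intro linearI) (simp_all add: representation_add representation_scale)
  show eq: "x = (\<Sum>b\<in>B. representation B x b *\<^sub>R b)" for x
    using assms fin by (simp add: sum_representation_eq)
  show "representation B (\<Sum>b\<in>B. c b *\<^sub>R b) b = c b" if "b \<in> B" for c b
  proof -
    have "(\<Sum>b\<in>B. (representation B (\<Sum>b\<in>B. c b *\<^sub>R b) b - c b) *\<^sub>R b) = 0"
      using eq[of "\<Sum>b\<in>B. c b *\<^sub>R b"] by (simp add: scaleR_diff_left sum_subtractf)
    then show ?thesis
      using assms(1) fin that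
      unfolding independent_explicit by fastforce
  qed
qed

text \<open>Coordinates are bounded linear functionals, so a bounded set leaves finitely many values
  for each integer coefficient.\<close>

lemma lattice_finite_bounded:
  fixes M :: "'a::euclidean_space set"
  assumes "is_lattice M" "bounded S"
  shows "finite (M \<inter> S)"
proof -
  obtain B where B: "independent B" "span B = UNIV"
    and M: "M = {v. \<exists>c :: 'a \<Rightarrow> int. v = (\<Sum>b\<in>B. of_int (c b) *\<^sub>R b)}"
    using assms(1) unfolding is_lattice_def by auto
  have fin: "finite B" using B by (simp add: independent_imp_finite)
  obtain r where r: "\<And>b. linear (\<lambda>x. r x b)"
    "\<And>x. x = (\<Sum>b\<in>B. r x b *\<^sub>R b)"
    "\<And>c b. b \<in> B \<Longrightarrow> r (\<Sum>b\<in>B. c b *\<^sub>R b) b = c b"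
    using lattice_coordinates[OF B] by blast
  have "\<exists>N::int. \<forall>x\<in>S. \<bar>r x b\<bar> \<le> of_int N" for b
  proof -
    have "bounded ((\<lambda>x. r x b) ` S)"
      using assms(2) r(1) by (simp add: bounded_linear_image linear_conv_bounded_linear)
    then obtain a where "\<And>x. x \<in> S \<Longrightarrow> \<bar>r x b\<bar> \<le> a"
      by (auto simp: bounded_iff)
    then show ?thesis by (meson le_of_int_ceiling order_trans)
  qed
  then obtain N :: "'a \<Rightarrow> int" where N: "\<And>b x. x \<in> S \<Longrightarrow> \<bar>r x b\<bar> \<le> of_int (N b)"
    by metis
  have "M \<inter> S \<subseteq> (\<lambda>c. \<Sum>b\<in>B. of_int (c b) *\<^sub>R b) ` (Pi\<^sub>E B (\<lambda>b. {- N b..N b}))"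
  proof
    fix v assume v: "v \<in> M \<inter> S"
    then obtain c where c: "v = (\<Sum>b\<in>B. of_int (c b) *\<^sub>R b)" unfolding M by auto
    have "c b \<in> {- N b..N b}" if "b \<in> B" for b
    proof -
      have "r v b = of_int (c b)" unfolding c using r(3) that by auto
      then have "\<bar>of_int (c b) :: real\<bar> \<le> of_int (N b)" using N v by (metis IntD2)
      then show ?thesis by (simp add: abs_le_iff)
    qed
    then have "restrict c B \<in> Pi\<^sub>E B (\<lambda>b. {- N b..N b})" by auto
    moreover have "v = (\<Sum>b\<in>B. of_int (restrict c B b) *\<^sub>R b)" unfolding c by auto
    ultimately show "v \<in> (\<lambda>c. \<Sum>b\<in>B. of_int (c b) *\<^sub>R b) ` (Pi\<^sub>E B (\<lambda>b. {- N b..N b}))" by blast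
  qed
  then show ?thesis
    by (rule finite_subset) (intro finite_imageI finite_PiE fin, auto)
qed

text \<open>Rounding all coordinates down leaves a vector of the fundamental parallelepiped, whose
  norm is at most the sum of the norms of the basis vectors.\<close>

lemma lattice_relatively_dense:
  fixes M :: "'a::euclidean_space set"
  assumes "is_lattice M"
  shows "\<exists>R>0. \<forall>x. \<exists>p\<in>M. norm (x - p) \<le> R"
proof -
  obtain B where B: "independent B" "span B = UNIV"
    and M: "M = {v. \<exists>c :: 'a \<Rightarrow> int. v = (\<Sum>b\<in>B. of_int (c b) *\<^sub>R b)}"
    using assms(1) unfolding is_lattice_def by auto
  obtain r where r: "\<And>x. x = (\<Sum>b\<in>B. r x b *\<^sub>R b)"
    using lattice_coordinates[OF B] by metis
  have "\<exists>p\<in>M. norm (x - p) \<le> 1 + (\<Sum>b\<in>B. norm b)" for x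
  proof
    let ?p = "\<Sum>b\<in>B. of_int \<lfloor>r x b\<rfloor> *\<^sub>R b"
    show "?p \<in> M" unfolding M by auto
    have "x - ?p = (\<Sum>b\<in>B. frac (r x b) *\<^sub>R b)"
      by (subst r[of x]) (simp add: frac_def scaleR_diff_left sum_subtractf)
    also have "norm \<dots> \<le> (\<Sum>b\<in>B. norm b)"
      by (rule sum_norm_le) (simp add: frac_ge_0 frac_lt_1 less_imp_le mult_left_le_one_le)
    finally show "norm (x - ?p) \<le> 1 + (\<Sum>b\<in>B. norm b)" by simp
  qed
  moreover have "0 < 1 + (\<Sum>b\<in>B. norm b)" by (simp add: add_pos_nonneg sum_nonneg)
  ultimately show ?thesis by blast
qed

lemma lattice_zero: "is_lattice M \<Longrightarrow> 0 \<in> M"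
  unfolding is_lattice_def by (auto intro!: exI[of _ "\<lambda>_. 0"])

lemma lattice_diff: "is_lattice (M :: 'a::euclidean_space set) \<Longrightarrow> x \<in> M \<Longrightarrow> y \<in> M \<Longrightarrow> x - y \<in> M"
proof -
  assume "is_lattice M" "x \<in> M" "y \<in> M"
  then obtain B c d where M: "M = {v. \<exists>c :: 'a \<Rightarrow> int. v = (\<Sum>b\<in>B. of_int (c b) *\<^sub>R b)}"
    and "x = (\<Sum>b\<in>B. of_int (c b) *\<^sub>R b)" "y = (\<Sum>b\<in>B. of_int (d b) *\<^sub>R b)"
    unfolding is_lattice_def by blast
  then have "x - y = (\<Sum>b\<in>B. of_int (c b - d b) *\<^sub>R b)"
    by (simp add: sum_subtractf scaleR_diff_left)
  then show ?thesis unfolding M mem_Collect_eq by (rule exI[of _ "\<lambda>b. c b - d b"])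
qed

lemma lattice_add: "is_lattice M \<Longrightarrow> x \<in> M \<Longrightarrow> y \<in> M \<Longrightarrow> x + y \<in> M"
  using lattice_diff[of M x "0 - y"] lattice_diff[of M 0 y] lattice_zero[of M] by simp

text \<open>Packing bound: the balls of radius \<delta>/2 are disjoint, so their volumes add up
  inside S.\<close>

lemma separated_card_le:
  fixes F :: "'a::euclidean_space set"
  assumes "finite F" and sep: "\<And>x y. x \<in> F \<Longrightarrow> y \<in> F \<Longrightarrow> x \<noteq> y \<Longrightarrow> \<delta> \<le> dist x y"
    and sub: "\<And>x. x \<in> F \<Longrightarrow> ball x (\<delta>/2) \<subseteq> S" and S: "S \<in> lmeasurable" and "0 < \<delta>"
  shows "real (card F) * (unit_ball_vol DIM('a) * (\<delta>/2) ^ DIM('a)) \<le> measure lebesgue S"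
proof -
  have "measure lebesgue (\<Union>x\<in>F. ball x (\<delta>/2)) = (\<Sum>x\<in>F. measure lebesgue (ball x (\<delta>/2)))"
  proof (rule measure_UNION')
    show "pairwise (\<lambda>i j. disjnt (ball i (\<delta>/2)) (ball j (\<delta>/2))) F"
      unfolding pairwise_def disjnt_def using sep
      by (auto simp: disjoint_ballI)
  qed (use assms in auto)
  also have "\<dots> = real (card F) * (unit_ball_vol DIM('a) * (\<delta>/2) ^ DIM('a))"
    using \<open>0 < \<delta>\<close> by (simp add: content_ball)
  finally show ?thesis
    using measure_mono_fmeasurable[of "\<Union>x\<in>F. ball x (\<delta>/2)" S lebesgue] sub S \<open>finite F\<close>
    by (metis (no_types, lifting) UN_least fmeasurableD lmeasurable_ball sets.finite_UN)
qed

lemma covering_card_ge: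
  fixes F :: "'a::euclidean_space set"
  assumes "finite F" and sub: "S \<subseteq> (\<Union>x\<in>F. cball x r)" and S: "S \<in> sets lebesgue" and "0 \<le> r"
  shows "measure lebesgue S \<le> real (card F) * (unit_ball_vol DIM('a) * r ^ DIM('a))"
proof -
  have "measure lebesgue S \<le> measure lebesgue (\<Union>x\<in>F. cball x r)"
    by (rule measure_mono_fmeasurable[OF sub S]) (use assms in \<open>auto intro!: fmeasurable.finite_UN\<close>)
  also have "\<dots> \<le> (\<Sum>x\<in>F. measure lebesgue (cball x r))"
    by (rule measure_UNION_le) (use assms in auto)
  also have "\<dots> = real (card F) * (unit_ball_vol DIM('a) * r ^ DIM('a))"
    using \<open>0 \<le> r\<close> by (simp add: content_cball)
  finally show ?thesis .
qed


section \<open>The star map, and upper and lower bounds for point counts\<close>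

locale cut_and_project =
  fixes M :: "((real^'m) \<times> (real^'n)) set"
  assumes scheme: "cut_and_project_scheme M"
begin

abbreviation "L \<equiv> phys_lattice M"

lemma lattice: "is_lattice M"
  using scheme by (simp add: cut_and_project_scheme_def)

lemma star_eq: "(x, y) \<in> M \<Longrightarrow> star M x = y"
  using scheme unfolding star_def cut_and_project_scheme_def
  by (metis fst_conv inv_into_f_f snd_conv)

lemma physI: "(x, y) \<in> M \<Longrightarrow> x \<in> L"
  unfolding phys_lattice_def by force

lemma star_mem: "x \<in> L \<Longrightarrow> (x, star M x) \<in> M"
  unfolding phys_lattice_def using star_eq by force

lemma zero_phys: "0 \<in> L" and star_zero: "star M 0 = 0"
  using lattice_zero[OF lattice] physI star_eq by (auto simp: zero_prod_def)

lemma diff_phys: "x \<in> L \<Longrightarrow> y \<in> L \<Longrightarrow> x - y \<in> L"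
  and star_diff: "x \<in> L \<Longrightarrow> y \<in> L \<Longrightarrow> star M (x - y) = star M x - star M y"
  using lattice_diff[OF lattice star_mem star_mem] physI star_eq by fastforce+

lemma add_phys: "x \<in> L \<Longrightarrow> y \<in> L \<Longrightarrow> x + y \<in> L"
  and star_add: "x \<in> L \<Longrightarrow> y \<in> L \<Longrightarrow> star M (x + y) = star M x + star M y"
  using lattice_add[OF lattice star_mem star_mem] physI star_eq by fastforce+

lemma star_dense:
  assumes "0 < e"
  obtains x where "x \<in> L" "dist (star M x) y < e"
proof -
  have "y \<in> closure (snd ` M)"
    using scheme by (simp add: cut_and_project_scheme_def)
  then obtain z where z: "z \<in> snd ` M" "dist z y < e"
    using assms unfolding closure_approachable by blast
  then obtain x where "(x, z) \<in> M" by auto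
  then show ?thesis using that z physI star_eq by metis
qed

text \<open>The model set of a closed ball in internal space. A test function of bounded support
  sees only the points of one strip, and a strip is uniformly discrete.\<close>

definition "strip R = {x \<in> L. norm (star M x) \<le> R}"

lemma finite_strip: "bounded S \<Longrightarrow> finite (strip R \<inter> S)"
proof -
  assume "bounded S"
  then have "finite (M \<inter> (S \<times> cball 0 R))"
    by (intro lattice_finite_bounded lattice bounded_Times bounded_cball)
  then have "finite (fst ` (M \<inter> (S \<times> cball 0 R)))" by blast
  moreover have "strip R \<inter> S \<subseteq> fst ` (M \<inter> (S \<times> cball 0 R))"
    unfolding strip_def using star_mem by force
  ultimately show ?thesis by (rule rev_finite_subset)
qed

text \<open>A difference of two points of \<open>strip R\<close> lies in
  \<open>strip (2 * R)\<close>, which has only finitely many points in the unit ball.\<close>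

lemma strip_separated:
  obtains \<delta> where "0 < \<delta>" "\<And>x y. x \<in> strip R \<Longrightarrow> y \<in> strip R \<Longrightarrow> x \<noteq> y \<Longrightarrow> \<delta> \<le> dist x y"
proof -
  let ?F = "strip (2 * R) \<inter> cball 0 1 - {0}"
  have fin: "finite ?F" by (simp add: finite_strip)
  \<comment> \<open>The 1 covers pairs at distance more than 1 and keeps the minimum defined if
    \<open>?F\<close> is empty.\<close>
  define \<delta> where "\<delta> = Min (insert 1 (norm ` ?F))"
  have pos: "0 < \<delta>" unfolding \<delta>_def using fin by (subst Min_gr_iff) auto
  have "\<delta> \<le> dist x y" if "x \<in> strip R" "y \<in> strip R" "x \<noteq> y" for x y
  proof (cases "dist x y \<le> 1")
    case True
    have "norm (star M (x - y)) \<le> R + R"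
      using that norm_triangle_ineq4[of "star M x" "star M y"]
      by (simp add: strip_def star_diff)
    then have "x - y \<in> ?F" using that True by (auto simp: strip_def diff_phys dist_norm norm_minus_commute)
    then have "norm (x - y) \<in> insert 1 (norm ` ?F)" by blast
    then show ?thesis unfolding \<delta>_def dist_norm using fin by (intro Min_le) auto
  next
    case False
    then show ?thesis unfolding \<delta>_def using fin by (intro Min.coboundedI[THEN order_trans]) auto
  qed
  then show ?thesis using pos that by blast
qed

text \<open>Packing: the small balls around the counted points lie in the annulus widened by
  \<delta> on both sides. The volume of the unit ball cancels, leaving \<open>c\<close> as the
  inverse of (\<delta>/2)^m. The condition \<open>a + \<delta> \<le> s\<close> keeps the inner
  radius non-negative.\<close>

lemma annulus_count_bound:
  obtains c \<delta> where "0 < c" "0 < \<delta>" "\<And>a s. 0 \<le> a \<Longrightarrow> a + \<delta> \<le> s \<Longrightarrow>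
     real (card {x\<in>strip R. s - a \<le> norm x \<and> norm x \<le> s + a}) \<le>
        c * ((s + a + \<delta>) ^ CARD('m) - (s - a - \<delta>) ^ CARD('m))"
    "\<And>s. 0 \<le> s \<Longrightarrow> real (card {x\<in>strip R. norm x \<le> s}) \<le> c * (s + \<delta>) ^ CARD('m)"
proof -
  obtain \<delta> where d: "0 < \<delta>" "\<And>x y. x \<in> strip R \<Longrightarrow> y \<in> strip R \<Longrightarrow> x \<noteq> y \<Longrightarrow> \<delta> \<le> dist x y"
    using strip_separated by blast
  let ?v = "unit_ball_vol CARD('m)"
  have v: "0 < ?v" by simp
  let ?c = "1 / (\<delta>/2) ^ CARD('m)"
  have c: "0 < ?c" using d by simp
  have 1: "real (card {x\<in>strip R. s - a \<le> norm x \<and> norm x \<le> s + a}) \<le>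
        ?c * ((s + a + \<delta>) ^ CARD('m) - (s - a - \<delta>) ^ CARD('m))" if "0 \<le> a" "a + \<delta> \<le> s" for a s
  proof -
    let ?F = "{x\<in>strip R. s - a \<le> norm x \<and> norm x \<le> s + a}"
    let ?S = "cball 0 (s + a + \<delta>) - ball 0 (s - a - \<delta>) :: (real^'m) set"
    have fin: "finite ?F" by (rule finite_subset[OF _ finite_strip[of "cball 0 (s+a)"]]) auto
    have "real (card ?F) * (unit_ball_vol DIM(real^'m) * (\<delta>/2) ^ DIM(real^'m)) \<le> measure lebesgue ?S"
    proof (rule separated_card_le[OF fin])
      fix x assume x: "x \<in> ?F"
      show "ball x (\<delta>/2) \<subseteq> ?S"
      proof
        fix z assume z: "z \<in> ball x (\<delta>/2)"
        have "\<bar>norm x - norm z\<bar> \<le> norm (x - z)" by (rule norm_triangle_ineq3)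
        then have "\<bar>norm x - norm z\<bar> < \<delta>" using z d by (simp add: dist_norm)
        then show "z \<in> ?S" using x by auto
      qed
    qed (use d in auto)
    also have "measure lebesgue ?S = ?v * ((s + a + \<delta>) ^ CARD('m) - (s - a - \<delta>) ^ CARD('m))"
      using that d by (subst measurable_measure_Diff)
        (auto simp: content_cball content_ball subset_eq algebra_simps)
    finally have "?v * (real (card ?F) * (\<delta>/2) ^ CARD('m))
      \<le> ?v * ((s + a + \<delta>) ^ CARD('m) - (s - a - \<delta>) ^ CARD('m))"
      by (simp add: mult_ac)
    then have "real (card ?F) * (\<delta>/2) ^ CARD('m) \<le> (s + a + \<delta>) ^ CARD('m) - (s - a - \<delta>) ^ CARD('m)"
      using v by (rule mult_left_le_imp_le)
    then show ?thesis using d by (simp add: field_simps)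
  qed
  have 2: "real (card {x\<in>strip R. norm x \<le> s}) \<le> ?c * (s + \<delta>) ^ CARD('m)" if "0 \<le> s" for s
  proof -
    let ?F = "{x\<in>strip R. norm x \<le> s}"
    let ?S = "cball 0 (s + \<delta>) :: (real^'m) set"
    have fin: "finite ?F" by (rule finite_subset[OF _ finite_strip[of "cball 0 s"]]) auto
    have "real (card ?F) * (unit_ball_vol DIM(real^'m) * (\<delta>/2) ^ DIM(real^'m)) \<le> measure lebesgue ?S"
    proof (rule separated_card_le[OF fin])
      fix x assume x: "x \<in> ?F"
      show "ball x (\<delta>/2) \<subseteq> ?S"
      proof
        fix z assume z: "z \<in> ball x (\<delta>/2)"
        have "\<bar>norm x - norm z\<bar> \<le> norm (x - z)" by (rule norm_triangle_ineq3)
        then have "\<bar>norm x - norm z\<bar> < \<delta>" using z d by (simp add: dist_norm)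
        then show "z \<in> ?S" using x by auto
      qed
    qed (use d in auto)
    also have "measure lebesgue ?S = ?v * (s + \<delta>) ^ CARD('m)"
      using that d by (simp add: content_cball)
    finally have "?v * (real (card ?F) * (\<delta>/2) ^ CARD('m)) \<le> ?v * (s + \<delta>) ^ CARD('m)"
      by (simp add: mult_ac)
    then have "real (card ?F) * (\<delta>/2) ^ CARD('m) \<le> (s + \<delta>) ^ CARD('m)"
      using v by (rule mult_left_le_imp_le)
    then show ?thesis using d by (simp add: field_simps)
  qed
  show thesis using that[OF c d(1) 1 2] by blast
qed

text \<open>The leading terms of the two volumes cancel. This is the boundary error made when a sum
  over a large ball is shifted by a fixed vector.\<close>

lemma annulus_count_negligible:
  assumes "0 \<le> a"
  shows "((\<lambda>s. real (card {x\<in>strip R. s - a \<le> norm x \<and> norm x \<le> s + a}) / s ^ CARD('m)) \<longlongrightarrow> 0) at_top"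
proof -
  obtain c \<delta> where c: "0 < c" "0 < \<delta>" "\<And>a s. 0 \<le> a \<Longrightarrow> a + \<delta> \<le> s \<Longrightarrow>
     real (card {x\<in>strip R. s - a \<le> norm x \<and> norm x \<le> s + a}) \<le>
        c * ((s + a + \<delta>) ^ CARD('m) - (s - a - \<delta>) ^ CARD('m))"
    "\<And>s. 0 \<le> s \<Longrightarrow> real (card {x\<in>strip R. norm x \<le> s}) \<le> c * (s + \<delta>) ^ CARD('m)"
    by (rule annulus_count_bound[of R]) (rule that, assumption+)
  have lim: "((\<lambda>s. ((s + b) / s) ^ CARD('m)) \<longlongrightarrow> 1) at_top" for b :: real
  proof -
    have "((\<lambda>s::real. 1 + b / s) \<longlongrightarrow> 1 + 0) at_top"
      by (intro tendsto_intros tendsto_divide_0[OF tendsto_const] filterlim_at_top_imp_at_infinity filterlim_ident)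
    then have "((\<lambda>s::real. (s + b) / s) \<longlongrightarrow> 1) at_top"
      by (rule Lim_transform_eventually[OF tendsto_eq_rhs])
        (auto intro!: eventually_mono[OF eventually_gt_at_top[of 0]] simp: field_simps)
    from tendsto_power[OF this] show ?thesis by simp
  qed
  have "((\<lambda>s. c * (((s + (a + \<delta>)) / s) ^ CARD('m) - ((s + - (a + \<delta>)) / s) ^ CARD('m))) \<longlongrightarrow> c * (1 - 1)) at_top"
    by (intro tendsto_intros lim)
  then have lim0: "((\<lambda>s. c * (((s + (a + \<delta>)) / s) ^ CARD('m) - ((s + - (a + \<delta>)) / s) ^ CARD('m))) \<longlongrightarrow> 0) at_top"
    by simp
  show ?thesis
  proof (rule tendsto_sandwich[OF _ _ tendsto_const lim0])
    show "\<forall>\<^sub>F s in at_top. 0 \<le> real (card {x\<in>strip R. s - a \<le> norm x \<and> norm x \<le> s + a}) / s ^ CARD('m)"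
      using eventually_gt_at_top[of 0] by eventually_elim simp
    show "\<forall>\<^sub>F s in at_top. real (card {x\<in>strip R. s - a \<le> norm x \<and> norm x \<le> s + a}) / s ^ CARD('m)
       \<le> c * (((s + (a + \<delta>)) / s) ^ CARD('m) - ((s + - (a + \<delta>)) / s) ^ CARD('m))"
      using eventually_ge_at_top[of "a + \<delta>"]
    proof eventually_elim
      case (elim s)
      then have "0 < s" using assms c by simp
      then have "real (card {x\<in>strip R. s - a \<le> norm x \<and> norm x \<le> s + a}) / s ^ CARD('m)
        \<le> c * ((s + a + \<delta>) ^ CARD('m) - (s - a - \<delta>) ^ CARD('m)) / s ^ CARD('m)"
        using c(3)[OF assms elim] by (intro divide_right_mono) auto
      also have "\<dots> = c * (((s + (a + \<delta>)) / s) ^ CARD('m) - ((s + - (a + \<delta>)) / s) ^ CARD('m))"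
        by (simp add: power_divide diff_divide_distrib[symmetric] algebra_simps)
      finally show ?case .
    qed
  qed
qed

lemma strip_count_upper:
  obtains c where "0 < c" "\<And>s. 1 \<le> s \<Longrightarrow> real (card {x\<in>strip R. norm x \<le> s}) \<le> c * s ^ CARD('m)"
proof -
  obtain c \<delta> where c: "0 < c" "0 < \<delta>"
    "\<And>s. 0 \<le> s \<Longrightarrow> real (card {x\<in>strip R. norm x \<le> s}) \<le> c * (s + \<delta>) ^ CARD('m)"
    by (rule annulus_count_bound[of R]) (rule that, assumption+)
  have "real (card {x\<in>strip R. norm x \<le> s}) \<le> (c * (1 + \<delta>) ^ CARD('m)) * s ^ CARD('m)" if "1 \<le> s" for s
  proof -
    have "s + \<delta> \<le> (1 + \<delta>) * s" using that c by (simp add: algebra_simps)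
    then have "(s + \<delta>) ^ CARD('m) \<le> ((1 + \<delta>) * s) ^ CARD('m)"
      using that c by (intro power_mono) auto
    then have "c * (s + \<delta>) ^ CARD('m) \<le> c * ((1 + \<delta>) * s) ^ CARD('m)" using c by simp
    then show ?thesis using c(3)[of s] that by (simp add: power_mult_distrib mult_ac)
  qed
  then show ?thesis using that[of "c * (1 + \<delta>) ^ CARD('m)"] c by simp
qed

text \<open>A lattice point within R0 of (x, y) has its internal component in a fixed compact ball
  around y. By density and compactness, finitely many translations from L suffice to move that
  component into \<open>ball y r\<close>, and they move the physical component by a bounded
  amount.\<close>

lemma window_relatively_dense:
  assumes "0 < r"
  obtains R where "0 < R" "\<And>x. \<exists>p\<in>L. star M p \<in> ball y r \<and> norm (x - p) \<le> R"
proof -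
  obtain R0 where R0: "R0 > 0" "\<And>z. \<exists>p\<in>M. norm (z - p) \<le> R0"
    using lattice_relatively_dense[OF lattice] by blast
  have "cball y R0 \<subseteq> (\<Union>t\<in>L. ball (y + star M t) r)"
  proof
    fix z
    obtain t where "t \<in> L" "dist (star M t) (z - y) < r" using star_dense[OF assms] by blast
    then show "z \<in> (\<Union>t\<in>L. ball (y + star M t) r)"
      by (auto simp: dist_norm algebra_simps intro!: bexI[of _ t])
  qed
  then obtain T where T: "T \<subseteq> L" "finite T" "cball y R0 \<subseteq> (\<Union>t\<in>T. ball (y + star M t) r)"
    using compactE_image[of "cball y R0" L "\<lambda>t. ball (y + star M t) r"] by auto
  have "\<exists>p\<in>L. star M p \<in> ball y r \<and> norm (x - p) \<le> R0 + (\<Sum>t\<in>T. norm t)" for x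
  proof -
    obtain p where p: "p \<in> M" "norm ((x, y) - p) \<le> R0" using R0 by blast
    then have fp: "fst p \<in> L" "star M (fst p) = snd p" using physI star_eq by (metis prod.collapse)+
    have n: "norm (x - fst p) \<le> R0" "norm (y - snd p) \<le> R0"
      using p(2) norm_fst_le[of "x - fst p" "y - snd p"] norm_snd_le[of "y - snd p" "x - fst p"] by (auto simp: minus_prod_def)
    then have "snd p \<in> cball y R0" by (simp add: dist_norm)
    then obtain t where t: "t \<in> T" "snd p \<in> ball (y + star M t) r" using T by blast
    have tL: "t \<in> L" using t T by auto
    have "norm (x - (fst p - t)) \<le> norm (x - fst p) + norm t"
      using norm_triangle_ineq[of "x - fst p" t] by (simp add: algebra_simps)
    also have "norm t \<le> (\<Sum>t\<in>T. norm t)" using t T by (intro member_le_sum) auto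
    finally have "norm (x - (fst p - t)) \<le> R0 + (\<Sum>t\<in>T. norm t)" using n by simp
    moreover have "star M (fst p - t) \<in> ball y r"
      using t fp tL by (simp add: star_diff dist_norm algebra_simps)
    ultimately show ?thesis using diff_phys[OF fp(1) tL] by blast
  qed
  moreover have "0 < R0 + (\<Sum>t\<in>T. norm t)" using R0 by (simp add: add_pos_nonneg sum_nonneg)
  ultimately show ?thesis using that by blast
qed

text \<open>Balls of radius R around the counted points cover the ball of radius s - R, which is at
  least s/2 once s is at least 2 R.\<close>

lemma window_count_lower:
  assumes "0 < r"
  obtains c s0 where "0 < c"
    "\<And>s. s0 \<le> s \<Longrightarrow> c * s ^ CARD('m) \<le> real (card {x\<in>L. star M x \<in> ball y r \<and> norm x \<le> s})"
proof -
  obtain R where R: "0 < R" "\<And>x. \<exists>p\<in>L. star M p \<in> ball y r \<and> norm (x - p) \<le> R"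
    using window_relatively_dense[OF assms, of y] by blast
  have "(1 / (2 * R) ^ CARD('m)) * s ^ CARD('m) \<le> real (card {x\<in>L. star M x \<in> ball y r \<and> norm x \<le> s})"
    if "2 * R \<le> s" for s
  proof -
    let ?F = "{x\<in>L. star M x \<in> ball y r \<and> norm x \<le> s}"
    have "?F \<subseteq> strip (norm y + r) \<inter> cball 0 s"
    proof
      fix x assume x: "x \<in> ?F"
      then have "norm (star M x) \<le> norm y + r"
        using norm_triangle_ineq2[of "star M x" y] by (simp add: dist_norm norm_minus_commute)
      then show "x \<in> strip (norm y + r) \<inter> cball 0 s" using x by (simp add: strip_def)
    qed
    then have fin: "finite ?F" using finite_strip[of "cball 0 s"] by (meson bounded_cball finite_subset)
    have sub: "cball 0 (s - R) \<subseteq> (\<Union>x\<in>?F. cball x R)"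
    proof
      fix z :: "real^'m" assume z: "z \<in> cball 0 (s - R)"
      obtain p where p: "p \<in> L" "star M p \<in> ball y r" "norm (z - p) \<le> R" using R by blast
      have "norm p \<le> norm z + norm (z - p)" using norm_triangle_sub[of p z] by (simp add: norm_minus_commute)
      then show "z \<in> (\<Union>x\<in>?F. cball x R)" using p z
        by (intro UN_I[of p]) (auto simp: dist_norm norm_minus_commute)
    qed
    have "measure lebesgue (cball 0 (s - R) :: (real^'m) set)
       \<le> real (card ?F) * (unit_ball_vol DIM(real^'m) * R ^ DIM(real^'m))"
      by (rule covering_card_ge[OF fin sub]) (use R in auto)
    then have "unit_ball_vol CARD('m) * (s - R) ^ CARD('m)
       \<le> unit_ball_vol CARD('m) * (real (card ?F) * R ^ CARD('m))"
      using that R by (simp add: content_cball mult_ac)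
    then have 1: "(s - R) ^ CARD('m) \<le> real (card ?F) * R ^ CARD('m)"
      by (rule mult_left_le_imp_le) simp
    have "(s / 2) ^ CARD('m) \<le> (s - R) ^ CARD('m)"
      using that R by (intro power_mono) auto
    then have "s ^ CARD('m) \<le> 2 ^ CARD('m) * (s - R) ^ CARD('m)"
      by (simp add: power_divide field_simps)
    also have "\<dots> \<le> 2 ^ CARD('m) * (real (card ?F) * R ^ CARD('m))"
      using 1 by (rule mult_left_mono) simp
    finally have "s ^ CARD('m) \<le> real (card ?F) * (2 * R) ^ CARD('m)"
      by (simp add: power_mult_distrib mult_ac)
    then show ?thesis using R by (simp add: divide_le_eq)
  qed
  moreover have "0 < 1 / (2 * R) ^ CARD('m)" using R by simp
  ultimately show ?thesis using that by blast
qed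

end

section \<open>Linear images of Lebesgue measure\<close>

lemma measure_lborel_open_pos:
  assumes "open S" "S \<noteq> {}" "emeasure lborel S < \<infinity>"
  shows "0 < measure lborel S"
proof -
  have "S \<notin> null_sets lborel"
    using assms open_not_negligible negligible_iff_null_sets null_sets_completionI by blast
  then have "emeasure lborel S \<noteq> 0" using assms(1) by auto
  then show ?thesis using assms(3)
    by (metis emeasure_eq_ennreal_measure ennreal_0 infinity_ennreal_def less_irrefl zero_less_measure_iff)
qed

text \<open>Uniqueness of Haar measure, by exchanging the two integrals in the convolution of an indicator
  with that of a ball.\<close>

lemma distr_linear_lborel:
  fixes A :: "'a::euclidean_space \<Rightarrow> 'a"
  assumes A: "linear A" and inj: "inj A"
  obtains c where "0 < c" "distr lborel borel A = density lborel (\<lambda>_. ennreal c)"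
proof -
  obtain B where B: "linear B" "\<And>x. A (B x) = x" "\<And>x. B (A x) = x"
    using linear_injective_isomorphism[OF A inj] by blast
  have mA [measurable]: "A \<in> borel_measurable borel"
    using A by (simp add: borel_measurable_continuous_onI linear_continuous_on linear_conv_bounded_linear)
  have AmE: "A -` E \<in> sets borel" if "E \<in> sets borel" for E
    using measurable_sets_borel[OF mA that] by simp
  let ?D = "ball (0::'a) 1"
  have key: "emeasure lborel (A -` E) * emeasure lborel ?D = emeasure lborel (A -` ?D) * emeasure lborel E"
    if E [measurable]: "E \<in> sets borel" for E
  proof -
    define f g :: "'a \<Rightarrow> ennreal" where "f = indicator E" and "g = indicator ?D"
    have [measurable]: "f \<in> borel_measurable borel" "g \<in> borel_measurable borel"
      unfolding f_def g_def by (auto intro!: borel_measurable_indicator)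
    have If: "(\<integral>\<^sup>+x. f x \<partial>lborel) = emeasure lborel E" "(\<integral>\<^sup>+x. f (A x) \<partial>lborel) = emeasure lborel (A -` E)"
      using AmE[OF E] by (auto simp: f_def indicator_vimage[symmetric] o_def simp flip: nn_integral_indicator)
    have Ig: "(\<integral>\<^sup>+x. g x \<partial>lborel) = emeasure lborel ?D" "(\<integral>\<^sup>+x. g (A x) \<partial>lborel) = emeasure lborel (A -` ?D)"
      using AmE[of ?D] by (auto simp: g_def indicator_vimage[symmetric] o_def simp flip: nn_integral_indicator)
    have g_minus: "g (- x) = g x" for x by (simp add: g_def indicator_def)
    have tr: "(\<integral>\<^sup>+x. h (a + x) \<partial>lborel) = (\<integral>\<^sup>+x. h x \<partial>lborel)"
      if [measurable]: "h \<in> borel_measurable borel" for h :: "'a \<Rightarrow> ennreal" and a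
    proof -
      have "(\<integral>\<^sup>+x. h x \<partial>lborel) = (\<integral>\<^sup>+x. h x \<partial>distr lborel borel ((+) a))"
        by (simp add: lborel_distr_plus)
      then show ?thesis by (simp add: nn_integral_distr)
    qed
    have tr2: "(\<integral>\<^sup>+y. f (y + A x) \<partial>lborel) = emeasure lborel E" for x
      using tr[of f "A x"] by (simp add: add.commute If)
    have "emeasure lborel (A -` E) * emeasure lborel ?D = (\<integral>\<^sup>+x. f (A x) * emeasure lborel ?D \<partial>lborel)"
      by (simp add: nn_integral_multc If)
    also have "\<dots> = (\<integral>\<^sup>+x. (\<integral>\<^sup>+y. f (A x) * g (- A x + y) \<partial>lborel) \<partial>lborel)"
    proof (rule nn_integral_cong)
      fix x
      have "(\<integral>\<^sup>+y. f (A x) * g (- A x + y) \<partial>lborel) = f (A x) * (\<integral>\<^sup>+y. g (- A x + y) \<partial>lborel)"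
        by (rule nn_integral_cmult) measurable
      also have "(\<integral>\<^sup>+y. g (- A x + y) \<partial>lborel) = (\<integral>\<^sup>+y. g y \<partial>lborel)"
        by (rule tr) measurable
      also have "\<dots> = emeasure lborel ?D" by (rule Ig)
      finally show "f (A x) * emeasure lborel ?D = (\<integral>\<^sup>+y. f (A x) * g (- A x + y) \<partial>lborel)"
        by simp
    qed
    also have "\<dots> = (\<integral>\<^sup>+y. (\<integral>\<^sup>+x. f (A x) * g (- A x + y) \<partial>lborel) \<partial>lborel)"
      by (rule lborel_pair.Fubini') measurable
    \<comment> \<open>The inner variable is shifted by B y: then A (B y + x) = y + A x, and the
      argument of g becomes - A x, where g is even. Now f carries the y-integral and g the
      x-integral.\<close>
    also have "\<dots> = (\<integral>\<^sup>+y. (\<integral>\<^sup>+x. f (A (B y + x)) * g (- A (B y + x) + y) \<partial>lborel) \<partial>lborel)"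
      by (intro nn_integral_cong tr[symmetric]) measurable
    also have "\<dots> = (\<integral>\<^sup>+y. (\<integral>\<^sup>+x. f (y + A x) * g (A x) \<partial>lborel) \<partial>lborel)"
      using A B g_minus by (simp add: linear_add)
    also have "\<dots> = (\<integral>\<^sup>+x. (\<integral>\<^sup>+y. f (y + A x) * g (A x) \<partial>lborel) \<partial>lborel)"
      by (rule lborel_pair.Fubini') measurable
    also have "\<dots> = (\<integral>\<^sup>+x. emeasure lborel E * g (A x) \<partial>lborel)"
      by (simp add: nn_integral_multc tr2)
    also have "\<dots> = emeasure lborel (A -` ?D) * emeasure lborel E"
      by (simp add: nn_integral_cmult mult.commute Ig)
    finally show ?thesis .
  qed
  \<comment> \<open>By \<open>key\<close> the measure of the preimage is proportional to that of the
    set; the factor is read off at the unit ball.\<close>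
  define c where "c = measure lborel (A -` ?D) / measure lborel ?D"
  have "bounded (A -` ?D)"
  proof -
    have "A -` ?D \<subseteq> B ` ?D"
      by (metis B(3) image_eqI subsetI vimageE)
    moreover have "bounded (B ` ?D)" using B(1) by (simp add: bounded_linear_image linear_conv_bounded_linear)
    ultimately show ?thesis by (rule bounded_subset[rotated])
  qed
  then have finA: "emeasure lborel (A -` ?D) < \<infinity>" by (rule emeasure_bounded_finite)
  have opA: "open (A -` ?D)"
    using A by (intro open_vimage) (auto simp: linear_continuous_on linear_conv_bounded_linear)
  have "0 \<in> A -` ?D" using A by (simp add: linear_0)
  then have posA: "0 < measure lborel (A -` ?D)"
    using opA by (intro measure_lborel_open_pos finA) auto
  have posD: "0 < measure lborel ?D" by (simp add: content_ball)
  show thesis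
  proof
    show "0 < c" using posA posD by (simp add: c_def)
    show "distr lborel borel A = density lborel (\<lambda>_. ennreal c)"
    proof (rule measure_eqI)
      fix E assume "E \<in> sets (distr lborel borel A)"
      then have E: "E \<in> sets borel" by simp
      have "emeasure (distr lborel borel A) E = emeasure lborel (A -` E)"
        using E by (simp add: emeasure_distr)
      also have "\<dots> = ennreal c * emeasure lborel E"
      proof -
        have D: "emeasure lborel ?D = ennreal (measure lborel ?D)"
          by (simp add: emeasure_eq_ennreal_measure emeasure_ball)
        have A': "emeasure lborel (A -` ?D) = ennreal (measure lborel (A -` ?D))"
          using finA by (simp add: emeasure_eq_ennreal_measure)
        have "emeasure lborel (A -` E) = emeasure lborel (A -` E) * emeasure lborel ?D / emeasure lborel ?D"
          using D posD by (simp add: ennreal_mult_divide_eq)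
        also have "\<dots> = emeasure lborel (A -` ?D) * emeasure lborel E / emeasure lborel ?D"
          using key[OF E] by simp
        also have "\<dots> = emeasure lborel (A -` ?D) / emeasure lborel ?D * emeasure lborel E"
          by (simp add: ennreal_times_divide mult.commute)
        also have "emeasure lborel (A -` ?D) / emeasure lborel ?D = ennreal c"
          unfolding A' D c_def using posD posA by (simp add: divide_ennreal)
        finally show ?thesis .
      qed
      also have "\<dots> = emeasure (density lborel (\<lambda>_. ennreal c)) E"
        using E by (simp add: emeasure_density nn_integral_cmult)
      finally show "emeasure (distr lborel borel A) E = emeasure (density lborel (\<lambda>_. ennreal c)) E" .
    qed simp
  qed
qed

lemma lborel_integral_linear:
  fixes A :: "'a::euclidean_space \<Rightarrow> 'a" and f :: "'a \<Rightarrow> 'b::{banach, second_countable_topology}"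
  assumes A: "linear A" and c: "0 < c" "distr lborel borel A = density lborel (\<lambda>_. ennreal c)"
    and f: "f \<in> borel_measurable borel"
  shows "(\<integral>x. f (A x) \<partial>lborel) = c *\<^sub>R (\<integral>x. f x \<partial>lborel)"
proof -
  have mA: "A \<in> borel_measurable borel"
    using A by (simp add: borel_measurable_continuous_onI linear_continuous_on linear_conv_bounded_linear)
  have "(\<integral>x. f (A x) \<partial>lborel) = (\<integral>x. f x \<partial>distr lborel borel A)"
    by (rule integral_distr[symmetric]) (use f mA in auto)
  also have "\<dots> = (\<integral>x. c *\<^sub>R f x \<partial>lborel)"
    unfolding c(2) by (rule integral_density) (use f c in auto)
  finally show ?thesis by simp
qed

lemma lborel_integral_translate:
  fixes f :: "'a::euclidean_space \<Rightarrow> 'b::{banach, second_countable_topology}"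
  assumes "f \<in> borel_measurable borel"
  shows "(\<integral>x. f (a + x) \<partial>lborel) = (\<integral>x. f x \<partial>lborel)"
proof -
  have "(\<integral>x. f x \<partial>lborel) = (\<integral>x. f x \<partial>distr lborel borel ((+) a))"
    by (simp add: lborel_distr_plus)
  also have "\<dots> = (\<integral>x. f (a + x) \<partial>lborel)"
    by (rule integral_distr) (use assms in auto)
  finally show ?thesis by simp
qed

lemma lborel_integral_reflect:
  fixes f :: "'a::euclidean_space \<Rightarrow> 'b::{banach, second_countable_topology}"
  assumes "f \<in> borel_measurable borel"
  shows "(\<integral>x. f (a - x) \<partial>lborel) = (\<integral>x. f x \<partial>lborel)"
proof -
  have "(lborel :: 'a measure) = distr lborel borel (\<lambda>x. a - x)"
    using lborel_affine[of "-1" a] by (simp add: density_1)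
  then have "(\<integral>x. f x \<partial>lborel) = (\<integral>x. f x \<partial>distr lborel borel (\<lambda>x. a - x))" by simp
  also have "\<dots> = (\<integral>x. f (a - x) \<partial>lborel)"
    by (rule integral_distr) (use assms in auto)
  finally show ?thesis by simp
qed

lemma integrable_continuous_bounded_support:
  fixes f :: "'a::euclidean_space \<Rightarrow> 'b::{banach, second_countable_topology}"
  assumes "continuous_on UNIV f" "\<And>x. x \<notin> cball 0 R \<Longrightarrow> f x = 0"
  shows "integrable lborel f"
proof -
  have "integrable lborel (\<lambda>x. indicator (cball 0 R) x *\<^sub>R f x)"
    using assms(1) by (intro borel_integrable_compact) (auto intro: continuous_on_subset)
  moreover have "(\<lambda>x. indicator (cball 0 R) x *\<^sub>R f x) = f"
    using assms(2) by (force simp: indicator_def)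
  ultimately show ?thesis by simp
qed

text \<open>The set where f does not vanish is null by the integral and open by continuity; a
  nonempty open set is not null.\<close>

lemma integral_continuous_nonneg_eq_0:
  fixes f :: "'a::euclidean_space \<Rightarrow> real"
  assumes f: "continuous_on UNIV f" "\<And>x. 0 \<le> f x" "integrable lborel f" "(\<integral>x. f x \<partial>lborel) = 0"
  shows "f x = 0"
proof (rule ccontr)
  assume nz: "f x \<noteq> 0"
  have "AE x in lborel. f x = 0"
    using integral_nonneg_eq_0_iff_AE[OF f(3)] f by simp
  then have "AE x in lebesgue. f x = 0" by (rule AE_completion)
  then obtain N where "{x \<in> space lebesgue. f x \<noteq> 0} \<subseteq> N" "N \<in> null_sets lebesgue"
    by (auto simp: eventually_ae_filter)
  then have neg: "negligible {x. f x \<noteq> 0}"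
    by (auto simp: negligible_iff_null_sets[symmetric] intro: negligible_subset)
  have "open {x. f x \<noteq> 0}"
    using f(1) by (intro open_Collect_neq) auto
  then show False using open_not_negligible neg nz by blast
qed

section \<open>Fourier uniqueness\<close>

text \<open>\<open>fourier\<close> integrates over the completed measure; for Borel functions the
  computation moves to \<open>lborel\<close>, where translation, image measure and Fubini rules
  apply.\<close>

lemma fourier_lborel:
  assumes "f \<in> borel_measurable borel"
  shows "fourier f k = (\<integral>x. exp (- (2 * of_real pi * \<i> * of_real (k \<bullet> x))) * f x \<partial>lborel)"
  unfolding fourier_def using assms by (intro integral_completion) measurable

text \<open>The complex span of the kernels of \<open>fourier\<close>, all real frequencies allowed.
  A vanishing transform thus means orthogonality to the whole set, and products stay inside because
  frequencies add.\<close>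

inductive_set trig_poly :: "(real^'n \<Rightarrow> complex) set" where
  monom: "(\<lambda>x. c * exp (- (2 * of_real pi * \<i> * of_real (k \<bullet> x)))) \<in> trig_poly"
| add: "f \<in> trig_poly \<Longrightarrow> g \<in> trig_poly \<Longrightarrow> (\<lambda>x. f x + g x) \<in> trig_poly"

lemma trig_poly_mult_monom:
  assumes "f \<in> trig_poly"
  shows "(\<lambda>x. f x * (c * exp (- (2 * of_real pi * \<i> * of_real (k \<bullet> x))))) \<in> trig_poly"
  using assms
proof induction
  case (monom d l)
  have "(\<lambda>x. d * exp (- (2 * of_real pi * \<i> * of_real (l \<bullet> x))) * (c * exp (- (2 * of_real pi * \<i> * of_real (k \<bullet> x)))))
    = (\<lambda>x. (d * c) * exp (- (2 * of_real pi * \<i> * of_real ((l + k) \<bullet> x))))"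
    by (auto simp: inner_add_left algebra_simps simp flip: exp_add)
  then show ?case by (simp only: trig_poly.monom)
qed (simp add: ring_distribs trig_poly.add)

lemma trig_poly_mult:
  assumes "f \<in> trig_poly" "g \<in> trig_poly"
  shows "(\<lambda>x. f x * g x) \<in> trig_poly"
  using assms(2)
proof induction
  case (monom c k)
  show ?case using trig_poly_mult_monom[OF assms(1)] .
qed (simp add: ring_distribs trig_poly.add)

lemma trig_poly_continuous:
  assumes "f \<in> trig_poly" shows "continuous_on S f"
  using assms by induction (auto intro!: continuous_intros)

lemma trig_poly_orthogonal:
  assumes h: "continuous_on UNIV h" "\<And>x. x \<notin> cball 0 R \<Longrightarrow> h x = 0"
    and z: "\<And>k. fourier h k = 0" and "t \<in> trig_poly"
  shows "(\<integral>x. t x * h x \<partial>lborel) = 0"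
  using assms(4)
proof induction
  case (monom c k)
  have hm: "h \<in> borel_measurable borel" using h by (simp add: borel_measurable_continuous_onI)
  show ?case using z[of k] by (simp add: fourier_lborel[OF hm] mult.assoc)
next
  case (add f g)
  have i: "integrable lborel (\<lambda>x. f x * h x)" if "f \<in> trig_poly" for f
    by (rule integrable_continuous_bounded_support[of _ R])
      (auto intro!: continuous_on_mult trig_poly_continuous[OF that] simp: h)
  show ?case using add i[OF add(1)] i[OF add(2)] by (simp add: ring_distribs)
qed

text \<open>The Stone-Weierstrass theorem used here is about real functions, so the ring consists of
  the real-valued trigonometric polynomials.\<close>

lemma trig_poly_ring:
  "function_ring_on {t. (\<lambda>x. complex_of_real (t x)) \<in> trig_poly} (cball (0::real^'n) R)"
proof
  fix f :: "real^'n \<Rightarrow> real" assume f: "f \<in> {t. (\<lambda>x. complex_of_real (t x)) \<in> trig_poly}"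
  then have "continuous_on (cball 0 R) (\<lambda>x. Re (complex_of_real (f x)))"
    by (intro continuous_intros trig_poly_continuous) simp
  then show "continuous_on (cball 0 R) f" by simp
next
  fix f g :: "real^'n \<Rightarrow> real" assume "f \<in> {t. (\<lambda>x. complex_of_real (t x)) \<in> trig_poly}"
   "g \<in> {t. (\<lambda>x. complex_of_real (t x)) \<in> trig_poly}"
  then show "(\<lambda>x. f x + g x) \<in> {t. (\<lambda>x. complex_of_real (t x)) \<in> trig_poly}"
    "(\<lambda>x. f x * g x) \<in> {t. (\<lambda>x. complex_of_real (t x)) \<in> trig_poly}"
    by (auto simp: trig_poly.add trig_poly_mult)
next
  show "(\<lambda>_. c) \<in> {t::real^'n \<Rightarrow> real. (\<lambda>x. complex_of_real (t x)) \<in> trig_poly}" for c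
    using trig_poly.monom[of "of_real c" 0] by simp
next
  fix x y :: "real^'n" assume "x \<noteq> y"
  \<comment> \<open>Scaled so that a quarter period lies between y and x: the sine centred at y is 0
    at y and 1 at x.\<close>
  define k where "k = (1 / (4 * (norm (x - y))\<^sup>2)) *\<^sub>R (x - y)"
  have k: "k \<bullet> (x - y) = 1 / 4"
    using \<open>x \<noteq> y\<close> by (simp add: k_def power2_norm_eq_inner[symmetric])
  let ?t = "\<lambda>z. sin (2 * pi * (k \<bullet> (z - y)))"
  have "complex_of_real (?t z) =
     (exp (- (2 * of_real pi * \<i> * of_real (k \<bullet> y))) / (2 * \<i>)) * exp (- (2 * of_real pi * \<i> * of_real ((- k) \<bullet> z)))
   + (- exp (2 * of_real pi * \<i> * of_real (k \<bullet> y)) / (2 * \<i>)) * exp (- (2 * of_real pi * \<i> * of_real (k \<bullet> z)))" for z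
  proof -
    have "complex_of_real (?t z) = sin (of_real (2 * pi * (k \<bullet> (z - y))))" by (rule sin_of_real[symmetric])
    also have "\<dots> = (exp (\<i> * of_real (2 * pi * (k \<bullet> (z - y)))) - exp (- (\<i> * of_real (2 * pi * (k \<bullet> (z - y)))))) / (2 * \<i>)"
      by (rule sin_exp_eq)
    also have "exp (\<i> * of_real (2 * pi * (k \<bullet> (z - y)))) =
       exp (- (2 * of_real pi * \<i> * of_real (k \<bullet> y))) * exp (- (2 * of_real pi * \<i> * of_real ((- k) \<bullet> z)))"
      by (simp add: inner_diff_right algebra_simps flip: exp_add)
    also have "exp (- (\<i> * of_real (2 * pi * (k \<bullet> (z - y))))) =
       exp (2 * of_real pi * \<i> * of_real (k \<bullet> y)) * exp (- (2 * of_real pi * \<i> * of_real (k \<bullet> z)))"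
      by (simp add: inner_diff_right algebra_simps flip: exp_add)
    finally show ?thesis by (simp add: field_simps)
  qed
  then have *: "?t \<in> {t. (\<lambda>x. complex_of_real (t x)) \<in> trig_poly}"
    by (simp only: mem_Collect_eq) (intro trig_poly.intros)
  have "2 * pi * (k \<bullet> (x - y)) = pi / 2" unfolding k by simp
  then have "?t x \<noteq> ?t y" by (simp only: diff_self inner_zero_right mult_zero_right sin_zero sin_pi_half)
  then show "\<exists>f\<in>{t. (\<lambda>x. complex_of_real (t x)) \<in> trig_poly}. f x \<noteq> f y" using * by (rule bexI)
qed simp

text \<open>Let g be the real part of h and t a real trigonometric polynomial within e of g on the
  ball. Since t is real, the integral of t g is the real part of the integral of t h, which is 0.
  Hence the integral of g^2 equals that of (g - t) g and is at most e times the integral of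
  |g|.\<close>

lemma fourier_eq_0_imp_Re_eq_0:
  assumes h: "continuous_on UNIV h" "\<And>x. x \<notin> cball 0 R \<Longrightarrow> h x = 0"
    and z: "\<And>k. fourier h k = 0"
  shows "Re (h x) = 0"
proof -
  let ?g = "\<lambda>x. Re (h x)"
  have g: "continuous_on UNIV ?g" "\<And>x. x \<notin> cball 0 R \<Longrightarrow> ?g x = 0"
    using h by (auto intro!: continuous_intros)
  have ig: "integrable lborel ?g" by (rule integrable_continuous_bounded_support[OF g])
  have ig2: "integrable lborel (\<lambda>x. ?g x ^ 2)"
    by (rule integrable_continuous_bounded_support[of _ R]) (use g h in \<open>auto intro!: continuous_intros\<close>)
  have le: "(\<integral>x. ?g x ^ 2 \<partial>lborel) \<le> e * (\<integral>x. \<bar>?g x\<bar> \<partial>lborel)" if e: "0 < e" for e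
  proof -
    interpret function_ring_on "{t. (\<lambda>x. complex_of_real (t x)) \<in> trig_poly}" "cball (0::real^'b) R"
      by (rule trig_poly_ring)
    obtain t where t: "(\<lambda>x. complex_of_real (t x)) \<in> trig_poly" "\<And>x. x \<in> cball 0 R \<Longrightarrow> \<bar>?g x - t x\<bar> < e"
      using Stone_Weierstrass_basic[OF continuous_on_subset[OF g(1)] e] by auto
    have ct: "continuous_on UNIV t"
    proof -
      have "continuous_on UNIV (\<lambda>x. Re (complex_of_real (t x)))"
        using t by (intro continuous_intros trig_poly_continuous)
      then show ?thesis by simp
    qed
    have it: "integrable lborel (\<lambda>x. t x * ?g x)"
      by (rule integrable_continuous_bounded_support[of _ R]) (use g h ct in \<open>auto intro!: continuous_intros\<close>)
    have ith: "integrable lborel (\<lambda>x. complex_of_real (t x) * h x)"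
      by (rule integrable_continuous_bounded_support[of _ R]) (use g h ct in \<open>auto intro!: continuous_intros\<close>)
    have "0 = Re (\<integral>x. complex_of_real (t x) * h x \<partial>lborel)"
      using trig_poly_orthogonal[OF h z t(1)] by simp
    also have "\<dots> = (\<integral>x. t x * ?g x \<partial>lborel)"
      using integral_Re[OF ith] by simp
    finally have "(\<integral>x. ?g x ^ 2 \<partial>lborel) = (\<integral>x. ?g x ^ 2 - t x * ?g x \<partial>lborel)"
      using it ig2 by simp
    also have "\<dots> \<le> (\<integral>x. e * \<bar>?g x\<bar> \<partial>lborel)"
    proof (rule integral_mono)
      show "?g x ^ 2 - t x * ?g x \<le> e * \<bar>?g x\<bar>" for x
      proof (cases "x \<in> cball 0 R")
        case True
        have "?g x ^ 2 - t x * ?g x = (?g x - t x) * ?g x" by (simp add: power2_eq_square algebra_simps)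
        also have "\<dots> \<le> \<bar>?g x - t x\<bar> * \<bar>?g x\<bar>" by (metis abs_ge_self abs_mult)
        also have "\<dots> \<le> e * \<bar>?g x\<bar>" using t(2)[OF True] by (intro mult_right_mono) auto
        finally show ?thesis .
      qed (use g in simp)
    qed (use it ig2 ig in auto)
    finally show ?thesis by simp
  qed
  have "(\<integral>x. ?g x ^ 2 \<partial>lborel) \<le> 0"
  proof (rule field_le_epsilon)
    fix e :: real assume e: "0 < e"
    let ?I = "\<integral>x. \<bar>?g x\<bar> \<partial>lborel"
    have I: "0 \<le> ?I" by simp
    \<comment> \<open>The 1 in the denominator avoids division by 0 if the integral
      vanishes.\<close>
    have "(\<integral>x. ?g x ^ 2 \<partial>lborel) \<le> (e / (1 + ?I)) * ?I" using e I by (intro le divide_pos_pos add_pos_nonneg) auto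
    also have "\<dots> = e * (?I / (1 + ?I))" by simp
    also have "?I / (1 + ?I) \<le> 1" using I by (subst divide_le_eq_1_pos) linarith+
    then have "e * (?I / (1 + ?I)) \<le> e * 1" using e by (intro mult_left_mono) auto
    also have "e * 1 = e" by simp
    finally show "(\<integral>x. ?g x ^ 2 \<partial>lborel) \<le> 0 + e" by simp
  qed
  moreover have "0 \<le> (\<integral>x. ?g x ^ 2 \<partial>lborel)" by simp
  ultimately have "(\<integral>x. ?g x ^ 2 \<partial>lborel) = 0" by simp
  then have "?g x ^ 2 = 0"
    by (rule integral_continuous_nonneg_eq_0[rotated 3]) (use g ig2 in \<open>auto intro!: continuous_intros\<close>)
  then show ?thesis by simp
qed

text \<open>The factors 1 and -i turn the statement about real parts into one about the real and the
  imaginary part of f - g.\<close>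

lemma fourier_injective:
  assumes f: "continuous_on UNIV f" "\<And>x. x \<notin> cball 0 R \<Longrightarrow> f x = 0"
    and g: "continuous_on UNIV g" "\<And>x. x \<notin> cball 0 R \<Longrightarrow> g x = 0"
    and eq: "\<And>k. fourier f k = fourier g k"
  shows "f = g"
proof
  fix x
  have m: "f \<in> borel_measurable borel" "g \<in> borel_measurable borel"
    using f g by (auto simp: borel_measurable_continuous_onI)
  let ?h = "\<lambda>c x. c * (f x - g x)"
  have "Re (?h c x) = 0" for c
  proof (rule fourier_eq_0_imp_Re_eq_0[of _ R])
    show "fourier (?h c) k = 0" for k
    proof -
      let ?e = "\<lambda>x. exp (- (2 * of_real pi * \<i> * of_real (k \<bullet> x)))"
      have i: "integrable lborel (\<lambda>x. ?e x * f x)" "integrable lborel (\<lambda>x. ?e x * g x)"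
        by (rule integrable_continuous_bounded_support[of _ R];
            use f g in \<open>auto intro!: continuous_intros\<close>)+
      have "fourier (?h c) k = (\<integral>x. c * (?e x * f x - ?e x * g x) \<partial>lborel)"
        using m by (subst fourier_lborel) (auto simp: algebra_simps)
      also have "\<dots> = c * (fourier f k - fourier g k)"
        using m i by (simp add: fourier_lborel)
      finally show ?thesis using eq by simp
    qed
  qed (use f g in \<open>auto intro!: continuous_intros\<close>)
  from this[of 1] this[of "-\<i>"] show "f x = g x" by (simp add: complex_eq_iff)
qed

section \<open>Approximation of convolutions and indicators\<close>

lemma compact_subset_cball:
  fixes V :: "'a::real_normed_vector set"
  assumes "compact V" obtains r where "0 < r" "V \<subseteq> cball 0 r"
  using compact_imp_bounded[OF assms] unfolding bounded_pos by (meson mem_cball_0 subsetI)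

text \<open>Two points at distance below 1 either both lie in the ball enlarged by 1, which is
  compact, or both lie outside the original ball, where g is 0.\<close>

lemma uniformly_continuous_bounded_support:
  fixes g :: "'a::euclidean_space \<Rightarrow> 'b::real_normed_vector"
  assumes g: "continuous_on UNIV g" "\<And>x. x \<notin> cball 0 r \<Longrightarrow> g x = 0"
  shows "uniformly_continuous_on UNIV g"
proof -
  have u: "uniformly_continuous_on (cball 0 (r + 1)) g"
    using g(1) by (intro compact_uniformly_continuous) (auto intro: continuous_on_subset)
  show ?thesis
    unfolding uniformly_continuous_on_def
  proof (intro allI impI)
    fix e :: real assume e: "0 < e"
    obtain d where d: "0 < d" "\<And>x y. x \<in> cball 0 (r + 1) \<Longrightarrow> y \<in> cball 0 (r + 1) \<Longrightarrow> dist y x < d \<Longrightarrow> dist (g y) (g x) < e"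
      by (rule uniformly_continuous_onE[OF u e]) (rule that, assumption+)
    have "dist (g y) (g x) < e" if "dist y x < min d 1" for x y
    proof (cases "x \<in> cball 0 (r + 1) \<and> y \<in> cball 0 (r + 1)")
      case True
      then show ?thesis using d that by auto
    next
      case False
      have "norm x \<le> norm y + dist y x" "norm y \<le> norm x + dist y x"
        using norm_triangle_sub[of x y] norm_triangle_sub[of y x] by (auto simp: dist_norm norm_minus_commute)
      then have "x \<notin> cball 0 r" "y \<notin> cball 0 r" using False that by auto
      then show ?thesis using g(2) e by simp
    qed
    then show "\<exists>d>0. \<forall>x\<in>UNIV. \<forall>y\<in>UNIV. dist y x < d \<longrightarrow> dist (g y) (g x) < e"
      using d(1) by (intro exI[of _ "min d 1"]) auto
  qed
qed

lemma bounded_continuous_bounded_support: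
  fixes g :: "'a::euclidean_space \<Rightarrow> real"
  assumes g: "continuous_on UNIV g" "\<And>x. x \<notin> cball 0 r \<Longrightarrow> g x = 0"
  obtains B where "0 < B" "\<And>x. \<bar>g x\<bar> \<le> B"
proof -
  have "compact (g ` cball 0 r)"
    using g(1) by (intro compact_continuous_image) (auto intro: continuous_on_subset)
  then obtain B where B: "\<And>x. x \<in> cball 0 r \<Longrightarrow> \<bar>g x\<bar> \<le> B"
    using compact_imp_bounded by (fastforce simp: bounded_iff)
  have "\<bar>g x\<bar> \<le> \<bar>B\<bar> + 1" for x
    using B[of x] g(2)[of x] by (cases "x \<in> cball 0 r") auto
  then show ?thesis using that[of "\<bar>B\<bar> + 1"] by simp
qed

text \<open>Replaces the convolution by a finite combination of translates of g, with one error
  bound for all y. The nodes may be taken from any dense set, later the stars of points of L, and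
  the weights have exactly the integral of h as their sum.\<close>

lemma convolution_riemann_sum:
  fixes g h :: "'a::euclidean_space \<Rightarrow> real"
  assumes g: "continuous_on UNIV g" "\<And>x. x \<notin> cball 0 r' \<Longrightarrow> g x = 0"
    and h: "continuous_on UNIV h" "\<And>x. x \<notin> cball 0 r \<Longrightarrow> h x = 0"
    and Z: "\<And>y e. 0 < e \<Longrightarrow> \<exists>z\<in>Z. dist z y < e" and e: "0 < e"
  obtains n :: nat and z w where "\<And>i. i < n \<Longrightarrow> z i \<in> Z \<and> norm (z i) \<le> r + 1"
    "(\<Sum>i<n. w i) = (\<integral>x. h x \<partial>lborel)"
    "\<And>y. \<bar>(\<integral>x. g (y - x) * h x \<partial>lborel) - (\<Sum>i<n. w i * g (y - z i))\<bar> \<le> e"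
proof -
  have ih: "integrable lborel h" by (rule integrable_continuous_bounded_support[OF h])
  let ?H = "\<integral>x. \<bar>h x\<bar> \<partial>lborel"
  have H: "0 \<le> ?H" by simp
  \<comment> \<open>The accumulated error is e' times the integral of |h|; the 1 keeps e' defined
    and positive even if h vanishes.\<close>
  define e' where "e' = e / (1 + ?H)"
  have e': "0 < e'" unfolding e'_def using H e by (intro divide_pos_pos add_pos_nonneg) auto
  have uc: "uniformly_continuous_on UNIV g" by (rule uniformly_continuous_bounded_support[OF g])
  obtain d0 where d0': "0 < d0" "\<And>x y. x \<in> UNIV \<Longrightarrow> y \<in> UNIV \<Longrightarrow> dist y x < d0 \<Longrightarrow> dist (g y) (g x) < e'"
    by (rule uniformly_continuous_onE[OF uc e']) (rule that, assumption+)
  note d0 = d0'(1) d0'(2)[OF UNIV_I UNIV_I]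
  define d where "d = min d0 1"
  have d: "0 < d" "d \<le> 1" "d \<le> d0" using d0 by (auto simp: d_def)
  have "cball 0 r \<subseteq> (\<Union>z\<in>{z\<in>Z. norm z \<le> r + 1}. ball z d)"
  proof
    fix y :: 'a assume y: "y \<in> cball 0 r"
    obtain z where z: "z \<in> Z" "dist z y < d" using Z[OF d(1)] by blast
    have "norm z \<le> norm y + dist z y" using norm_triangle_sub[of z y] by (simp add: dist_norm)
    then have "norm z \<le> r + 1" using y z d by simp
    then show "y \<in> (\<Union>z\<in>{z\<in>Z. norm z \<le> r + 1}. ball z d)" using z by auto
  qed
  then obtain Z' where Z': "Z' \<subseteq> {z\<in>Z. norm z \<le> r + 1}" "finite Z'" "cball 0 r \<subseteq> (\<Union>z\<in>Z'. ball z d)"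
    using compactE_image[of "cball 0 r" "{z\<in>Z. norm z \<le> r + 1}" "\<lambda>z. ball z d"] by auto
  obtain n :: nat and z where nz: "Z' = z ` {i. i < n}"
    using finite_imp_nat_seg_image_inj_on[OF Z'(2)] by blast
  \<comment> \<open>Making the covering balls disjoint gives measurable cells that partition the
    support of h; the weight of a node is the integral of h over its cell.\<close>
  define E where "E = disjointed (\<lambda>i. ball (z i) d)"
  have Eb [measurable]: "E i \<in> sets borel" for i
    unfolding E_def disjointed_def by auto
  have Esub: "E i \<subseteq> ball (z i) d" for i unfolding E_def by (rule disjointed_subset)
  have Eun: "(\<Union>i\<in>{..<n}. E i) = (\<Union>i\<in>{..<n}. ball (z i) d)"
    using finite_UN_disjointed_eq[of "\<lambda>i. ball (z i) d" n] by (simp add: E_def lessThan_atLeast0)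
  have Ed: "disjoint_family_on E {..<n}"
    using disjoint_family_disjointed[of "\<lambda>i. ball (z i) d"] unfolding E_def disjoint_family_on_def by auto
  have one: "(\<Sum>i<n. indicator (E i) x) = (1::real)" if "x \<in> cball 0 r" for x
  proof -
    have "(\<Sum>i<n. indicator (E i) x) = (indicator (\<Union>i\<in>{..<n}. E i) x :: real)"
      by (rule indicator_UN_disjoint[symmetric]) (use Ed in auto)
    moreover have "x \<in> (\<Union>i\<in>{..<n}. E i)" unfolding Eun using subsetD[OF Z'(3) that] unfolding nz by auto
    ultimately show ?thesis by simp
  qed
  have dec: "h x = (\<Sum>i<n. indicator (E i) x * h x)" for x
    using one[of x] h(2)[of x] by (cases "x \<in> cball 0 r") (auto simp flip: sum_distrib_right)
  define w where "w i = (\<integral>x. indicator (E i) x * h x \<partial>lborel)" for i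
  have iw: "integrable lborel (\<lambda>x. indicator (E i) x * h x)" for i
    using integrable_real_mult_indicator[OF _ ih, of "E i"] by (simp add: mult.commute)
  have mg: "g \<in> borel_measurable borel" using g by (simp add: borel_measurable_continuous_onI)
  have c1: "z i \<in> Z \<and> norm (z i) \<le> r + 1" if "i < n" for i using that Z' nz by auto
  have c2: "(\<Sum>i<n. w i) = (\<integral>x. h x \<partial>lborel)"
  proof -
    have "(\<integral>x. h x \<partial>lborel) = (\<integral>x. (\<Sum>i<n. indicator (E i) x * h x) \<partial>lborel)"
      using dec by presburger
    also have "\<dots> = (\<Sum>i<n. w i)" unfolding w_def using iw by (intro Bochner_Integration.integral_sum)
    finally show ?thesis by simp
  qed
  have c3: "\<bar>(\<integral>x. g (y - x) * h x \<partial>lborel) - (\<Sum>i<n. w i * g (y - z i))\<bar> \<le> e" for y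
  proof -
    have i1: "integrable lborel (\<lambda>x. g (y - x) * h x)"
      by (rule integrable_continuous_bounded_support[of _ r])
        (auto intro!: continuous_intros continuous_on_compose2[OF g(1)] h simp: h)
    have i2: "integrable lborel (\<lambda>x. \<Sum>i<n. indicator (E i) x * h x * g (y - z i))"
      using iw by auto
    have "(\<Sum>i<n. w i * g (y - z i)) = (\<integral>x. (\<Sum>i<n. indicator (E i) x * h x * g (y - z i)) \<partial>lborel)"
      unfolding w_def using iw by (simp add: Bochner_Integration.integral_sum)
    then have "\<bar>(\<integral>x. g (y - x) * h x \<partial>lborel) - (\<Sum>i<n. w i * g (y - z i))\<bar>
      = \<bar>\<integral>x. g (y - x) * h x - (\<Sum>i<n. indicator (E i) x * h x * g (y - z i)) \<partial>lborel\<bar>"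
      using i1 i2 by simp
    also have "\<dots> \<le> (\<integral>x. e' * \<bar>h x\<bar> \<partial>lborel)"
    proof (rule order_trans[OF integral_abs_bound integral_mono])
      fix x
      show "\<bar>g (y - x) * h x - (\<Sum>i<n. indicator (E i) x * h x * g (y - z i))\<bar> \<le> e' * \<bar>h x\<bar>"
      proof (cases "x \<in> cball 0 r")
        case True
        have "(\<Sum>i<n. indicator (E i) x * (h x * g (y - x))) = (\<Sum>i<n. indicator (E i) x) * (h x * g (y - x))"
          by (rule sum_distrib_right[symmetric])
        then have "g (y - x) * h x = (\<Sum>i<n. indicator (E i) x * (h x * g (y - x)))"
          unfolding one[OF True] by (simp only: mult_1_left mult.commute)
        then have "g (y - x) * h x - (\<Sum>i<n. indicator (E i) x * h x * g (y - z i))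
          = (\<Sum>i<n. indicator (E i) x * (h x * g (y - x)) - indicator (E i) x * h x * g (y - z i))"
          by (simp only: sum_subtractf)
        also have "\<dots> = (\<Sum>i<n. indicator (E i) x * (g (y - x) - g (y - z i)) * h x)"
          by (intro sum.cong refl) (simp only: algebra_simps)
        also have "\<dots> = (\<Sum>i<n. indicator (E i) x * (g (y - x) - g (y - z i))) * h x"
          by (rule sum_distrib_right[symmetric])
        finally have "\<bar>g (y - x) * h x - (\<Sum>i<n. indicator (E i) x * h x * g (y - z i))\<bar>
          = \<bar>(\<Sum>i<n. indicator (E i) x * (g (y - x) - g (y - z i))) * h x\<bar>" by simp
        also have "\<dots> \<le> e' * \<bar>h x\<bar>"
          unfolding abs_mult
        proof (rule mult_right_mono)
          have "\<bar>\<Sum>i<n. indicator (E i) x * (g (y - x) - g (y - z i))\<bar> \<le> (\<Sum>i<n. indicator (E i) x * e')"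
          proof (rule order_trans[OF sum_abs sum_mono])
            fix i
            show "\<bar>indicator (E i) x * (g (y - x) - g (y - z i))\<bar> \<le> indicator (E i) x * e'"
            proof (cases "x \<in> E i")
              case True
              then have "dist (z i) x < d" using subsetD[OF Esub[of i]] by simp
              then have "dist (y - x) (y - z i) < d0" using d by (simp add: dist_norm norm_minus_commute)
              from d0(2)[OF this] show ?thesis using True by (simp add: dist_real_def)
            qed simp
          qed
          also have "\<dots> = e'" using one[OF True] by (simp flip: sum_distrib_right)
          finally show "\<bar>\<Sum>i<n. indicator (E i) x * (g (y - x) - g (y - z i))\<bar> \<le> e'" .
        qed simp
        finally show ?thesis .
      qed (simp add: h)
    qed (use i1 i2 ih in auto)
    also have "\<dots> = e' * ?H" by simp
    also have "\<dots> \<le> e' * (1 + ?H)" using e' by (intro mult_left_mono) auto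
    also have "\<dots> = e"
    proof -
      have "1 + ?H \<noteq> 0" using H by linarith
      then show ?thesis unfolding e'_def by simp
    qed
    finally show ?thesis .
  qed
  show thesis using that c1 c2 c3 by blast
qed

text \<open>Tents built from the distances to V and to its complement are squeezed onto the
  indicator. Off the frontier they agree from some index on, and the frontier is null, so dominated
  convergence applies. The inner function inherits the bounded support by lying between 0 and the
  outer one.\<close>

lemma indicator_approximation:
  fixes V :: "'a::euclidean_space set"
  assumes V: "compact V" "V \<noteq> {}" "frontier V \<in> null_sets lborel" and sub: "V \<subseteq> cball 0 r" and e: "0 < e"
  obtains \<phi> \<psi> :: "'a \<Rightarrow> real" where "continuous_on UNIV \<phi>" "continuous_on UNIV \<psi>"
    "\<And>x. 0 \<le> \<psi> x" "\<And>x. \<psi> x \<le> indicator V x" "\<And>x. indicator V x \<le> \<phi> x" "\<And>x. \<phi> x \<le> 1"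
    "\<And>x. x \<notin> cball 0 (r + 1) \<Longrightarrow> \<phi> x = 0" "(\<integral>x. \<phi> x - \<psi> x \<partial>lborel) < e"
proof -
  have cV: "closed V" using V by (simp add: compact_imp_closed)
  have "V \<noteq> UNIV" using V(1) not_compact_UNIV by metis
  \<comment> \<open>\<open>infdist\<close> to the empty set is 0 by convention, so positive
    distances require both V and its complement to be nonempty.\<close>
  then have nV: "- V \<noteq> {}" by auto
  define F where "F k x = max 0 (1 - real (Suc k) * infdist x V)" for k :: nat and x
  define G where "G k x = min 1 (real (Suc k) * infdist x (- V))" for k :: nat and x
  have cont: "continuous_on UNIV (F k)" "continuous_on UNIV (G k)" for k
    unfolding F_def G_def by (auto intro!: continuous_intros)
  have p: "0 \<le> G k x" "G k x \<le> indicator V x" "indicator V x \<le> F k x" "F k x \<le> 1" for k x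
    unfolding F_def G_def by (auto simp: indicator_def infdist_nonneg)
  have supp: "F k x = 0" if "x \<notin> cball 0 (r + 1)" for k x
  proof -
    have "1 \<le> infdist x V"
      unfolding infdist_notempty[OF V(2)]
    proof (rule cINF_greatest[OF V(2)])
      fix v assume "v \<in> V"
      then have "norm v \<le> r" using sub by auto
      moreover have "norm x \<le> norm v + dist x v" using norm_triangle_sub[of x v] by (simp add: dist_norm)
      ultimately show "1 \<le> dist x v" using that by simp
    qed
    then have "1 * 1 \<le> real (Suc k) * infdist x V" by (intro mult_mono) auto
    then show ?thesis by (simp add: F_def)
  qed
  have ev: "\<forall>\<^sub>F k in sequentially. 1 \<le> real (Suc k) * a" if "0 < a" for a :: real
  proof -
    obtain N where "1 / a < real N" using reals_Archimedean2 by blast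
    then have N: "1 \<le> real N * a" using that by (simp add: field_simps)
    have "1 \<le> real (Suc k) * a" if "N \<le> k" for k
    proof -
      have "real N * a \<le> real (Suc k) * a" using that \<open>0 < a\<close> by (intro mult_right_mono) auto
      then show ?thesis using N by linarith
    qed
    then show ?thesis unfolding eventually_sequentially by blast
  qed
  have lim: "(\<lambda>k. F k x - G k x) \<longlonglongrightarrow> 0" if x: "x \<notin> frontier V" for x
  proof (cases "x \<in> V")
    case True
    then have "x \<in> interior V" using x cV by (auto simp: frontier_def closure_closed)
    then have "x \<notin> closure (- V)" by (simp add: closure_complement)
    then have "0 < infdist x (- V)"
      using in_closure_iff_infdist_zero[OF nV, of x] infdist_nonneg[of x "- V"] by linarith
    from ev[OF this] have "\<forall>\<^sub>F k in sequentially. F k x - G k x = 0"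
    proof eventually_elim
      case (elim k)
      then show ?case unfolding F_def G_def using True by simp
    qed
    then show ?thesis by (rule tendsto_eventually)
  next
    case False
    then have "0 < infdist x V" using cV V(2) by (simp add: infdist_pos_not_in_closed)
    from ev[OF this] have "\<forall>\<^sub>F k in sequentially. F k x - G k x = 0"
    proof eventually_elim
      case (elim k)
      then show ?case unfolding F_def G_def using False by simp
    qed
    then show ?thesis by (rule tendsto_eventually)
  qed
  have "(\<lambda>k. \<integral>x. F k x - G k x \<partial>lborel) \<longlonglongrightarrow> (\<integral>x. 0 \<partial>(lborel :: 'a measure))"
  proof (rule integral_dominated_convergence[where w="indicator (cball 0 (r + 1))"])
    show "AE x in lborel. (\<lambda>k. F k x - G k x) \<longlonglongrightarrow> 0"
      by (rule AE_I'[OF V(3)]) (use lim in auto)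
    show "AE x in lborel. norm (F k x - G k x) \<le> indicator (cball 0 (r + 1)) x" for k
    proof (rule AE_I2)
      fix x
      show "norm (F k x - G k x) \<le> indicator (cball 0 (r + 1)) x"
        using p(1)[of k x] p(2)[of k x] p(3)[of x k] p(4)[of k x] supp[of x k]
          by (cases "x \<in> cball 0 (r + 1)") (auto simp: indicator_def split: if_splits)
    qed
    show "integrable lborel (indicator (cball 0 (r + 1)) :: 'a \<Rightarrow> real)"
      using emeasure_bounded_finite[of "cball (0::'a) (r+1)"] by simp
  qed (use cont in \<open>auto intro!: borel_measurable_continuous_onI continuous_intros\<close>)
  then have "\<forall>\<^sub>F k in sequentially. (\<integral>x. F k x - G k x \<partial>lborel) < e"
    using e by (intro order_tendstoD(2)[where y=0]) auto
  then obtain k where "(\<integral>x. F k x - G k x \<partial>lborel) < e"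
    unfolding eventually_sequentially by blast
  then show ?thesis using that[of "F k" "G k"] cont p supp by blast
qed

text \<open>An indicator is locally constant off the frontier, hence converges almost everywhere
  along any sequence of translations tending to 0. The bound of that sequence yields a common ball
  for domination.\<close>

lemma indicator_translation_continuous:
  fixes V :: "'a::euclidean_space set"
  assumes V: "compact V" "frontier V \<in> null_sets lborel" and e: "0 < e"
  obtains d where "0 < d" "\<And>t. norm t < d \<Longrightarrow> (\<integral>x. \<bar>indicator V (t + x) - indicator V x\<bar> \<partial>lborel) < (e::real)"
proof -
  have [measurable]: "V \<in> sets borel" using V(1) by (simp add: borel_compact)
  obtain r where r: "V \<subseteq> cball 0 r" using compact_subset_cball[OF V(1)] by blast
  let ?D = "\<lambda>t. \<integral>x. \<bar>indicator V (t + x) - indicator V x\<bar> \<partial>(lborel :: 'a measure) :: real"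
  have "(?D \<longlongrightarrow> 0) (at 0 within UNIV)"
    unfolding tendsto_at_iff_sequentially
  proof (intro allI impI)
    fix X :: "nat \<Rightarrow> 'a" assume "X \<longlonglongrightarrow> 0"
    then have "Bseq X" by (intro convergent_imp_Bseq convergentI)
    then obtain b where b: "\<And>n. norm (X n) \<le> b" unfolding Bseq_def by blast
    have "(\<lambda>n. ?D (X n)) \<longlonglongrightarrow> (\<integral>x. 0 \<partial>(lborel :: 'a measure))"
    proof (rule integral_dominated_convergence[where w="indicator (cball 0 (r + b))"])
      show "AE x in lborel. (\<lambda>n. \<bar>indicator V (X n + x) - indicator V x\<bar>) \<longlonglongrightarrow> (0::real)"
      proof (rule AE_I'[OF V(2)], safe)
        fix x assume nl: "\<not> (\<lambda>n. \<bar>indicator V (X n + x) - indicator V x\<bar>) \<longlonglongrightarrow> (0::real)"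
        show "x \<in> frontier V"
        proof (rule ccontr)
          assume "x \<notin> frontier V"
          obtain U where U: "open U" "x \<in> U" "\<And>y. y \<in> U \<Longrightarrow> y \<in> V \<longleftrightarrow> x \<in> V"
          proof (cases "x \<in> V")
            case True
            then have "x \<in> interior V"
              using \<open>x \<notin> frontier V\<close> closure_subset[of V] by (auto simp: frontier_def)
            then show ?thesis using that[of "interior V"] interior_subset[of V] True by auto
          next
            case False
            then show ?thesis using that[of "- V"] compact_imp_closed[OF V(1)] by auto
          qed
          have "(\<lambda>n. X n + x) \<longlonglongrightarrow> 0 + x" by (intro tendsto_intros \<open>X \<longlonglongrightarrow> 0\<close>)
          then have "(\<lambda>n. X n + x) \<longlonglongrightarrow> x" by simp
          then have "\<forall>\<^sub>F n in sequentially. X n + x \<in> U"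
            using U(1,2) by (rule topological_tendstoD)
          then have "\<forall>\<^sub>F n in sequentially. \<bar>indicator V (X n + x) - indicator V x\<bar> = (0::real)"
            by (rule eventually_mono) (simp add: indicator_def U(3))
          from tendsto_eventually[OF this] nl show False by contradiction
        qed
      qed
      show "AE x in lborel. norm \<bar>indicat_real V (X n + x) - indicat_real V x\<bar> \<le> indicat_real (cball 0 (r + b)) x" for n
      proof (rule AE_I2)
        fix x
        have "norm x \<le> norm (X n + x) + norm (X n)" using norm_triangle_ineq4[of "X n + x" "X n"] by simp
        moreover have "norm y \<le> r" if "y \<in> V" for y using that r by auto
        ultimately have "norm x \<le> r + b" if "X n + x \<in> V \<or> x \<in> V"
          using that b[of n] norm_ge_zero[of "X n"] by (smt (verit))
        then show "norm \<bar>indicat_real V (X n + x) - indicat_real V x\<bar> \<le> indicat_real (cball 0 (r + b)) x"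
          by (auto simp: indicator_def)
      qed
      show "integrable lborel (indicator (cball 0 (r + b)) :: 'a \<Rightarrow> real)"
        using emeasure_bounded_finite[of "cball (0::'a) (r+b)"] by simp
    qed auto
    then show "((\<lambda>t. ?D t) \<circ> X) \<longlonglongrightarrow> 0" by (simp add: o_def)
  qed
  then obtain d where d: "0 < d" "\<And>t. t \<noteq> 0 \<Longrightarrow> dist t 0 < d \<Longrightarrow> dist (?D t) 0 < e"
    using e unfolding Lim_at zero_less_dist_iff by blast
  \<comment> \<open>The limit at 0 is punctured; for t = 0 the integrand is identically 0.\<close>
  have "?D t < e" if "norm t < d" for t
    using d(2)[of t] that e by (cases "t = 0") auto
  then show ?thesis using that d(1) by blast
qed

section \<open>Equidistribution\<close>

context cut_and_project
begin

lemma finite_strip_norm: "finite {x \<in> strip R. norm x \<le> s}"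
  by (rule finite_subset[OF _ finite_strip[of "cball 0 s" R]]) auto

lemma strip_phys: "x \<in> strip R \<Longrightarrow> x \<in> L"
  by (simp add: strip_def)

text \<open>The strip makes the index set finite; by \<open>csum_mono_radius\<close> its radius is
  immaterial once it contains the support of g.\<close>

definition csum :: "real \<Rightarrow> (real^'n \<Rightarrow> real) \<Rightarrow> real \<Rightarrow> real" where
  "csum R g s = (\<Sum>x\<in>{x \<in> strip R. norm x \<le> s}. g (star M x))"

text \<open>Translating g by \<open>star M t\<close> amounts to shifting the index set by t. Only
  points for which the shift changes whether the norm is at most s survive in the difference, and
  these lie in an annulus of half-width |t|. The room in R keeps both x and x + t in the
  strip.\<close>

lemma csum_translate:
  assumes t: "t \<in> L" and g: "\<And>y. y \<notin> cball 0 r \<Longrightarrow> g y = 0" and R: "r + norm (star M t) \<le> R"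
    and B: "\<And>y. \<bar>g y\<bar> \<le> B"
  shows "\<bar>csum R (\<lambda>y. g (y - star M t)) s - csum R g s\<bar>
     \<le> B * real (card {x \<in> strip R. s - norm t \<le> norm x \<and> norm x \<le> s + norm t})"
proof -
  let ?F = "{x \<in> strip R. norm x \<le> s}" and ?ann = "{x \<in> strip R. s - norm t \<le> norm x \<and> norm x \<le> s + norm t}"
  let ?F' = "(\<lambda>x. x - t) ` ?F" and ?G = "\<lambda>x. g (star M x)"
  have fin: "finite ?F" by (rule finite_strip_norm)
  have fann: "finite ?ann" by (rule finite_subset[OF _ finite_strip_norm[of R "s + norm t"]]) auto
  have B0: "0 \<le> B" using B[of 0] by linarith
  have "csum R (\<lambda>y. g (y - star M t)) s = (\<Sum>x\<in>?F. ?G (x - t))"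
    unfolding csum_def using t by (intro sum.cong refl) (auto simp: star_diff strip_phys)
  also have "\<dots> = (\<Sum>x\<in>?F'. ?G x)"
    by (subst sum.reindex) (auto simp: inj_on_def)
  \<comment> \<open>Both sums are extended by zeros to the union of the two index sets, so that they
    can be subtracted pointwise.\<close>
  also have "\<dots> = (\<Sum>x\<in>?F \<union> ?F'. if x \<in> ?F' then ?G x else 0)"
    using fin by (intro sum.mono_neutral_cong_left) auto
  finally have 1: "csum R (\<lambda>y. g (y - star M t)) s = (\<Sum>x\<in>?F \<union> ?F'. if x \<in> ?F' then ?G x else 0)" .
  have 2: "csum R g s = (\<Sum>x\<in>?F \<union> ?F'. if x \<in> ?F then ?G x else 0)"
    unfolding csum_def using fin by (intro sum.mono_neutral_cong_left) auto
  have pt: "\<bar>(if x \<in> ?F' then ?G x else 0) - (if x \<in> ?F then ?G x else 0)\<bar> \<le> (if x \<in> ?ann then B else 0)"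
    if x: "x \<in> ?F \<union> ?F'" for x
  proof (cases "?G x = 0 \<or> (x \<in> ?F \<and> x \<in> ?F')")
    case True
    then show ?thesis using B0 by auto
  next
    case False
    then have nz: "norm (star M x) \<le> r" using g[of "star M x"] by auto
    have xL: "x \<in> L" using x t by (auto simp: strip_phys diff_phys)
    have "norm (star M x) \<le> R" using nz R norm_ge_zero[of "star M t"] by linarith
    then have xs: "x \<in> strip R" using xL by (simp add: strip_def)
    have "norm (star M (x + t)) \<le> norm (star M x) + norm (star M t)"
      using xL t by (simp add: star_add norm_triangle_ineq)
    then have xt: "x + t \<in> strip R" using nz R xL t by (simp add: strip_def add_phys)
    have iff: "x \<in> ?F' \<longleftrightarrow> norm (x + t) \<le> s"
    proof
      assume "x \<in> ?F'"
      then show "norm (x + t) \<le> s" by auto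
    next
      assume "norm (x + t) \<le> s"
      then have "x + t \<in> ?F" using xt by simp
      then show "x \<in> ?F'" by (rule rev_image_eqI) simp
    qed
    have "norm (x + t) \<le> norm x + norm t" "norm x \<le> norm (x + t) + norm t"
      using norm_triangle_ineq[of x t] norm_triangle_ineq4[of "x + t" t] by auto
    then have "x \<in> ?ann" using False iff x xs by auto
    moreover have "\<bar>(if x \<in> ?F' then ?G x else 0) - (if x \<in> ?F then ?G x else 0)\<bar> \<le> \<bar>?G x\<bar>"
      by auto
    ultimately show ?thesis using B[of "star M x"] by simp
  qed
  have "\<bar>csum R (\<lambda>y. g (y - star M t)) s - csum R g s\<bar>
     = \<bar>\<Sum>x\<in>?F \<union> ?F'. (if x \<in> ?F' then ?G x else 0) - (if x \<in> ?F then ?G x else 0)\<bar>"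
    unfolding 1 2 by (simp only: sum_subtractf)
  also have "\<dots> \<le> (\<Sum>x\<in>?F \<union> ?F'. if x \<in> ?ann then B else 0)"
    by (rule order_trans[OF sum_abs sum_mono]) (rule pt)
  also have "\<dots> = (\<Sum>x\<in>(?F \<union> ?F') \<inter> ?ann. B)"
    using fin by (intro sum.inter_restrict[symmetric]) auto
  also have "\<dots> = real (card ((?F \<union> ?F') \<inter> ?ann)) * B" by simp
  also have "\<dots> \<le> real (card ?ann) * B"
    using B0 fann by (intro mult_right_mono) (auto intro!: card_mono)
  finally show ?thesis by (simp only: mult.commute)
qed

lemma csum_translate_tendsto:
  assumes t: "t \<in> L" and g: "continuous_on UNIV g" "\<And>y. y \<notin> cball 0 r \<Longrightarrow> g y = 0"
    and R: "r + norm (star M t) \<le> R"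
  shows "((\<lambda>s. (csum R (\<lambda>y. g (y - star M t)) s - csum R g s) / s ^ CARD('m)) \<longlongrightarrow> 0) at_top"
proof -
  obtain B where B: "0 < B" "\<And>x. \<bar>g x\<bar> \<le> B"
    by (rule bounded_continuous_bounded_support[of g r]) (rule g(1), rule g(2), assumption, rule that, assumption+)
  let ?c = "\<lambda>s. real (card {x \<in> strip R. s - norm t \<le> norm x \<and> norm x \<le> s + norm t})"
  have "((\<lambda>s. B * (?c s / s ^ CARD('m))) \<longlongrightarrow> B * 0) at_top"
    by (intro tendsto_intros annulus_count_negligible) simp
  then have lim: "((\<lambda>s. B * (?c s / s ^ CARD('m))) \<longlongrightarrow> 0) at_top" by simp
  show ?thesis
  proof (rule Lim_null_comparison[OF _ lim])
    show "\<forall>\<^sub>F s in at_top. norm ((csum R (\<lambda>y. g (y - star M t)) s - csum R g s) / s ^ CARD('m)) \<le> B * (?c s / s ^ CARD('m))"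
      using eventually_gt_at_top[of 0]
    proof eventually_elim
      case (elim s)
      have "\<bar>csum R (\<lambda>y. g (y - star M t)) s - csum R g s\<bar> \<le> B * ?c s"
        by (rule csum_translate[OF t _ R B(2)]) (rule g(2))
      then have "\<bar>csum R (\<lambda>y. g (y - star M t)) s - csum R g s\<bar> / s ^ CARD('m) \<le> B * ?c s / s ^ CARD('m)"
        using elim by (intro divide_right_mono) auto
      then show ?case using elim by (simp add: abs_divide)
    qed
  qed
qed

text \<open>The Riemann sum turns the convolution into finitely many translates, each of which
  alters the counting sum by o(s^m). The nodes have norm at most r + 1, so translates of g stay
  within radius 2 r + 1.\<close>

lemma csum_convolution:
  assumes g: "continuous_on UNIV g" "\<And>x. x \<notin> cball 0 r \<Longrightarrow> g x = 0"
    and h: "continuous_on UNIV h" "\<And>x. x \<notin> cball 0 r \<Longrightarrow> h x = 0"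
    and R: "2 * r + 1 \<le> R"
  shows "((\<lambda>s. ((\<integral>x. h x \<partial>lborel) * csum R g s - csum R (\<lambda>y. \<integral>x. g (y - x) * h x \<partial>lborel) s) / s ^ CARD('m)) \<longlongrightarrow> 0) at_top"
proof (rule tendstoI)
  fix e :: real assume e: "0 < e"
  let ?c = "\<lambda>y. \<integral>x. g (y - x) * h x \<partial>lborel"
  obtain b where b: "0 < b" "\<And>s. 1 \<le> s \<Longrightarrow> real (card {x\<in>strip R. norm x \<le> s}) \<le> b * s ^ CARD('m)"
    by (rule strip_count_upper[of R]) (rule that, assumption+)
  \<comment> \<open>The Riemann error \<epsilon> is made once per point, that is at most b s^m
    times, and should total e/2 after division by s^m.\<close>
  define \<epsilon> where "\<epsilon> = e / (2 * b)"
  have eps: "0 < \<epsilon>" using e b by (simp add: \<epsilon>_def)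
  have Z: "\<exists>z\<in>star M ` L. dist z y < d" if "0 < d" for y d
    using star_dense[OF that, of y] by blast
  obtain n :: nat and z w where zw: "\<And>i. i < n \<Longrightarrow> z i \<in> star M ` L \<and> norm (z i) \<le> r + 1"
    "(\<Sum>i<n. w i) = (\<integral>x. h x \<partial>lborel)"
    "\<And>y. \<bar>?c y - (\<Sum>i<n. w i * g (y - z i))\<bar> \<le> \<epsilon>"
    by (rule convolution_riemann_sum[where g=g and h=h and r'=r and r=r and Z="star M ` L" and e=\<epsilon>])
       (use g h Z eps in blast)+
  define D where "D i s = (csum R (\<lambda>y. g (y - z i)) s - csum R g s) / s ^ CARD('m)" for i s
  have D: "(D i \<longlongrightarrow> 0) at_top" if "i < n" for i
  proof -
    obtain t where t: "t \<in> L" "z i = star M t" using zw(1)[OF \<open>i < n\<close>] by blast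
    have rt: "r + norm (star M t) \<le> R" using zw(1)[OF \<open>i < n\<close>] R t by simp
    show ?thesis unfolding D_def t(2) by (rule csum_translate_tendsto[OF t(1) g(1) _ rt]) (rule g(2))
  qed
  have "((\<lambda>s. \<Sum>i<n. - w i * D i s) \<longlongrightarrow> (\<Sum>i<n. - w i * 0)) at_top"
    by (intro tendsto_sum tendsto_mult tendsto_const D) auto
  then have "((\<lambda>s. \<Sum>i<n. - w i * D i s) \<longlongrightarrow> 0) at_top" by simp
  then have "\<forall>\<^sub>F s in at_top. dist (\<Sum>i<n. - w i * D i s) 0 < e / 2"
    using e by (intro tendstoD) auto
  then show "\<forall>\<^sub>F s in at_top. dist (((\<integral>x. h x \<partial>lborel) * csum R g s - csum R ?c s) / s ^ CARD('m)) 0 < e"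
    using eventually_ge_at_top[of 1]
  proof eventually_elim
    case (elim s)
    let ?F = "{x \<in> strip R. norm x \<le> s}"
    have sp: "0 < s ^ CARD('m)" using elim(2) by simp
    have comb: "csum R (\<lambda>y. \<Sum>i<n. w i * g (y - z i)) s = (\<Sum>i<n. w i * csum R (\<lambda>y. g (y - z i)) s)"
      unfolding csum_def sum_distrib_left by (rule sum.swap)
    have "(\<integral>x. h x \<partial>lborel) * csum R g s - csum R ?c s
      = (\<Sum>i<n. w i * csum R g s) - (\<Sum>i<n. w i * csum R (\<lambda>y. g (y - z i)) s)
        + (csum R (\<lambda>y. \<Sum>i<n. w i * g (y - z i)) s - csum R ?c s)"
      unfolding comb zw(2)[symmetric] by (simp add: sum_distrib_right)
    also have "(\<Sum>i<n. w i * csum R g s) - (\<Sum>i<n. w i * csum R (\<lambda>y. g (y - z i)) s)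
       = (\<Sum>i<n. - w i * D i s) * s ^ CARD('m)"
      unfolding D_def sum_distrib_right sum_subtractf[symmetric] using less_imp_neq[OF sp]
      by (intro sum.cong refl) (simp add: mult.assoc right_diff_distrib)
    finally have eq0: "(\<integral>x. h x \<partial>lborel) * csum R g s - csum R ?c s
      = (\<Sum>i<n. - w i * D i s) * s ^ CARD('m) + (csum R (\<lambda>y. \<Sum>i<n. w i * g (y - z i)) s - csum R ?c s)" .
    have eq: "((\<integral>x. h x \<partial>lborel) * csum R g s - csum R ?c s) / s ^ CARD('m)
      = (\<Sum>i<n. - w i * D i s) + (csum R (\<lambda>y. \<Sum>i<n. w i * g (y - z i)) s - csum R ?c s) / s ^ CARD('m)"
      unfolding eq0 add_divide_distrib using not_sym[OF less_imp_neq[OF sp]]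
      by (simp only: nonzero_mult_div_cancel_right not_False_eq_True)
    have "\<bar>csum R (\<lambda>y. \<Sum>i<n. w i * g (y - z i)) s - csum R ?c s\<bar> \<le> (\<Sum>x\<in>?F. \<epsilon>)"
      unfolding csum_def sum_subtractf[symmetric]
      by (rule order_trans[OF sum_abs sum_mono]) (use zw(3) in \<open>simp add: abs_minus_commute\<close>)
    also have "\<dots> = \<epsilon> * real (card ?F)" by simp
    also have "\<dots> \<le> \<epsilon> * (b * s ^ CARD('m))" using b(2)[OF elim(2)] eps by (intro mult_left_mono) auto
    also have "\<dots> = e / 2 * s ^ CARD('m)" using b(1) by (simp add: \<epsilon>_def)
    finally have "\<bar>(csum R (\<lambda>y. \<Sum>i<n. w i * g (y - z i)) s - csum R ?c s) / s ^ CARD('m)\<bar> \<le> e / 2"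
      using sp elim(2) by (simp add: abs_divide divide_le_eq)
    then show ?case using elim(1) unfolding eq dist_real_def by linarith
  qed
qed

lemma csum_ratio:
  assumes g: "continuous_on UNIV g" "\<And>x. x \<notin> cball 0 r \<Longrightarrow> g x = 0"
    and h: "continuous_on UNIV h" "\<And>x. x \<notin> cball 0 r \<Longrightarrow> h x = 0"
    and R: "2 * r + 1 \<le> R"
  shows "((\<lambda>s. ((\<integral>x. h x \<partial>lborel) * csum R g s - (\<integral>x. g x \<partial>lborel) * csum R h s) / s ^ CARD('m)) \<longlongrightarrow> 0) at_top"
proof -
  have c: "(\<lambda>y. \<integral>x. g (y - x) * h x \<partial>lborel) = (\<lambda>y. \<integral>x. h (y - x) * g x \<partial>lborel)"
  proof
    fix y
    have m: "(\<lambda>x. h (y - x) * g x) \<in> borel_measurable borel"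
      by (intro borel_measurable_continuous_onI continuous_intros continuous_on_compose2[OF h(1)] g) auto
    show "(\<integral>x. g (y - x) * h x \<partial>lborel) = (\<integral>x. h (y - x) * g x \<partial>lborel)"
      using lborel_integral_reflect[OF m, of y] by (simp add: mult.commute)
  qed
  have 1: "((\<lambda>s. ((\<integral>x. h x \<partial>lborel) * csum R g s - csum R (\<lambda>y. \<integral>x. g (y - x) * h x \<partial>lborel) s) / s ^ CARD('m)) \<longlongrightarrow> 0) at_top"
    by (rule csum_convolution[OF g h R])
  have 2: "((\<lambda>s. ((\<integral>x. g x \<partial>lborel) * csum R h s - csum R (\<lambda>y. \<integral>x. h (y - x) * g x \<partial>lborel) s) / s ^ CARD('m)) \<longlongrightarrow> 0) at_top"
    by (rule csum_convolution[OF h g R])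
  show ?thesis using tendsto_diff[OF 1 2] unfolding c by (simp add: diff_divide_distrib[symmetric])
qed

lemma csum_mono_radius:
  assumes "\<And>y. y \<notin> cball 0 r \<Longrightarrow> g y = 0" "r \<le> R"
  shows "csum R g s = csum r g s"
  unfolding csum_def
  by (rule sum.mono_neutral_right[OF finite_strip_norm]) (use assms in \<open>auto simp: strip_def\<close>)

section \<open>Normalisation of counting sums and the equidistribution limits\<close>

definition bump :: "real^'n \<Rightarrow> real" where
  "bump y = max 0 (1 - norm y)"

lemma bump_continuous: "continuous_on UNIV bump"
  unfolding bump_def by (intro continuous_intros)

lemma bump_support: "x \<notin> cball 0 1 \<Longrightarrow> bump x = 0"
  by (simp add: bump_def)

lemma bump_integral_pos: "0 < (\<integral>x. bump x \<partial>lborel)"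
proof -
  have i: "integrable lborel bump"
    by (rule integrable_continuous_bounded_support[OF bump_continuous]) (rule bump_support)
  have n: "0 \<le> bump x" for x by (simp add: bump_def)
  have "0 \<le> (\<integral>x. bump x \<partial>lborel)" using n by (simp add: integral_nonneg_AE)
  moreover have "(\<integral>x. bump x \<partial>lborel) \<noteq> 0"
    using integral_continuous_nonneg_eq_0[OF bump_continuous n i, of 0] by (auto simp: bump_def)
  ultimately show ?thesis by linarith
qed

text \<open>Asymptotically a constant multiple of \<open>s ^ CARD('m)\<close>; normalising by the sum of a test function
  avoids computing the constant, the inverse of the covolume.\<close>

definition count_scale :: "real \<Rightarrow> real" where
  "count_scale s = csum 1 bump s / (\<integral>x. bump x \<partial>lborel)"

lemma count_scale_lower:
  obtains c s0 where "0 < c" "\<And>s. s0 \<le> s \<Longrightarrow> c * s ^ CARD('m) \<le> count_scale s"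
proof -
  let ?I = "\<integral>x. bump x \<partial>lborel"
  obtain c s0 where c: "0 < c"
    "\<And>s. s0 \<le> s \<Longrightarrow> c * s ^ CARD('m) \<le> real (card {x\<in>L. star M x \<in> ball 0 (1/2) \<and> norm x \<le> s})"
    by (rule window_count_lower[of "1/2" 0]) (simp, rule that, assumption+)
  have "c / (2 * ?I) * s ^ CARD('m) \<le> count_scale s" if s: "s0 \<le> s" for s
  proof -
    let ?F = "{x\<in>L. star M x \<in> ball 0 (1/2) \<and> norm x \<le> s}" and ?F1 = "{x \<in> strip 1. norm x \<le> s}"
    have sub: "?F \<subseteq> ?F1" by (auto simp: strip_def)
    have "real (card ?F) * (1 / 2) = (\<Sum>x\<in>?F. 1 / 2)" by simp
    \<comment> \<open>On the ball of radius 1/2 the tent is at least 1/2.\<close>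
    also have "\<dots> \<le> (\<Sum>x\<in>?F. bump (star M x))" by (rule sum_mono) (auto simp: bump_def)
    also have "\<dots> \<le> (\<Sum>x\<in>?F1. bump (star M x))"
      by (rule sum_mono2[OF finite_strip_norm sub]) (simp add: bump_def)
    finally have "c * s ^ CARD('m) / 2 \<le> csum 1 bump s" unfolding csum_def using c(2)[OF s] by linarith
    then have "c * s ^ CARD('m) / 2 / ?I \<le> csum 1 bump s / ?I"
      using bump_integral_pos by (intro divide_right_mono) auto
    then show ?thesis by (simp add: count_scale_def)
  qed
  moreover have "0 < c / (2 * ?I)" using c(1) bump_integral_pos by simp
  ultimately show ?thesis using that by blast
qed

lemma count_scale_upper:
  obtains c where "0 < c" "\<And>s. 1 \<le> s \<Longrightarrow> count_scale s \<le> c * s ^ CARD('m)"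
proof -
  let ?I = "\<integral>x. bump x \<partial>lborel"
  obtain b where b: "0 < b" "\<And>s. 1 \<le> s \<Longrightarrow> real (card {x\<in>strip 1. norm x \<le> s}) \<le> b * s ^ CARD('m)"
    by (rule strip_count_upper[of 1]) (rule that, assumption+)
  have "count_scale s \<le> b / ?I * s ^ CARD('m)" if s: "1 \<le> s" for s
  proof -
    have "csum 1 bump s \<le> (\<Sum>x\<in>{x\<in>strip 1. norm x \<le> s}. 1)"
      unfolding csum_def by (rule sum_mono) (simp add: bump_def)
    also have "\<dots> \<le> b * s ^ CARD('m)" using b(2)[OF s] by simp
    finally have "csum 1 bump s / ?I \<le> b * s ^ CARD('m) / ?I"
      using bump_integral_pos by (intro divide_right_mono) auto
    then show ?thesis by (simp add: count_scale_def)
  qed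
  moreover have "0 < b / ?I" using b(1) bump_integral_pos by simp
  ultimately show ?thesis using that by blast
qed

lemma count_scale_pos: "\<forall>\<^sub>F s in at_top. 0 < count_scale s"
proof -
  obtain c s0 where c: "0 < c" "\<And>s. s0 \<le> s \<Longrightarrow> c * s ^ CARD('m) \<le> count_scale s"
    by (rule count_scale_lower) (rule that, assumption+)
  show ?thesis using eventually_ge_at_top[of s0] eventually_gt_at_top[of 0]
  proof eventually_elim
    case (elim s)
    then have "0 < c * s ^ CARD('m)" using c(1) by simp
    then show ?case using c(2)[OF elim(1)] by linarith
  qed
qed

lemma csum_equidistribution:
  assumes g: "continuous_on UNIV g" "\<And>x. x \<notin> cball 0 r \<Longrightarrow> g x = 0"
  shows "((\<lambda>s. csum r g s / count_scale s) \<longlongrightarrow> (\<integral>x. g x \<partial>lborel)) at_top"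
proof -
  \<comment> \<open>\<open>csum_ratio\<close> requires g and \<open>bump\<close> to be supported in
    one common ball.\<close>
  define r1 where "r1 = max r 1"
  define R where "R = 2 * r1 + 1"
  have R: "r \<le> R" "1 \<le> R" by (auto simp: R_def r1_def)
  let ?I = "\<integral>x. bump x \<partial>lborel" and ?J = "\<integral>x. g x \<partial>lborel"
  have I: "0 < ?I" by (rule bump_integral_pos)
  have r1: "((\<lambda>s. (?I * csum R g s - ?J * csum R bump s) / s ^ CARD('m)) \<longlongrightarrow> 0) at_top"
    by (rule csum_ratio[of _ r1]) (use g bump_continuous bump_support in \<open>auto simp: r1_def R_def\<close>)
  obtain c s0 where c: "0 < c" "\<And>s. s0 \<le> s \<Longrightarrow> c * s ^ CARD('m) \<le> count_scale s"
    by (rule count_scale_lower) (rule that, assumption+)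
  have "((\<lambda>s. csum r g s / count_scale s - ?J) \<longlongrightarrow> 0) at_top"
  proof (rule Lim_null_comparison)
    show "((\<lambda>s. 1 / (?I * c) * \<bar>(?I * csum R g s - ?J * csum R bump s) / s ^ CARD('m)\<bar>) \<longlongrightarrow> 0) at_top"
      using tendsto_mult[OF tendsto_const tendsto_rabs[OF r1], of "1 / (?I * c)"] by simp
    show "\<forall>\<^sub>F s in at_top. norm (csum r g s / count_scale s - ?J)
       \<le> 1 / (?I * c) * \<bar>(?I * csum R g s - ?J * csum R bump s) / s ^ CARD('m)\<bar>"
      using eventually_ge_at_top[of s0] eventually_gt_at_top[of 0]
    proof eventually_elim
      case (elim s)
      have sp: "0 < s ^ CARD('m)" using elim(2) by simp
      have cs: "0 < c * s ^ CARD('m)" "c * s ^ CARD('m) \<le> count_scale s"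
        using c(1) sp c(2)[OF elim(1)] by auto
      have e1: "csum R g s = csum r g s"
        by (rule csum_mono_radius[OF _ R(1)]) (rule g(2))
      have e2: "csum R bump s = ?I * count_scale s"
        using csum_mono_radius[OF bump_support R(2)] I by (simp add: count_scale_def)
      have "?I * csum R g s - ?J * csum R bump s = ?I * (csum r g s - ?J * count_scale s)"
        unfolding e1 e2 by (simp add: algebra_simps)
      then have rhs: "1 / (?I * c) * \<bar>(?I * csum R g s - ?J * csum R bump s) / s ^ CARD('m)\<bar>
         = \<bar>csum r g s - ?J * count_scale s\<bar> / (c * s ^ CARD('m))"
        using I c(1) sp elim(2) by (simp add: abs_mult abs_divide)
      have "csum r g s / count_scale s - ?J = (csum r g s - ?J * count_scale s) / count_scale s"
        using cs by (simp add: field_simps)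
      then have "norm (csum r g s / count_scale s - ?J) = \<bar>csum r g s - ?J * count_scale s\<bar> / count_scale s"
        using cs by (simp add: abs_divide)
      also have "\<dots> \<le> \<bar>csum r g s - ?J * count_scale s\<bar> / (c * s ^ CARD('m))"
        using cs by (intro divide_left_mono) auto
      finally show ?case unfolding rhs .
    qed
  qed
  then show ?thesis by (simp add: LIM_zero_iff)
qed

text \<open>The discontinuous weight, indicator times g, is replaced by the continuous u g, where l
  and u enclose the indicator. The error is at most B (u - l) pointwise, and equidistribution of u -
  l controls its sum.\<close>

lemma window_equidistribution:
  assumes V: "compact V" "frontier V \<in> null_sets lborel" and g: "continuous_on UNIV g"
  shows "((\<lambda>s. (\<Sum>x\<in>truncate (model_points M V) s. g (star M x)) / count_scale s)
     \<longlongrightarrow> (\<integral>x. indicator V x * g x \<partial>lborel)) at_top"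
proof (cases "V = {}")
  case True
  then show ?thesis by (simp add: truncate_def model_points_def)
next
  case False
  obtain r where r: "0 < r" "V \<subseteq> cball 0 r" by (rule compact_subset_cball[OF V(1)])
  have [measurable]: "V \<in> sets borel" using V(1) by (simp add: borel_compact)
  have mg [measurable]: "g \<in> borel_measurable borel" using g by (simp add: borel_measurable_continuous_onI)
  \<comment> \<open>One unit beyond V, to contain the support of the outer approximation.\<close>
  let ?R = "r + 1"
  have "compact (g ` cball 0 ?R)"
    using g by (intro compact_continuous_image) (auto intro: continuous_on_subset)
  then have "bounded (g ` cball 0 ?R)" by (rule compact_imp_bounded)
  then obtain B where B: "0 < B" "\<forall>y\<in>g ` cball 0 ?R. norm y \<le> B"
    unfolding bounded_pos by blast
  then have Bg: "\<bar>g x\<bar> \<le> B" if "x \<in> cball 0 ?R" for x using that by auto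
  let ?G = "\<lambda>y. indicator V y * g y"
  have sumeq: "(\<Sum>x\<in>truncate (model_points M V) s. g (star M x)) = csum ?R ?G s" for s
    unfolding csum_def
  proof (rule sum.mono_neutral_cong_left[OF finite_strip_norm])
    show "truncate (model_points M V) s \<subseteq> {x \<in> strip ?R. norm x \<le> s}"
    proof
      fix x assume x: "x \<in> truncate (model_points M V) s"
      then have "star M x \<in> cball 0 r" using r(2) by (auto simp: truncate_def model_points_def)
      then show "x \<in> {x \<in> strip ?R. norm x \<le> s}" using x
        by (simp add: truncate_def model_points_def strip_def)
    qed
  qed (auto simp: truncate_def model_points_def strip_def indicator_def)
  have iG: "integrable lborel ?G"
  proof (rule Bochner_Integration.integrable_bound[where f="\<lambda>x. B * indicator (cball 0 ?R) x"])
    show "integrable lborel (\<lambda>x. B * indicator (cball 0 ?R) x :: real)"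
      by (intro integrable_mult_right integrable_real_indicator emeasure_bounded_finite) auto
    have "norm (?G x) \<le> norm (B * indicator (cball 0 ?R) x :: real)" for x
    proof (cases "x \<in> V")
      case True
      then have "x \<in> cball 0 r" using r(2) by blast
      then have "x \<in> cball 0 ?R" by simp
      then show ?thesis using Bg[of x] B(1) True by (simp add: abs_mult)
    qed (use B(1) in simp)
    then show "AE x in lborel. norm (?G x) \<le> norm (B * indicator (cball 0 ?R) x :: real)" by simp
  qed auto
  show ?thesis
    unfolding sumeq
  proof (rule tendstoI)
    fix e :: real assume e: "0 < e"
    \<comment> \<open>Three errors of e/4 are added below: equidistribution of u g, the difference
      of the sums and the difference of the integrals.\<close>
    define \<epsilon> where "\<epsilon> = e / (4 * B)"
    have eps: "0 < \<epsilon>" "B * \<epsilon> = e / 4" using e B by (auto simp: \<epsilon>_def)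
    obtain u l :: "real^'n \<Rightarrow> real" where ul: "continuous_on UNIV u" "continuous_on UNIV l"
      "\<And>x. 0 \<le> l x" "\<And>x. l x \<le> indicator V x" "\<And>x. indicator V x \<le> u x" "\<And>x. u x \<le> 1"
      "\<And>x. x \<notin> cball 0 ?R \<Longrightarrow> u x = 0" "(\<integral>x. u x - l x \<partial>lborel) < \<epsilon>"
      by (rule indicator_approximation[OF V(1) False V(2) r(2) eps(1)]) (rule that, assumption+)
    have l0: "l x = 0" if "x \<notin> cball 0 ?R" for x
      using ul(3)[of x] ul(4)[of x] ul(5)[of x] ul(7)[OF that] by linarith
    have iul: "integrable lborel (\<lambda>x. u x - l x)"
      by (rule integrable_continuous_bounded_support[of _ ?R]) (use ul(1,2,7) l0 in \<open>auto intro!: continuous_intros\<close>)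
    have iug: "integrable lborel (\<lambda>x. u x * g x)"
      by (rule integrable_continuous_bounded_support[of _ ?R]) (use ul(1,7) g in \<open>auto intro!: continuous_intros\<close>)
    have pt: "\<bar>?G x - u x * g x\<bar> \<le> B * (u x - l x)" for x
    proof (cases "x \<in> cball 0 ?R")
      case True
      have "?G x - u x * g x = - ((u x - indicator V x) * g x)" by (simp add: algebra_simps)
      then have "\<bar>?G x - u x * g x\<bar> = (u x - indicator V x) * \<bar>g x\<bar>"
        using ul(5)[of x] by (simp add: abs_mult)
      also have "\<dots> \<le> (u x - l x) * B"
        using ul(4,5)[of x] Bg[OF True] by (intro mult_mono) auto
      finally show ?thesis by (simp add: mult.commute)
    next
      case False
      then have "x \<notin> V" using r(2) by auto
      then show ?thesis using ul(7)[OF False] l0[OF False] by simp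
    qed
    have lim1: "((\<lambda>s. csum ?R (\<lambda>y. u y * g y) s / count_scale s) \<longlongrightarrow> (\<integral>x. u x * g x \<partial>lborel)) at_top"
      by (rule csum_equidistribution) (use ul(1,7) g in \<open>auto intro!: continuous_intros\<close>)
    have lim2: "((\<lambda>s. csum ?R (\<lambda>y. u y - l y) s / count_scale s) \<longlongrightarrow> (\<integral>x. u x - l x \<partial>lborel)) at_top"
      by (rule csum_equidistribution) (use ul(1,2,7) l0 in \<open>auto intro!: continuous_intros\<close>)
    have ev1: "\<forall>\<^sub>F s in at_top. dist (csum ?R (\<lambda>y. u y * g y) s / count_scale s) (\<integral>x. u x * g x \<partial>lborel) < e / 4"
      using e by (intro tendstoD[OF lim1]) simp
    have ev2: "\<forall>\<^sub>F s in at_top. csum ?R (\<lambda>y. u y - l y) s / count_scale s < \<epsilon>"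
      by (rule order_tendstoD(2)[OF lim2 ul(8)])
    have int: "\<bar>(\<integral>x. ?G x \<partial>lborel) - (\<integral>x. u x * g x \<partial>lborel)\<bar> \<le> e / 4"
    proof -
      have "\<bar>(\<integral>x. ?G x \<partial>lborel) - (\<integral>x. u x * g x \<partial>lborel)\<bar> = \<bar>\<integral>x. ?G x - u x * g x \<partial>lborel\<bar>"
        using iG iug by simp
      also have "\<dots> \<le> (\<integral>x. B * (u x - l x) \<partial>lborel)"
        by (rule order_trans[OF integral_abs_bound integral_mono]) (use iG iug iul pt in auto)
      also have "\<dots> = B * (\<integral>x. u x - l x \<partial>lborel)" by simp
      also have "\<dots> \<le> B * \<epsilon>" using ul(8) B(1) by (intro mult_left_mono) auto
      finally show ?thesis using eps by simp
    qed
    show "\<forall>\<^sub>F s in at_top. dist (csum ?R ?G s / count_scale s) (\<integral>x. ?G x \<partial>lborel) < e"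
      using ev1 ev2 count_scale_pos
    proof eventually_elim
      case (elim s)
      have "\<bar>csum ?R ?G s - csum ?R (\<lambda>y. u y * g y) s\<bar> \<le> (\<Sum>x\<in>{x \<in> strip ?R. norm x \<le> s}. B * (u (star M x) - l (star M x)))"
        unfolding csum_def sum_subtractf[symmetric] by (rule order_trans[OF sum_abs sum_mono]) (rule pt)
      also have "\<dots> = B * csum ?R (\<lambda>y. u y - l y) s" unfolding csum_def by (rule sum_distrib_left[symmetric])
      finally have "\<bar>csum ?R ?G s - csum ?R (\<lambda>y. u y * g y) s\<bar> / count_scale s \<le> B * csum ?R (\<lambda>y. u y - l y) s / count_scale s"
        using elim(3) by (intro divide_right_mono) auto
      also have "\<dots> = B * (csum ?R (\<lambda>y. u y - l y) s / count_scale s)" by simp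
      also have "\<dots> \<le> B * \<epsilon>" using elim(2) B(1) by (intro mult_left_mono) auto
      finally have "\<bar>csum ?R ?G s / count_scale s - csum ?R (\<lambda>y. u y * g y) s / count_scale s\<bar> \<le> e / 4"
        using elim(3) eps(2) by (simp add: abs_divide flip: diff_divide_distrib)
      then show ?case using elim(1) int e unfolding dist_real_def by linarith
    qed
  qed
qed

end

section \<open>Contraction and the Jacobian\<close>

text \<open>F(s) = f(s) / s^m stays between positive constants, while F(a s) / F(s) tends to c /
  a^m. If that limit were not 1, F would decay or grow geometrically along the points a^j t.
  Convergence of F itself is not assumed.\<close>

lemma ratio_limit_eq_power:
  fixes f :: "real \<Rightarrow> real"
  assumes lower: "0 < c1" "\<And>s. s1 \<le> s \<Longrightarrow> c1 * s ^ m \<le> f s"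
    and upper: "\<And>s. 1 \<le> s \<Longrightarrow> f s \<le> c2 * s ^ m"
    and lim: "((\<lambda>s. f (a * s) / f s) \<longlongrightarrow> c) at_top" and a: "1 \<le> a"
  shows "c = a ^ m"
proof -
  define F where "F s = f s / s ^ m" for s
  have am: "0 < a ^ m" using a by simp
  have pos: "c1 \<le> F s" if "max 1 s1 \<le> s" for s
    using lower(2)[of s] that by (simp add: F_def le_divide_eq)
  have le: "F s \<le> c2" if "1 \<le> s" for s
    using upper[of s] that by (simp add: F_def divide_le_eq)
  have "((\<lambda>s. (f (a * s) / f s) / a ^ m) \<longlongrightarrow> c / a ^ m) at_top"
    using less_imp_neq[OF am] by (intro tendsto_intros lim) (rule not_sym)
  moreover have "\<forall>\<^sub>F s in at_top. (f (a * s) / f s) / a ^ m = F (a * s) / F s"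
    using eventually_gt_at_top[of 0] by eventually_elim (simp add: F_def power_mult_distrib)
  ultimately have limF: "((\<lambda>s. F (a * s) / F s) \<longlongrightarrow> c / a ^ m) at_top"
    by (rule Lim_transform_eventually)
  have shift: "max 1 s1 \<le> s \<Longrightarrow> s \<le> a ^ j * s" for s j
    using mult_right_mono[OF one_le_power[OF a, of j], of s] by simp
  have "c / a ^ m = 1"
  proof (rule linorder_cases[of "c / a ^ m" 1])
    assume lt: "c / a ^ m < 1"
    then obtain \<mu> where mu: "c / a ^ m < \<mu>" "\<mu> < 1" using dense by blast
    have "\<forall>\<^sub>F s in at_top. F (a * s) / F s < \<mu>" by (rule order_tendstoD(2)[OF limF mu(1)])
    then obtain s0 where s0: "\<And>s. s0 \<le> s \<Longrightarrow> F (a * s) / F s < \<mu>"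
      unfolding eventually_at_top_linorder by blast
    define t where "t = max s0 (max 1 s1)"
    have t: "s0 \<le> a ^ j * t" "max 1 s1 \<le> a ^ j * t" for j
      using shift[of t j] by (auto simp: t_def)
    have step: "F (a ^ Suc j * t) < \<mu> * F (a ^ j * t)" for j
    proof -
      have "0 < F (a ^ j * t)" using pos[OF t(2), of j] lower(1) by linarith
      then show ?thesis using s0[OF t(1), of j] by (simp add: divide_less_eq mult.assoc)
    qed
    \<comment> \<open>The induction multiplies inequalities by \<mu>, whose sign is not yet known:
      it was chosen only above the limit and below 1.\<close>
    have mu0: "0 \<le> \<mu>"
    proof (rule ccontr)
      assume "\<not> 0 \<le> \<mu>"
      then have "\<mu> * F (a ^ 0 * t) \<le> 0"
        using pos[OF t(2), of 0] lower(1) by (intro mult_nonpos_nonneg) auto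
      then show False using step[of 0] pos[OF t(2), of 1] lower(1) by simp
    qed
    have dec: "F (a ^ j * t) \<le> \<mu> ^ j * F t" for j
    proof (induction j)
      case (Suc j)
      have "F (a ^ Suc j * t) \<le> \<mu> * F (a ^ j * t)" using step[of j] by linarith
      also have "\<dots> \<le> \<mu> * (\<mu> ^ j * F t)" using Suc mu0 by (intro mult_left_mono)
      finally show ?case by (simp add: mult.assoc)
    qed simp
    have "(\<lambda>j. \<mu> ^ j * F t) \<longlonglongrightarrow> 0 * F t"
      using mu0 mu(2) by (intro tendsto_intros LIMSEQ_realpow_zero)
    then have "\<forall>\<^sub>F j in sequentially. \<mu> ^ j * F t < c1"
      using lower(1) by (intro order_tendstoD(2)) auto
    then obtain j where "\<mu> ^ j * F t < c1" unfolding eventually_sequentially by blast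
    then show ?thesis using dec[of j] pos[OF t(2), of j] by linarith
  next
    assume gt: "1 < c / a ^ m"
    then obtain \<mu> where mu: "\<mu> < c / a ^ m" "1 < \<mu>" using dense by blast
    have "\<forall>\<^sub>F s in at_top. \<mu> < F (a * s) / F s" by (rule order_tendstoD(1)[OF limF mu(1)])
    then obtain s0 where s0: "\<And>s. s0 \<le> s \<Longrightarrow> \<mu> < F (a * s) / F s"
      unfolding eventually_at_top_linorder by blast
    define t where "t = max s0 (max 1 s1)"
    have t: "s0 \<le> a ^ j * t" "max 1 s1 \<le> a ^ j * t" for j
      using shift[of t j] by (auto simp: t_def)
    have step: "\<mu> * F (a ^ j * t) < F (a ^ Suc j * t)" for j
    proof -
      have "0 < F (a ^ j * t)" using pos[OF t(2), of j] lower(1) by linarith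
      then show ?thesis using s0[OF t(1), of j] by (simp add: less_divide_eq mult.assoc)
    qed
    have inc: "\<mu> ^ j * c1 \<le> F (a ^ j * t)" for j
    proof (induction j)
      case 0
      then show ?case using pos[OF t(2), of 0] by simp
    next
      case (Suc j)
      have "\<mu> * (\<mu> ^ j * c1) \<le> \<mu> * F (a ^ j * t)" using Suc mu by (intro mult_left_mono) auto
      then show ?case using step[of j] by (simp add: mult.assoc)
    qed
    obtain j where j: "c2 / c1 < \<mu> ^ j" using real_arch_pow[OF mu(2)] by blast
    then have "c2 < \<mu> ^ j * c1" using lower(1) by (simp add: divide_less_eq)
    moreover have "F (a ^ j * t) \<le> c2" using t(2)[of j] by (intro le) simp
    ultimately show ?thesis using inc[of j] by linarith
  qed
  then show ?thesis using am by (simp add: divide_eq_1_iff)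
qed

section \<open>Consequences of compatibility: contraction, inflation and the Jacobian\<close>

locale compatible_similarity = cut_and_project M
  for M :: "((real^'m) \<times> (real^'n)) set" +
  fixes W :: "(real^'n) set" and Q :: "real^'m \<Rightarrow> real^'m" and A :: "real^'n \<Rightarrow> real^'n"
  assumes window: "model_window W" and zero_interior: "0 \<in> interior W"
    and similarity: "linear_similarity Q" and Q_image: "Q ` phys_lattice M = phys_lattice M"
    and star_map: "is_star_map M Q A"
    and compatible: "interior (translation_window A W) \<noteq> {}"
    and frontier_null: "frontier (translation_window A W) \<in> null_sets lebesgue"
begin

abbreviation "V \<equiv> translation_window A W"

lemma linear_A: "linear A" and star_Q: "x \<in> L \<Longrightarrow> star M (Q x) = A (star M x)"
  using star_map by (auto simp: is_star_map_def)

lemma compact_W: "compact W"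
  using window by (simp add: model_window_def)

lemma zero_W: "0 \<in> W"
  using zero_interior interior_subset by blast

lemma similarity_data:
  obtains q where "q \<noteq> 0" "linear Q" "\<And>x. norm (Q x) = \<bar>q\<bar> * norm x" "\<bar>det (matrix Q)\<bar> = \<bar>q\<bar> ^ CARD('m)" "bij Q"
proof -
  obtain q R where R: "orthogonal_transformation R" and Q: "Q = (\<lambda>x. q *\<^sub>R R x)"
    using similarity by (auto simp: linear_similarity_def)
  have lR: "linear R" using R by (simp add: orthogonal_transformation_linear)
  have lQ: "linear Q" unfolding Q using lR by (simp add: linear_compose_scale_right)
  have nQ: "norm (Q x) = \<bar>q\<bar> * norm x" for x
    unfolding Q using orthogonal_transformation_norm[OF R, of x] by simp
  \<comment> \<open>Otherwise Q L = L would force L to be {0}, against the density of its stars in a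
    space of positive dimension.\<close>
  have q: "q \<noteq> 0"
  proof
    assume "q = 0"
    then have "L \<subseteq> {0}" using Q_image by (auto simp: Q)
    obtain y :: "real^'n" where y: "norm y = 1" using vector_choose_size[of 1] by auto
    obtain x where "x \<in> L" "dist (star M x) y < 1" using star_dense[of 1 y] by auto
    moreover from this \<open>L \<subseteq> {0}\<close> have "star M x = 0" using star_zero by auto
    ultimately show False using y by (simp add: dist_norm)
  qed
  have "matrix Q = matrix (\<lambda>x. q *\<^sub>R x) ** matrix R"
    unfolding Q using matrix_compose[OF lR, of "\<lambda>x. q *\<^sub>R x"] by (simp add: o_def)
  then have d: "\<bar>det (matrix Q)\<bar> = \<bar>q\<bar> ^ CARD('m)"
    using orthogonal_transformation_det[OF R] by (simp add: det_mul abs_mult det_matrix_scaleR power_abs)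
  have "inj Q"
    unfolding linear_injective_0[OF lQ] using nQ q by (metis mult_eq_0_iff norm_eq_zero abs_eq_0)
  then have "bij Q" using linear_inj_imp_surj[OF lQ] by (simp add: bij_def)
  then show ?thesis using that q lQ nQ d by blast
qed

text \<open>Q L = L puts all stars into the range of A. This range is a closed subspace and the
  stars are dense, so A is surjective, hence injective in finite dimension.\<close>

lemma inj_A: "inj A"
proof -
  have "star M ` L \<subseteq> range A"
  proof
    fix y assume "y \<in> star M ` L"
    then obtain x where x: "x \<in> L" "y = star M x" by blast
    then obtain z where "z \<in> L" "x = Q z" using Q_image by blast
    then show "y \<in> range A" using x star_Q by auto
  qed
  moreover have "closed (range A)"
    using linear_A by (intro closed_subspace linear_subspace_image) auto
  moreover have "closure (star M ` L) = UNIV"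
  proof -
    have "\<exists>x\<in>L. dist (star M x) y < e" if "0 < e" for e y
      using star_dense[OF that, of y] by blast
    then show ?thesis by (auto simp: closure_approachable)
  qed
  ultimately have "surj A" using closure_minimal[of "star M ` L" "range A"] by auto
  then show ?thesis using linear_A by (simp add: linear_surjective_imp_injective)
qed

text \<open>V is the intersection of the closed conditions A x + u in W over x in W; the condition
  for x = 0 reads u in W.\<close>

lemma compact_V: "compact V" and V_subset: "V \<subseteq> W"
proof -
  show "V \<subseteq> W"
  proof
    fix u assume "u \<in> V"
    then have "A 0 + u \<in> W" using zero_W by (auto simp: translation_window_def)
    then show "u \<in> W" using linear_0[OF linear_A] by simp
  qed
  moreover have "closed V"
  proof -
    have "V = (\<Inter>x\<in>W. (\<lambda>u. A x + u) -` W)" by (auto simp: translation_window_def)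
    also have "closed \<dots>"
      using compact_imp_closed[OF compact_W]
      by (intro closed_INT ballI continuous_closed_vimage) (auto intro!: continuous_intros)
    finally show ?thesis .
  qed
  ultimately show "compact V"
    using compact_imp_bounded[OF compact_W] bounded_subset compact_eq_bounded_closed by blast
qed

lemma frontier_V: "frontier V \<in> null_sets lborel" and frontier_W: "frontier W \<in> null_sets lborel"
  using frontier_null window by (auto simp: null_sets_completion_iff model_window_def)

lemma measure_V_pos: "0 < measure lborel V" and measure_W_pos: "0 < measure lborel W"
proof -
  have p: "0 < measure lborel S" if "compact S" "interior S \<noteq> {}" for S :: "(real^'n) set"
  proof -
    have fin: "emeasure lborel S < \<infinity>" by (rule emeasure_bounded_finite[OF compact_imp_bounded[OF that(1)]])
    have fin2: "emeasure lborel (interior S) < \<infinity>"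
      by (rule emeasure_bounded_finite[OF bounded_subset[OF compact_imp_bounded[OF that(1)] interior_subset]])
    have "0 < measure lborel (interior S)"
      using that(2) fin2 by (intro measure_lborel_open_pos) auto
    also have "\<dots> \<le> measure lborel S"
      using fin that(1) by (intro measure_mono_fmeasurable interior_subset) (auto simp: fmeasurable_def borel_compact)
    finally show ?thesis .
  qed
  show "0 < measure lborel V" by (rule p[OF compact_V compatible])
  show "0 < measure lborel W" by (rule p[OF compact_W]) (use zero_interior in blast)
qed

text \<open>The difference set \<open>D\<close> of the window satisfies \<open>A D + B \<subseteq> D\<close> for a ball \<open>B\<close>, because
  \<open>V\<close> contains a ball; so \<open>D\<close> plays the role of the unit ball of a norm that \<open>A\<close> contracts.\<close>

lemma contraction:
  obtains C \<rho> where "0 < C" "0 < \<rho>" "\<rho> < 1" "\<And>N x. norm ((A ^^ N) x) \<le> C * \<rho> ^ N * norm x"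
proof -
  obtain u0 \<epsilon> where ball: "0 < \<epsilon>" "ball u0 \<epsilon> \<subseteq> V"
  proof -
    obtain u0 where "u0 \<in> interior V" using compatible by blast
    then show ?thesis using that unfolding mem_interior by blast
  qed
  obtain r0 where r0: "0 < r0" "ball 0 r0 \<subseteq> W"
    using zero_interior by (auto simp: mem_interior)
  obtain k where k: "0 < k" "W \<subseteq> cball 0 k" by (rule compact_subset_cball[OF compact_W])
  define D where "D = {x - y | x y. x \<in> W \<and> y \<in> W}"
  define K where "K = 2 * k"
  have K: "0 < K" using k by (simp add: K_def)
  have DK: "norm z \<le> K" if "z \<in> D" for z
  proof -
    obtain x y where xy: "z = x - y" "x \<in> W" "y \<in> W" using \<open>z \<in> D\<close> by (auto simp: D_def)
    then have "norm x \<le> k" "norm y \<le> k" using k(2) by auto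
    then show ?thesis using norm_triangle_ineq4[of x y] by (simp add: xy(1) K_def)
  qed
  have absorb: "A z + b \<in> D" if z: "z \<in> D" and b: "norm b < 2 * \<epsilon>" for z b
  proof -
    obtain x y where xy: "z = x - y" "x \<in> W" "y \<in> W" using z by (auto simp: D_def)
    \<comment> \<open>The perturbation b is split evenly between the two points of the difference;
      each half stays within \<epsilon> of \<open>u0\<close>, so |b| < 2 \<epsilon> is
      allowed.\<close>
    have "u0 + (1/2) *\<^sub>R b \<in> V" "u0 - (1/2) *\<^sub>R b \<in> V"
      using ball(2) b by (auto simp: dist_norm subset_eq)
    then have "A x + (u0 + (1/2) *\<^sub>R b) \<in> W" "A y + (u0 - (1/2) *\<^sub>R b) \<in> W"
      using xy by (auto simp: translation_window_def)
    moreover have "A z + b = (A x + (u0 + (1/2) *\<^sub>R b)) - (A y + (u0 - (1/2) *\<^sub>R b))"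
      unfolding xy(1) linear_diff[OF linear_A] by (simp add: algebra_simps flip: scaleR_add_left)
    ultimately show ?thesis unfolding D_def by blast
  qed
  \<comment> \<open>K bounds the norms in D, so t A z has norm at most \<epsilon> and can be
    absorbed: A maps D into D shrunk by the factor 1 + t.\<close>
  define t where "t = \<epsilon> / K"
  have t: "0 < t" using ball K by (simp add: t_def)
  have step: "(1 + t) *\<^sub>R A z \<in> D" if "z \<in> D" for z
  proof -
    have "A z \<in> D" using absorb[OF that, of 0] ball(1) by simp
    then have "norm (t *\<^sub>R A z) \<le> t * K" using DK t by (simp add: mult_left_mono)
    also have "\<dots> < 2 * \<epsilon>" using ball(1) K by (simp add: t_def)
    finally show ?thesis using absorb[OF that, of "t *\<^sub>R A z"] by (simp add: scaleR_add_left)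
  qed
  have iter: "(1 + t) ^ N *\<^sub>R (A ^^ N) z \<in> D" if "z \<in> D" for N z
  proof (induction N)
    case (Suc N)
    from step[OF this] show ?case by (simp add: linear_scale[OF linear_A])
  qed (use that in simp)
  define \<rho> where "\<rho> = 1 / (1 + t)"
  have rho: "0 < \<rho>" "\<rho> < 1" using t by (auto simp: \<rho>_def)
  have itn: "norm ((A ^^ N) z) \<le> K * \<rho> ^ N" if "z \<in> D" for N z
  proof -
    have "(1 + t) ^ N * norm ((A ^^ N) z) \<le> K"
      using DK[OF iter[OF that, of N]] t by simp
    then show ?thesis using t by (simp add: \<rho>_def power_divide le_divide_eq mult.commute)
  qed
  have linN: "linear (A ^^ N)" for N
  proof (induction N)
    case (Suc N)
    then show ?case using linear_compose[OF Suc linear_A] by (simp add: o_def)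
  qed (simp add: linear_id[unfolded id_def] linear_ident)
  have "norm ((A ^^ N) x) \<le> (2 * K / r0) * \<rho> ^ N * norm x" for N x
  proof (cases "x = 0")
    case True
    then show ?thesis using linear_0[OF linN] by simp
  next
    case False
    \<comment> \<open>Scales x to norm r0/2, hence into W; and W lies in D because 0 is in
      W.\<close>
    define c where "c = r0 / 2 / norm x"
    have c: "0 < c" using False r0 by (simp add: c_def)
    have "norm (c *\<^sub>R x) = r0 / 2" using False r0 by (simp add: c_def)
    then have "c *\<^sub>R x \<in> W" using r0 by (auto simp: subset_eq)
    then have "c *\<^sub>R x \<in> D" unfolding D_def using zero_W by force
    from itn[OF this, of N] have "c * norm ((A ^^ N) x) \<le> K * \<rho> ^ N"
      using c by (simp add: linear_scale[OF linN])
    then have "norm ((A ^^ N) x) \<le> K * \<rho> ^ N / c" using c by (simp add: le_divide_eq mult.commute)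
    also have "\<dots> = (2 * K / r0) * \<rho> ^ N * norm x" by (simp add: c_def)
    finally show ?thesis .
  qed
  moreover have "0 < 2 * K / r0" using K r0 by simp
  ultimately show ?thesis using that rho by blast
qed

text \<open>With w the iterated adjoint image of k, |w|^2 is the inner product of k with the N-th
  iterate of A at w; Cauchy-Schwarz and division by |w| transfer the bound for A with the same
  constants.\<close>

lemma adjoint_contraction:
  obtains C \<rho> where "0 < C" "0 < \<rho>" "\<rho> < 1" "\<And>N k. norm ((adjoint A ^^ N) k) \<le> C * \<rho> ^ N * norm k"
proof -
  obtain C \<rho> where C: "0 < C" "0 < \<rho>" "\<rho> < 1" "\<And>N x. norm ((A ^^ N) x) \<le> C * \<rho> ^ N * norm x"
    by (rule contraction) (rule that, assumption+)
  have adj: "(adjoint A ^^ N) k \<bullet> x = k \<bullet> (A ^^ N) x" for N k x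
  proof (induction N arbitrary: x)
    case (Suc N)
    have "(adjoint A ^^ Suc N) k \<bullet> x = x \<bullet> adjoint A ((adjoint A ^^ N) k)" by (simp add: inner_commute)
    also have "\<dots> = (adjoint A ^^ N) k \<bullet> A x" using adjoint_works[OF linear_A] by (simp add: inner_commute)
    also have "\<dots> = k \<bullet> (A ^^ Suc N) x" unfolding Suc by (simp add: funpow_swap1)
    finally show ?case .
  qed simp
  have "norm ((adjoint A ^^ N) k) \<le> C * \<rho> ^ N * norm k" for N k
  proof (cases "(adjoint A ^^ N) k = 0")
    case True
    then show ?thesis using C by simp
  next
    case False
    let ?w = "(adjoint A ^^ N) k"
    have "norm ?w * norm ?w = ?w \<bullet> ?w" by (metis power2_eq_square power2_norm_eq_inner)
    also have "\<dots> = k \<bullet> (A ^^ N) ?w" by (rule adj)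
    also have "\<dots> \<le> norm k * norm ((A ^^ N) ?w)" by (rule norm_cauchy_schwarz)
    also have "\<dots> \<le> norm k * (C * \<rho> ^ N * norm ?w)" by (intro mult_left_mono C(4)) simp
    finally have "norm ?w * norm ?w \<le> (C * \<rho> ^ N * norm k) * norm ?w" by (simp add: mult_ac)
    then show ?thesis using False by (simp only: mult_le_cancel_right) auto
  qed
  then show ?thesis using that C by blast
qed

text \<open>If |q| < 1, the orbit of a nonzero point of L under Q tends to 0. Its stars stay bounded
  because A contracts, so the orbit remains in one strip, where points keep a fixed distance from
  0.\<close>

lemma inflation_ge_1:
  assumes "\<And>x. norm (Q x) = \<bar>q\<bar> * norm x"
  shows "1 \<le> \<bar>q\<bar>"
proof (rule ccontr)
  assume lt: "\<not> 1 \<le> \<bar>q\<bar>"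
  obtain C \<rho> where C: "0 < C" "0 < \<rho>" "\<rho> < 1" "\<And>N x. norm ((A ^^ N) x) \<le> C * \<rho> ^ N * norm x"
    by (rule contraction) (rule that, assumption+)
  obtain y :: "real^'n" where y: "norm y = 1" using vector_choose_size[of 1] by auto
  obtain x where x: "x \<in> L" "dist (star M x) y < 1" using star_dense[of 1 y] by auto
  then have x0: "x \<noteq> 0" using y star_zero by (auto simp: dist_norm)
  have QN: "(Q ^^ N) x \<in> L \<and> star M ((Q ^^ N) x) = (A ^^ N) (star M x) \<and> norm ((Q ^^ N) x) = \<bar>q\<bar> ^ N * norm x" for N
  proof (induction N)
    case (Suc N)
    then show ?case using star_Q assms Q_image by auto
  qed (use x in simp)
  define R where "R = C * norm (star M x)"
  have strip: "(Q ^^ N) x \<in> strip R" for N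
  proof -
    have "\<rho> ^ N \<le> 1" using C by (intro power_le_one) auto
    then have "C * \<rho> ^ N * norm (star M x) \<le> C * 1 * norm (star M x)"
      using C by (intro mult_right_mono mult_left_mono) auto
    then show ?thesis using QN[of N] C(4)[of N "star M x"] by (simp add: strip_def R_def)
  qed
  have z: "0 \<in> strip R" using C zero_phys star_zero by (simp add: strip_def R_def)
  obtain \<delta> where d: "0 < \<delta>" "\<And>x y. x \<in> strip R \<Longrightarrow> y \<in> strip R \<Longrightarrow> x \<noteq> y \<Longrightarrow> \<delta> \<le> dist x y"
    by (rule strip_separated[of R]) (rule that, assumption+)
  have q0: "\<bar>q\<bar> \<noteq> 0"
  proof
    assume "\<bar>q\<bar> = 0"
    then have Q0: "Q z = 0" for z using assms[of z] by simp
    have "x \<in> Q ` L" using x Q_image by simp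
    then show False using x0 Q0 by auto
  qed
  have "\<delta> \<le> \<bar>q\<bar> ^ N * norm x" for N
  proof -
    have "norm ((Q ^^ N) x) = \<bar>q\<bar> ^ N * norm x" using QN by blast
    moreover from this have "(Q ^^ N) x \<noteq> 0" using q0 x0 by (metis mult_eq_0_iff norm_eq_zero power_not_zero)
    ultimately show ?thesis using d(2)[OF strip z, of N] by simp
  qed
  moreover have "(\<lambda>N. \<bar>q\<bar> ^ N * norm x) \<longlonglongrightarrow> 0 * norm x"
    using lt by (intro tendsto_intros LIMSEQ_realpow_zero) auto
  ultimately have "\<delta> \<le> 0" by (intro LIMSEQ_le_const[of _ "0 * norm x" \<delta>, simplified]) auto
  then show False using d(1) by simp
qed

text \<open>The constant c of the image measure is found by counting. Equidistribution of
  \<open>bump\<close> after A gives c as the limit of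
  \<open>count_scale (\<bar>q\<bar> * s) / count_scale s\<close>, and the growth bounds force it to
  be |q|^m. In effect |det Q| |det A| = 1, as for an automorphism of a lattice.\<close>

lemma linear_A_jacobian: "distr lborel borel A = density lborel (\<lambda>_. ennreal \<bar>det (matrix Q)\<bar>)"
  and jacobian_pos: "0 < \<bar>det (matrix Q)\<bar>"
proof -
  obtain q where q: "q \<noteq> 0" "linear Q" "\<And>x. norm (Q x) = \<bar>q\<bar> * norm x" "\<bar>det (matrix Q)\<bar> = \<bar>q\<bar> ^ CARD('m)" "bij Q"
    by (rule similarity_data) (rule that, assumption+)
  show "0 < \<bar>det (matrix Q)\<bar>" using q by simp
  obtain c where c: "0 < c" "distr lborel borel A = density lborel (\<lambda>_. ennreal c)"
    by (rule distr_linear_lborel[OF linear_A inj_A])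
  obtain b where b: "\<And>x. norm x \<le> b * norm (A x)"
  proof -
    obtain e where "0 < e" "\<And>x. e * norm x \<le> norm (A x)"
      using linear_inj_bounded_below_pos[OF linear_A inj_A] by blast
    then show ?thesis using that[of "1 / e"] by (simp add: field_simps)
  qed
  \<comment> \<open>The lower bound b for A confines the support of \<open>bump\<close> after A to
    this ball.\<close>
  define R where "R = max 1 \<bar>b\<bar>"
  let ?g = "\<lambda>y. bump (A y)" and ?I = "\<integral>x. bump x \<partial>lborel"
  have gc: "continuous_on UNIV ?g"
    using linear_A by (intro continuous_on_compose2[OF bump_continuous])
      (auto simp: linear_continuous_on linear_conv_bounded_linear)
  have gs: "?g y = 0" if "y \<notin> cball 0 R" for y
  proof (rule bump_support)
    show "A y \<notin> cball 0 1"
    proof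
      assume "A y \<in> cball 0 1"
      then have "\<bar>b\<bar> * norm (A y) \<le> \<bar>b\<bar> * 1" by (intro mult_left_mono) auto
      moreover have "norm y \<le> \<bar>b\<bar> * norm (A y)"
        using b[of y] abs_ge_self[of b] mult_right_mono[of b "\<bar>b\<bar>" "norm (A y)"] by simp
      ultimately show False using that by (simp add: R_def)
    qed
  qed
  have lim: "((\<lambda>s. csum R ?g s / count_scale s) \<longlongrightarrow> (\<integral>x. ?g x \<partial>lborel)) at_top"
    by (rule csum_equidistribution[OF gc]) (rule gs)
  have mb: "bump \<in> borel_measurable borel" using bump_continuous by (simp add: borel_measurable_continuous_onI)
  have int: "(\<integral>x. ?g x \<partial>lborel) = c * ?I"
    using lborel_integral_linear[OF linear_A c mb] by simp
  have I: "0 < ?I" by (rule bump_integral_pos)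
  \<comment> \<open>Q permutes L, multiplies norms by |q| and satisfies
    \<open>star M (Q y) = A (star M y)\<close>: the sum up to s of the composed function is the sum
    of \<open>bump\<close> up to |q| s.\<close>
  have scale: "csum R ?g s = ?I * count_scale (\<bar>q\<bar> * s)" for s
  proof -
    let ?F = "{y \<in> strip R. norm y \<le> s}" and ?F1 = "{x \<in> strip 1. norm x \<le> \<bar>q\<bar> * s}"
    have "csum 1 bump (\<bar>q\<bar> * s) = (\<Sum>y\<in>{y \<in> L. Q y \<in> ?F1}. bump (star M (Q y)))"
      unfolding csum_def
    proof (rule sum.reindex_cong)
      show "inj_on Q {y \<in> L. Q y \<in> ?F1}" using q(5) by (auto simp: bij_def intro: inj_on_subset)
      show "?F1 = Q ` {y \<in> L. Q y \<in> ?F1}"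
      proof (intro set_eqI iffI)
        fix x assume x: "x \<in> ?F1"
        then have "x \<in> Q ` L" using Q_image strip_phys by auto
        then show "x \<in> Q ` {y \<in> L. Q y \<in> ?F1}" using x by blast
      qed auto
    qed simp
    also have "\<dots> = csum R ?g s"
      unfolding csum_def
    proof (rule sum.mono_neutral_cong_left[OF finite_strip_norm])
      show "{y \<in> L. Q y \<in> ?F1} \<subseteq> ?F"
      proof
        fix y assume y: "y \<in> {y \<in> L. Q y \<in> ?F1}"
        then have yL: "y \<in> L" by blast
        have "norm (A (star M y)) \<le> 1" using y star_Q[OF yL] by (simp add: strip_def)
        then have "\<bar>b\<bar> * norm (A (star M y)) \<le> \<bar>b\<bar> * 1" by (intro mult_left_mono) auto
        moreover have "norm (star M y) \<le> \<bar>b\<bar> * norm (A (star M y))"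
          using b[of "star M y"] abs_ge_self[of b] mult_right_mono[of b "\<bar>b\<bar>" "norm (A (star M y))"] by simp
        ultimately have "norm (star M y) \<le> R" by (simp add: R_def)
        then show "y \<in> ?F" using y q(1,3) by (simp add: strip_def)
      qed
      show "\<forall>i\<in>?F - {y \<in> L. Q y \<in> ?F1}. bump (A (star M i)) = 0"
      proof
        fix y assume y: "y \<in> ?F - {y \<in> L. Q y \<in> ?F1}"
        then have yL: "y \<in> L" using strip_phys by blast
        then have "Q y \<in> L" using Q_image by blast
        moreover have "norm (Q y) \<le> \<bar>q\<bar> * s" using y q(3) by (simp add: mult_left_mono)
        ultimately have "\<not> norm (star M (Q y)) \<le> 1" using y yL by (auto simp: strip_def)
        then show "bump (A (star M y)) = 0" using star_Q[OF yL] bump_support[of "A (star M y)"] by simp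
      qed
    qed (simp add: star_Q)
    finally have "csum R ?g s = csum 1 bump (\<bar>q\<bar> * s)" by simp
    then show ?thesis using I by (simp add: count_scale_def)
  qed
  have "((\<lambda>s. (1 / ?I) * (csum R ?g s / count_scale s)) \<longlongrightarrow> (1 / ?I) * (c * ?I)) at_top"
    using lim unfolding int by (intro tendsto_intros)
  then have lim2: "((\<lambda>s. count_scale (\<bar>q\<bar> * s) / count_scale s) \<longlongrightarrow> c) at_top"
    unfolding scale using I by simp
  obtain c1 s1 where c1: "0 < c1" "\<And>s. s1 \<le> s \<Longrightarrow> c1 * s ^ CARD('m) \<le> count_scale s"
    by (rule count_scale_lower) (rule that, assumption+)
  obtain c2 where c2: "0 < c2" "\<And>s. 1 \<le> s \<Longrightarrow> count_scale s \<le> c2 * s ^ CARD('m)"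
    by (rule count_scale_upper) (rule that, assumption+)
  have "c = \<bar>q\<bar> ^ CARD('m)"
    by (rule ratio_limit_eq_power[OF c1 c2(2) lim2 inflation_ge_1[OF q(3)]])
  then show "distr lborel borel A = density lborel (\<lambda>_. ennreal \<bar>det (matrix Q)\<bar>)"
    using c(2) q(4) by simp
qed

end

section \<open>The averaging operator\<close>

definition wave :: "real^'n \<Rightarrow> real^'n \<Rightarrow> complex" where
  "wave k x = exp (- (2 * of_real pi * \<i> * of_real (k \<bullet> x)))"

lemma norm_wave [simp]: "norm (wave k x) = 1"
  by (simp add: wave_def)

lemma wave_add: "wave k (x + y) = wave k x * wave k y"
  by (simp add: wave_def inner_add_right algebra_simps flip: exp_add)

lemma wave_adjoint: "linear A \<Longrightarrow> wave k (A x) = wave (adjoint A k) x"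
  using adjoint_works[of A x k] by (simp add: wave_def inner_commute)

lemma wave_continuous: "continuous_on UNIV (wave k)"
  unfolding wave_def by (intro continuous_intros)

lemma wave_measurable [measurable]: "wave k \<in> borel_measurable borel"
  using wave_continuous by (rule borel_measurable_continuous_onI)

lemma norm_wave_minus_one: "norm (wave k x - 1) \<le> 2 * pi * norm k * norm x"
proof -
  have "wave k x = exp (\<i> * of_real (- (2 * pi * (k \<bullet> x))))"
    by (simp add: wave_def mult_ac)
  then have "norm (wave k x - 1) = 2 * \<bar>sin (- (2 * pi * (k \<bullet> x)) / 2)\<bar>"
    by (simp only: dist_exp_i_1)
  also have "\<dots> \<le> 2 * \<bar>- (2 * pi * (k \<bullet> x)) / 2\<bar>"
    by (intro mult_left_mono abs_sin_x_le_abs_x) simp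
  also have "\<dots> = 2 * pi * \<bar>k \<bullet> x\<bar>" by (simp add: abs_mult)
  also have "\<dots> \<le> 2 * pi * (norm k * norm x)"
    by (intro mult_left_mono Cauchy_Schwarz_ineq2) simp
  finally show ?thesis by (simp add: mult.assoc)
qed

lemma fourier_wave:
  "f \<in> borel_measurable borel \<Longrightarrow> fourier f k = (\<integral>x. wave k x * f x \<partial>lborel)"
  unfolding wave_def by (rule fourier_lborel)

lemma integrable_bounded_support:
  fixes f :: "'a::euclidean_space \<Rightarrow> 'b::{banach, second_countable_topology}"
  assumes f: "f \<in> borel_measurable borel" and S: "compact S"
    and bound: "\<And>x. norm (f x) \<le> c" and supp: "\<And>x. x \<notin> S \<Longrightarrow> f x = 0"
  shows "integrable lborel f"
proof (rule Bochner_Integration.integrable_bound[where f="\<lambda>x. c * indicator S x"])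
  show "integrable lborel (\<lambda>x. c * indicator S x :: real)"
    using S by (intro integrable_mult_right integrable_real_indicator emeasure_bounded_finite)
      (auto simp: borel_compact compact_imp_bounded)
  have c: "0 \<le> c" using norm_ge_zero bound by (rule order_trans)
  have "norm (f x) \<le> norm (c * indicator S x :: real)" for x
    using bound[of x] supp[of x] c by (cases "x \<in> S") auto
  then show "AE x in lborel. norm (f x) \<le> norm (c * indicator S x :: real)" by simp
qed (use f in auto)

text \<open>The second estimate integrates |\<open>wave k x\<close> - 1| against F over its support.
  Being linear in |k|, it decays geometrically at iterated adjoint images of k; this governs both
  the factors of the product and the remainder left after finitely many of them.\<close>

lemma fourier_probability_bounds:
  fixes F :: "real^'n \<Rightarrow> real"
  assumes F: "F \<in> borel_measurable borel" "integrable lborel F" "\<And>x. 0 \<le> F x" "(\<integral>x. F x \<partial>lborel) = 1"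
    and supp: "\<And>x. x \<notin> cball 0 r \<Longrightarrow> F x = 0"
  shows "norm (fourier (\<lambda>x. complex_of_real (F x)) k) \<le> 1"
    and "norm (fourier (\<lambda>x. complex_of_real (F x)) k - 1) \<le> 2 * pi * r * norm k"
proof -
  have [measurable]: "F \<in> borel_measurable borel" by (rule F)
  have eq: "fourier (\<lambda>x. complex_of_real (F x)) k = (\<integral>x. wave k x * of_real (F x) \<partial>lborel)"
    by (intro fourier_wave) measurable
  have i: "integrable lborel (\<lambda>x. wave k x * complex_of_real (F x))"
    by (rule Bochner_Integration.integrable_bound[OF F(2)]) (auto simp: norm_mult)
  have iF: "integrable lborel (\<lambda>x. complex_of_real (F x))" using F(2) by simp
  have "norm (\<integral>x. wave k x * complex_of_real (F x) \<partial>lborel) \<le> (\<integral>x. norm (wave k x * complex_of_real (F x)) \<partial>lborel)"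
    by (rule integral_norm_bound)
  also have "\<dots> = 1" using F(3,4) by (simp add: norm_mult)
  finally show "norm (fourier (\<lambda>x. complex_of_real (F x)) k) \<le> 1" unfolding eq .
  have one: "(\<integral>x. complex_of_real (F x) \<partial>lborel) = 1" using F(4) by simp
  have "norm (fourier (\<lambda>x. complex_of_real (F x)) k - 1)
     = norm (\<integral>x. wave k x * complex_of_real (F x) - complex_of_real (F x) \<partial>lborel)"
    unfolding eq one[symmetric] using i iF by simp
  also have "\<dots> \<le> (\<integral>x. norm (wave k x * complex_of_real (F x) - complex_of_real (F x)) \<partial>lborel)"
    by (rule integral_norm_bound)
  also have "\<dots> \<le> (\<integral>x. 2 * pi * r * norm k * F x \<partial>lborel)"
  proof (rule integral_mono)
    show "norm (wave k x * complex_of_real (F x) - complex_of_real (F x)) \<le> 2 * pi * r * norm k * F x" for x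
    proof (cases "x \<in> cball 0 r")
      case True
      have "wave k x * complex_of_real (F x) - complex_of_real (F x) = (wave k x - 1) * of_real (F x)"
        by (simp add: algebra_simps)
      then have "norm (wave k x * complex_of_real (F x) - complex_of_real (F x)) = norm (wave k x - 1) * F x"
        using F(3)[of x] by (simp add: norm_mult)
      also have "\<dots> \<le> (2 * pi * norm k * norm x) * F x"
        by (intro mult_right_mono norm_wave_minus_one F)
      also have "\<dots> \<le> (2 * pi * norm k * r) * F x"
        using True by (intro mult_right_mono mult_left_mono F) auto
      finally show ?thesis by (simp add: mult_ac)
    qed (simp add: supp)
  qed (use i iF F(2) in auto)
  also have "\<dots> = 2 * pi * r * norm k" using F(4) by simp
  finally show "norm (fourier (\<lambda>x. complex_of_real (F x)) k - 1) \<le> 2 * pi * r * norm k" .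
qed

context compatible_similarity
begin

abbreviation "\<mu> \<equiv> measure lborel V"
abbreviation "jac \<equiv> \<bar>det (matrix Q)\<bar>"

text \<open>The density of A w + u for independent w with density f and u uniform on V: the
  convolution of the normalised indicator of V with the image of f under A.\<close>

definition avg :: "(real^'n \<Rightarrow> real) \<Rightarrow> real^'n \<Rightarrow> real" where
  "avg f y = (\<integral>w. indicator V (y - A w) * f w \<partial>lborel) / \<mu>"

text \<open>Continuity is not demanded, since one application of \<open>avg\<close> produces it; the
  bound c is recorded because it controls the resulting modulus of continuity.\<close>

definition prob_density :: "real \<Rightarrow> (real^'n \<Rightarrow> real) \<Rightarrow> bool" where
  "prob_density c f \<longleftrightarrow> f \<in> borel_measurable borel \<and> (\<forall>x. 0 \<le> f x \<and> f x \<le> c) \<and>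
     (\<forall>x. x \<notin> W \<longrightarrow> f x = 0) \<and> (\<integral>x. f x \<partial>lborel) = 1"

lemma V_borel [measurable]: "V \<in> sets borel"
  using compact_V by (rule borel_compact)

lemma A_continuous: "continuous_on UNIV A"
  using linear_A by (simp add: linear_continuous_on linear_conv_bounded_linear)

lemma A_measurable [measurable]: "A \<in> borel_measurable borel"
  using A_continuous by (rule borel_measurable_continuous_onI)

lemma prob_density_integrable:
  assumes "prob_density c f" shows "integrable lborel f"
  by (rule integrable_bounded_support[OF _ compact_W, of f c]) (use assms in \<open>auto simp: prob_density_def\<close>)

lemma integrable_compose_A:
  fixes G :: "real^'n \<Rightarrow> real"
  assumes "integrable lborel G" shows "integrable lborel (\<lambda>x. G (A x))"
proof (rule integrable_distr[where T=A and M'=borel])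
  show "integrable (distr lborel borel A) G"
    unfolding linear_A_jacobian using assms by (subst integrable_density) auto
qed simp

lemma integral_compose_A:
  fixes G :: "real^'n \<Rightarrow> real"
  assumes "G \<in> borel_measurable borel"
  shows "(\<integral>x. G (A x) \<partial>lborel) = jac * (\<integral>x. G x \<partial>lborel)"
  using lborel_integral_linear[OF linear_A jacobian_pos linear_A_jacobian assms] by simp

lemma avg_integrable:
  assumes "prob_density c f"
  shows "integrable lborel (\<lambda>w. indicator V (y - A w) * f w)"
proof (rule Bochner_Integration.integrable_bound[OF prob_density_integrable[OF assms]])
  have [measurable]: "f \<in> borel_measurable borel" using assms by (simp add: prob_density_def)
  show "(\<lambda>w. indicator V (y - A w) * f w) \<in> borel_measurable lborel" by measurable
qed (auto simp: indicator_def)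

lemma avg_bounds:
  assumes f: "prob_density c f"
  shows "0 \<le> avg f y" "avg f y \<le> 1 / \<mu>"
proof -
  have nn: "0 \<le> f x" for x using f by (simp add: prob_density_def)
  have "0 \<le> (\<integral>w. indicator V (y - A w) * f w \<partial>lborel)" using nn by (intro integral_nonneg_AE) auto
  then show "0 \<le> avg f y" unfolding avg_def using measure_V_pos by simp
  have "(\<integral>w. indicator V (y - A w) * f w \<partial>lborel) \<le> (\<integral>w. f w \<partial>lborel)"
    by (rule integral_mono[OF avg_integrable[OF f] prob_density_integrable[OF f]]) (use nn in \<open>auto simp: indicator_def\<close>)
  also have "\<dots> = 1" using f by (simp add: prob_density_def)
  finally show "avg f y \<le> 1 / \<mu>" unfolding avg_def using measure_V_pos by (intro divide_right_mono) auto
qed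

text \<open>If w is in W and y - A w is in V, then y = A w + (y - A w) is in W by the definition of
  V.\<close>

lemma avg_support:
  assumes "\<And>x. x \<notin> W \<Longrightarrow> f x = 0" and "y \<notin> W"
  shows "avg f y = 0"
proof -
  have "indicator V (y - A w) * f w = 0" for w
  proof (cases "w \<in> W")
    case True
    have "y - A w \<notin> V"
    proof
      assume "y - A w \<in> V"
      then have "A w + (y - A w) \<in> W" using True by (auto simp: translation_window_def)
      then show False using assms(2) by simp
    qed
    then show ?thesis by simp
  qed (use assms(1) in simp)
  then have "(\<lambda>w. indicator V (y - A w) * f w) = (\<lambda>w. 0)" by (rule ext)
  then show ?thesis unfolding avg_def by simp
qed

text \<open>Estimating f by c and substituting z = A w leaves the L1 distance of two translates of
  the indicator of V. Apart from c, nothing depends on f.\<close>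

lemma avg_diff_bound:
  assumes f: "prob_density c f"
  shows "\<bar>avg f y - avg f y'\<bar> \<le> c * jac / \<mu> * (\<integral>u. \<bar>indicator V ((y' - y) + u) - indicator V u\<bar> \<partial>lborel)"
proof -
  let ?G = "\<lambda>z. \<bar>indicator V (y - z) - indicator V (y' - z)\<bar> :: real"
  let ?H = "\<lambda>u. \<bar>indicator V ((y' - y) + u) - indicator V u\<bar> :: real"
  have f': "\<And>x. 0 \<le> f x" "\<And>x. f x \<le> c" using f by (auto simp: prob_density_def)
  have c: "0 \<le> c" using order_trans[OF f'] by blast
  have mG [measurable]: "?G \<in> borel_measurable borel" by measurable
  have mH [measurable]: "?H \<in> borel_measurable borel" by measurable
  have iG: "integrable lborel ?G"
  proof (rule integrable_bounded_support[where c=1])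
    show "compact ((\<lambda>x. y - x) ` V \<union> (\<lambda>x. y' - x) ` V)"
      using compact_V by (intro compact_Un compact_continuous_image continuous_intros)
    show "?G x = 0" if "x \<notin> (\<lambda>x. y - x) ` V \<union> (\<lambda>x. y' - x) ` V" for x
    proof -
      have "y - x \<notin> V" "y' - x \<notin> V"
        using that by (auto simp: image_iff)
      then show ?thesis by simp
    qed
    show "norm (?G x) \<le> 1" for x by (simp add: indicator_def)
  qed simp
  have "\<bar>(\<integral>w. indicator V (y - A w) * f w \<partial>lborel) - (\<integral>w. indicator V (y' - A w) * f w \<partial>lborel)\<bar>
     = \<bar>\<integral>w. indicator V (y - A w) * f w - indicator V (y' - A w) * f w \<partial>lborel\<bar>"
    using avg_integrable[OF f] by simp
  also have "\<dots> \<le> (\<integral>w. c * ?G (A w) \<partial>lborel)"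
  proof (rule order_trans[OF integral_abs_bound integral_mono])
    show "integrable lborel (\<lambda>w. c * ?G (A w))"
      by (intro integrable_mult_right integrable_compose_A iG)
    show "integrable lborel (\<lambda>w. \<bar>indicator V (y - A w) * f w - indicator V (y' - A w) * f w\<bar>)"
      using avg_integrable[OF f] by auto
    fix w
    have "indicator V (y - A w) * f w - indicator V (y' - A w) * f w
      = f w * (indicator V (y - A w) - indicator V (y' - A w))" by (simp add: algebra_simps)
    then have "\<bar>indicator V (y - A w) * f w - indicator V (y' - A w) * f w\<bar> = f w * ?G (A w)"
      using f'(1)[of w] by (simp add: abs_mult)
    also have "\<dots> \<le> c * ?G (A w)" by (intro mult_right_mono f') simp
    finally show "\<bar>indicator V (y - A w) * f w - indicator V (y' - A w) * f w\<bar> \<le> c * ?G (A w)" .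
  qed
  also have "\<dots> = c * (jac * (\<integral>z. ?G z \<partial>lborel))" using integral_compose_A[OF mG] by simp
  also have "(\<integral>z. ?G z \<partial>lborel) = (\<integral>u. ?H u \<partial>lborel)"
    using lborel_integral_reflect[OF mH, of y] by (simp add: algebra_simps abs_minus_commute)
  finally have "\<bar>(\<integral>w. indicator V (y - A w) * f w \<partial>lborel) - (\<integral>w. indicator V (y' - A w) * f w \<partial>lborel)\<bar> / \<mu>
     \<le> c * (jac * (\<integral>u. ?H u \<partial>lborel)) / \<mu>"
    using measure_V_pos by (intro divide_right_mono) auto
  moreover have "\<bar>avg f y - avg f y'\<bar>
    = \<bar>(\<integral>w. indicator V (y - A w) * f w \<partial>lborel) - (\<integral>w. indicator V (y' - A w) * f w \<partial>lborel)\<bar> / \<mu>"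
    unfolding avg_def using measure_V_pos by (simp add: abs_divide flip: diff_divide_distrib)
  ultimately show ?thesis by (simp add: mult_ac)
qed

text \<open>The same d serves all points and all densities bounded by c, which is the input for
  Arzela-Ascoli.\<close>

lemma avg_equicontinuous:
  assumes e: "0 < e"
  obtains d where "0 < d" "\<And>f y y'. prob_density c f \<Longrightarrow> norm (y - y') < d \<Longrightarrow> \<bar>avg f y - avg f y'\<bar> < e"
proof -
  \<comment> \<open>The 1 makes b positive, so that e / b is a valid tolerance.\<close>
  define b where "b = \<bar>c * jac / \<mu>\<bar> + 1"
  have cb: "c * jac / \<mu> \<le> b" using abs_ge_self[of "c * jac / \<mu>"] unfolding b_def by linarith
  have b: "0 < b" using abs_ge_zero[of "c * jac / \<mu>"] unfolding b_def by linarith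
  obtain d where d: "0 < d"
    "\<And>t. norm t < d \<Longrightarrow> (\<integral>x. \<bar>indicator V (t + x) - indicator V x\<bar> \<partial>lborel) < e / b"
    by (rule indicator_translation_continuous[OF compact_V frontier_V, of "e / b"]) (use e b that in auto)
  have "\<bar>avg f y - avg f y'\<bar> < e" if f: "prob_density c f" and n: "norm (y - y') < d" for f y y'
  proof -
    let ?H = "\<integral>x. \<bar>indicator V ((y' - y) + x) - indicator V x\<bar> \<partial>(lborel :: (real^'n) measure) :: real"
    have "\<bar>avg f y - avg f y'\<bar> \<le> c * jac / \<mu> * ?H" by (rule avg_diff_bound[OF f])
    also have "\<dots> \<le> b * ?H" by (intro mult_right_mono cb) simp
    also have "\<dots> < b * (e / b)" using d(2)[of "y' - y"] n b by (simp only: mult_less_cancel_left_pos norm_minus_commute)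
    also have "\<dots> = e" using b by simp
    finally show ?thesis .
  qed
  then show thesis using that d(1) by blast
qed

lemma avg_continuous:
  assumes f: "prob_density c f" shows "continuous_on UNIV (avg f)"
  unfolding continuous_on_iff
proof (intro ballI allI impI)
  fix x and e :: real assume "0 < e"
  then obtain d where d: "0 < d" "\<And>f y y'. prob_density c f \<Longrightarrow> norm (y - y') < d \<Longrightarrow> \<bar>avg f y - avg f y'\<bar> < e"
    by (rule avg_equicontinuous) (rule that, assumption+)
  then show "\<exists>d>0. \<forall>x'\<in>UNIV. dist x' x < d \<longrightarrow> dist (avg f x') (avg f x) < e"
    using f by (auto simp: dist_norm intro!: exI[of _ d])
qed

text \<open>Normalising before transforming exhibits the factor as the transform of a probability
  density, to which \<open>fourier_probability_bounds\<close> applies.\<close>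

lemma conv_factor_eq:
  "conv_factor A V N k = fourier (\<lambda>x. complex_of_real (indicator V x / \<mu>)) ((adjoint A ^^ N) k)"
proof -
  have "fourier (\<lambda>x. complex_of_real (indicator V x / \<mu>)) q = fourier (indicator V) q / of_real \<mu>" for q
    by (simp add: fourier_wave of_real_indicator)
  moreover have "measure lebesgue V = \<mu>" by simp
  ultimately show ?thesis unfolding conv_factor_def by simp
qed

lemma conv_factor_bounds:
  obtains r where "0 < r" "\<And>N k. norm (conv_factor A V N k) \<le> 1"
    "\<And>N k. norm (conv_factor A V N k - 1) \<le> 2 * pi * r * norm ((adjoint A ^^ N) k)"
proof -
  obtain r where r: "0 < r" "V \<subseteq> cball 0 r" by (rule compact_subset_cball[OF compact_V])
  let ?F = "\<lambda>x. indicator V x / \<mu> :: real"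
  have F: "?F \<in> borel_measurable borel" "\<And>x. 0 \<le> ?F x" "\<And>x. x \<notin> cball 0 r \<Longrightarrow> ?F x = 0"
    using r(2) by (auto simp: indicator_def)
  have iF: "integrable lborel ?F"
    using compact_V by (intro integrable_divide integrable_real_indicator emeasure_bounded_finite)
      (auto simp: compact_imp_bounded)
  have int: "(\<integral>x. ?F x \<partial>lborel) = 1" using measure_V_pos by simp
  show thesis
  proof (rule that[OF r(1)])
    show "norm (conv_factor A V N k) \<le> 1" for N k
      unfolding conv_factor_eq by (rule fourier_probability_bounds(1)[OF F(1) iF F(2) int]) (rule F(3))
    show "norm (conv_factor A V N k - 1) \<le> 2 * pi * r * norm ((adjoint A ^^ N) k)" for N k
      unfolding conv_factor_eq by (rule fourier_probability_bounds(2)[OF F(1) iF F(2) int]) (rule F(3))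
  qed
qed

text \<open>The convolution theorem: after Fubini, the translation y = A w + u splits
  \<open>wave k y\<close> into a wave in u and, through the adjoint, a wave in w.\<close>

lemma fourier_avg:
  assumes f: "prob_density c f"
  shows "fourier (\<lambda>x. complex_of_real (avg f x)) k
     = conv_factor A V 0 k * fourier (\<lambda>x. complex_of_real (f x)) (adjoint A k)"
proof -
  have mf [measurable]: "f \<in> borel_measurable borel" using f by (simp add: prob_density_def)
  have mavg [measurable]: "avg f \<in> borel_measurable borel"
    using avg_continuous[OF f] by (rule borel_measurable_continuous_onI)
  have f': "\<And>x. 0 \<le> f x" "\<And>x. f x \<le> c" "\<And>x. x \<notin> W \<Longrightarrow> f x = 0" using f by (auto simp: prob_density_def)
  have c: "0 \<le> c" using order_trans[OF f'(1,2)] by blast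
  let ?g = "\<lambda>w y. wave k y * of_real (indicator V (y - A w) * f w)"
  \<comment> \<open>Needed for Fubini: the integrand is bounded by c and vanishes off a compact
    product, since w in W and y - A w in V force y into W.\<close>
  have int: "integrable (lborel \<Otimes>\<^sub>M lborel) (case_prod ?g)"
    unfolding lborel_prod
  proof (rule integrable_bounded_support[where S="W \<times> W" and c=c])
    have "case_prod ?g \<in> borel_measurable (borel \<Otimes>\<^sub>M borel)" by measurable
    then show "case_prod ?g \<in> borel_measurable borel" by (simp add: borel_prod)
    show "compact (W \<times> W)" using compact_W by (intro compact_Times)
    show "norm (case_prod ?g x) \<le> c" for x
      using f'(1,2)[of "fst x"] c by (cases x) (auto simp: norm_mult indicator_def)
    show "case_prod ?g x = 0" if "x \<notin> W \<times> W" for x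
    proof (cases x)
      case (Pair w y)
      show ?thesis
      proof (cases "w \<in> W")
        case True
        then have "y \<notin> W" using that Pair by auto
        have "y - A w \<notin> V"
        proof
          assume "y - A w \<in> V"
          then have "A w + (y - A w) \<in> W" using True by (auto simp: translation_window_def)
          then show False using \<open>y \<notin> W\<close> by simp
        qed
        then show ?thesis using Pair by simp
      next
        case False
        then show ?thesis using f'(3) Pair by simp
      qed
    qed
  qed
  have inner: "(\<integral>y. ?g w y \<partial>lborel) = fourier (indicator V) k * (wave (adjoint A k) w * of_real (f w))" for w
  proof -
    have m: "?g w \<in> borel_measurable borel" by measurable
    have "(\<integral>y. ?g w y \<partial>lborel) = (\<integral>u. ?g w (A w + u) \<partial>lborel)"
      by (rule lborel_integral_translate[OF m, symmetric])
    also have "\<dots> = (\<integral>u. (wave k u * indicator V u) * (wave (adjoint A k) w * of_real (f w)) \<partial>lborel)"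
      by (intro Bochner_Integration.integral_cong refl)
        (simp add: wave_add wave_adjoint[OF linear_A] indicator_def)
    also have "\<dots> = (\<integral>u. wave k u * indicator V u \<partial>lborel) * (wave (adjoint A k) w * of_real (f w))"
      by simp
    also have "(\<integral>u. wave k u * indicator V u \<partial>lborel) = fourier (indicator V) k"
      by (rule fourier_wave[symmetric]) measurable
    finally show ?thesis .
  qed
  have "fourier (\<lambda>x. complex_of_real (avg f x)) k = (\<integral>y. wave k y * of_real (avg f y) \<partial>lborel)"
    by (rule fourier_wave) measurable
  also have "\<dots> = (\<integral>y. (\<integral>w. ?g w y \<partial>lborel) / of_real \<mu> \<partial>lborel)"
  proof (intro Bochner_Integration.integral_cong refl)
    fix y
    have "(\<integral>w. ?g w y \<partial>lborel) = wave k y * (\<integral>w. complex_of_real (indicator V (y - A w) * f w) \<partial>lborel)"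
      by (rule integral_mult_right_zero)
    also have "(\<integral>w. complex_of_real (indicator V (y - A w) * f w) \<partial>lborel)
       = of_real (\<integral>w. indicator V (y - A w) * f w \<partial>lborel)"
      by (rule integral_complex_of_real)
    finally show "wave k y * of_real (avg f y) = (\<integral>w. ?g w y \<partial>lborel) / of_real \<mu>"
      by (simp only: avg_def of_real_divide times_divide_eq_right)
  qed
  also have "\<dots> = (\<integral>y. (\<integral>w. ?g w y \<partial>lborel) \<partial>lborel) / of_real \<mu>" by simp
  also have "(\<integral>y. (\<integral>w. ?g w y \<partial>lborel) \<partial>lborel) = (\<integral>w. (\<integral>y. ?g w y \<partial>lborel) \<partial>lborel)"
    by (rule lborel_pair.Fubini_integral[OF int])
  also have "\<dots> = fourier (indicator V) k * (\<integral>w. wave (adjoint A k) w * of_real (f w) \<partial>lborel)"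
    unfolding inner by (rule integral_mult_right_zero)
  also have "(\<integral>w. wave (adjoint A k) w * of_real (f w) \<partial>lborel) = fourier (\<lambda>x. complex_of_real (f x)) (adjoint A k)"
    by (rule fourier_wave[symmetric]) measurable
  finally show ?thesis by (simp add: conv_factor_def)
qed

lemma fourier_zero:
  assumes "f \<in> borel_measurable borel"
  shows "fourier (\<lambda>x. complex_of_real (f x)) 0 = of_real (\<integral>x. f x \<partial>lborel)"
proof -
  have "fourier (\<lambda>x. complex_of_real (f x)) 0 = (\<integral>x. wave 0 x * of_real (f x) \<partial>lborel)"
    using assms by (intro fourier_wave) measurable
  then show ?thesis by (simp add: wave_def)
qed

text \<open>Preservation of total mass is read off from the transforms at 0.\<close>

lemma prob_density_avg:
  assumes f: "prob_density c f" shows "prob_density (1 / \<mu>) (avg f)"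
proof -
  have m: "avg f \<in> borel_measurable borel"
    using avg_continuous[OF f] by (rule borel_measurable_continuous_onI)
  obtain r where r: "0 < r" "\<And>N k. norm (conv_factor A V N k) \<le> 1"
    "\<And>N k. norm (conv_factor A V N k - 1) \<le> 2 * pi * r * norm ((adjoint A ^^ N) k)"
    by (rule conv_factor_bounds) (rule that, assumption+)
  \<comment> \<open>At k = 0 the estimate of the distance to 1 has right-hand side 0.\<close>
  have "conv_factor A V 0 0 = 1" using r(3)[of 0 0] by simp
  moreover have "adjoint A 0 = 0" using adjoint_linear[OF linear_A] linear_0 by blast
  ultimately have "fourier (\<lambda>x. complex_of_real (avg f x)) 0 = fourier (\<lambda>x. complex_of_real (f x)) 0"
    using fourier_avg[OF f, of 0] by simp
  then have "(\<integral>x. avg f x \<partial>lborel) = (\<integral>x. f x \<partial>lborel)"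
    using fourier_zero[OF m] fourier_zero[of f] f by (simp add: prob_density_def)
  then show ?thesis
    using avg_bounds[OF f] avg_support[of f] f m unfolding prob_density_def by auto
qed

end

section \<open>The invariant density\<close>

context compatible_similarity
begin

lemma adjoint_power_tendsto: "(\<lambda>n. norm ((adjoint A ^^ n) k)) \<longlonglongrightarrow> 0"
proof -
  obtain C \<rho> where C: "0 < C" "0 < \<rho>" "\<rho> < 1" "\<And>N k. norm ((adjoint A ^^ N) k) \<le> C * \<rho> ^ N * norm k"
    by (rule adjoint_contraction) (rule that, assumption+)
  have "(\<lambda>n. C * \<rho> ^ n * norm k) \<longlonglongrightarrow> C * 0 * norm k"
    using C by (intro tendsto_intros LIMSEQ_realpow_zero) auto
  then have lim: "(\<lambda>n. C * \<rho> ^ n * norm k) \<longlonglongrightarrow> 0" by simp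
  show ?thesis
    by (rule Lim_null_comparison[OF _ lim]) (use C(4) in simp)
qed

text \<open>\<open>has_prod\<close> asks for more than convergent partial products: after finitely
  many zero factors the limit must be nonzero. Summability of the distances of the factors to 1
  ensures this, and they decay geometrically.\<close>

lemma convergent_prod_conv_factor: "convergent_prod (\<lambda>N. conv_factor A V N k)"
proof -
  obtain C \<rho> where C: "0 < C" "0 < \<rho>" "\<rho> < 1" "\<And>N k. norm ((adjoint A ^^ N) k) \<le> C * \<rho> ^ N * norm k"
    by (rule adjoint_contraction) (rule that, assumption+)
  obtain r where r: "0 < r" "\<And>N k. norm (conv_factor A V N k) \<le> 1"
    "\<And>N k. norm (conv_factor A V N k - 1) \<le> 2 * pi * r * norm ((adjoint A ^^ N) k)"
    by (rule conv_factor_bounds) (rule that, assumption+)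
  have "summable (\<lambda>N. norm (conv_factor A V N k - 1))"
  proof (rule summable_comparison_test')
    show "summable (\<lambda>N. 2 * pi * r * C * norm k * \<rho> ^ N)"
      using C by (intro summable_mult summable_geometric) simp
    show "norm (norm (conv_factor A V N k - 1)) \<le> 2 * pi * r * C * norm k * \<rho> ^ N" for N
    proof -
      have "norm (conv_factor A V N k - 1) \<le> 2 * pi * r * norm ((adjoint A ^^ N) k)" by (rule r)
      also have "\<dots> \<le> 2 * pi * r * (C * \<rho> ^ N * norm k)"
        using r(1) by (intro mult_left_mono C) auto
      finally show ?thesis by (simp add: mult_ac)
    qed
  qed
  then show ?thesis
    by (intro abs_convergent_prod_imp_convergent_prod summable_imp_abs_convergent_prod)
qed

lemma conv_factor_shift: "conv_factor A V N (adjoint A k) = conv_factor A V (Suc N) k"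
  by (simp add: conv_factor_def funpow_swap1)

lemma prob_density_mono: "prob_density c f \<Longrightarrow> c \<le> c' \<Longrightarrow> prob_density c' f"
  unfolding prob_density_def by (meson order_trans)

lemma prob_density_avg_iterate:
  assumes "prob_density c f" "1 / \<mu> \<le> c"
  shows "prob_density c ((avg ^^ n) f)"
proof (induction n)
  case (Suc n)
  show ?case using prob_density_mono[OF prob_density_avg[OF Suc] assms(2)] by simp
qed (use assms(1) in simp)

text \<open>Each application of \<open>avg\<close> splits off the factor of index 0 and passes the
  argument through the adjoint, which raises the index of every other factor by one.\<close>

lemma fourier_avg_iterate:
  assumes f: "prob_density c f" "1 / \<mu> \<le> c"
  shows "fourier (\<lambda>x. complex_of_real ((avg ^^ n) f x)) k
     = (\<Prod>N<n. conv_factor A V N k) * fourier (\<lambda>x. complex_of_real (f x)) ((adjoint A ^^ n) k)"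
proof (induction n arbitrary: k)
  case (Suc n)
  have "fourier (\<lambda>x. complex_of_real ((avg ^^ Suc n) f x)) k
    = conv_factor A V 0 k * fourier (\<lambda>x. complex_of_real ((avg ^^ n) f x)) (adjoint A k)"
    using fourier_avg[OF prob_density_avg_iterate[OF f, of n], of k] by simp
  also have "\<dots> = conv_factor A V 0 k * (\<Prod>N<n. conv_factor A V (Suc N) k)
     * fourier (\<lambda>x. complex_of_real (f x)) ((adjoint A ^^ Suc n) k)"
    unfolding Suc conv_factor_shift by (simp add: funpow_swap1)
  also have "conv_factor A V 0 k * (\<Prod>N<n. conv_factor A V (Suc N) k) = (\<Prod>N<Suc n. conv_factor A V N k)"
    by (rule prod.lessThan_Suc_shift[symmetric])
  finally show ?case .
qed simp

text \<open>r depends only on W, so the estimate is uniform over all densities and all bounds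
  c.\<close>

lemma prob_density_fourier_near_one:
  obtains r where "0 < r" "\<And>c f k. prob_density c f \<Longrightarrow>
     norm (fourier (\<lambda>x. complex_of_real (f x)) k - 1) \<le> 2 * pi * r * norm k"
proof -
  obtain r where r: "0 < r" "W \<subseteq> cball 0 r" by (rule compact_subset_cball[OF compact_W])
  have "norm (fourier (\<lambda>x. complex_of_real (f x)) k - 1) \<le> 2 * pi * r * norm k" if f: "prob_density c f" for c f k
    by (rule fourier_probability_bounds(2)[OF _ prob_density_integrable[OF f]])
      (use f r(2) in \<open>auto simp: prob_density_def\<close>)
  then show thesis using that r(1) by blast
qed

text \<open>Iteration writes the transform at k as the n-th partial product times the transform at
  the n-th adjoint image of k. Partial products have norm at most 1 and the last factor tends to 1
  at a geometric rate, uniformly for bounded k.\<close>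

lemma fixed_point_has_infinite_convolution:
  assumes f: "prob_density c f" and fixed: "avg f = f"
  shows "has_infinite_convolution A V (\<lambda>x. complex_of_real (f x))"
proof -
  let ?F = "fourier (\<lambda>x. complex_of_real (f x))"
  \<comment> \<open>Enlarged to dominate 1/\<mu>, the bound of all values of \<open>avg\<close>, so
    that one constant survives iteration.\<close>
  define c' where "c' = max c (1 / \<mu>)"
  have f': "prob_density c' f" "1 / \<mu> \<le> c'"
    using prob_density_mono[OF f] by (auto simp: c'_def)
  have "(avg ^^ n) f = f" for n by (induction n) (auto simp: fixed)
  then have F: "?F k = (\<Prod>N<n. conv_factor A V N k) * ?F ((adjoint A ^^ n) k)" for n k
    using fourier_avg_iterate[OF f', of n k] by simp
  obtain r where r: "0 < r" "\<And>c f k. prob_density c f \<Longrightarrow>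
     norm (fourier (\<lambda>x. complex_of_real (f x)) k - 1) \<le> 2 * pi * r * norm k"
    by (rule prob_density_fourier_near_one) (rule that, assumption+)
  obtain r' where r': "0 < r'" "\<And>N k. norm (conv_factor A V N k) \<le> 1"
    "\<And>N k. norm (conv_factor A V N k - 1) \<le> 2 * pi * r' * norm ((adjoint A ^^ N) k)"
    by (rule conv_factor_bounds) (rule that, assumption+)
  obtain C \<rho> where C: "0 < C" "0 < \<rho>" "\<rho> < 1" "\<And>N k. norm ((adjoint A ^^ N) k) \<le> C * \<rho> ^ N * norm k"
    by (rule adjoint_contraction) (rule that, assumption+)
  have bound: "norm ((\<Prod>N<n. conv_factor A V N k) - ?F k) \<le> 2 * pi * r * C * norm k * \<rho> ^ n" for n k
  proof -
    have "norm (\<Prod>N<n. conv_factor A V N k) \<le> 1"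
      unfolding prod_norm[symmetric] using r'(2) by (intro prod_le_1) simp
    moreover have "(\<Prod>N<n. conv_factor A V N k) - ?F k
      = - ((\<Prod>N<n. conv_factor A V N k) * (?F ((adjoint A ^^ n) k) - 1))"
      by (subst F[of k n]) (simp add: algebra_simps)
    ultimately have "norm ((\<Prod>N<n. conv_factor A V N k) - ?F k) \<le> 1 * norm (?F ((adjoint A ^^ n) k) - 1)"
      by (simp only: norm_minus_cancel norm_mult) (intro mult_right_mono, auto)
    also have "\<dots> \<le> 2 * pi * r * norm ((adjoint A ^^ n) k)" using r(2)[OF f] by simp
    also have "\<dots> \<le> 2 * pi * r * (C * \<rho> ^ n * norm k)" using r(1) by (intro mult_left_mono C) auto
    finally show ?thesis by (simp add: mult_ac)
  qed
  have unif: "uniform_limit K (\<lambda>n k. \<Prod>N<n. conv_factor A V N k) ?F sequentially" if "compact K" for K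
  proof -
    obtain b where b: "0 < b" "K \<subseteq> cball 0 b" by (rule compact_subset_cball[OF \<open>compact K\<close>])
    show ?thesis
    proof (rule uniform_limitI)
      fix e :: real assume e: "0 < e"
      have "(\<lambda>n. 2 * pi * r * C * b * \<rho> ^ n) \<longlonglongrightarrow> 2 * pi * r * C * b * 0"
        using C by (intro tendsto_intros LIMSEQ_realpow_zero) auto
      then have "\<forall>\<^sub>F n in sequentially. 2 * pi * r * C * b * \<rho> ^ n < e"
        using e by (intro order_tendstoD(2)) auto
      then show "\<forall>\<^sub>F n in sequentially. \<forall>k\<in>K. dist (\<Prod>N<n. conv_factor A V N k) (?F k) < e"
      proof eventually_elim
        case (elim n)
        show ?case
        proof
          fix k assume "k \<in> K"
          then have "norm k \<le> b" using b(2) by auto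
          then have "2 * pi * r * C * norm k * \<rho> ^ n \<le> 2 * pi * r * C * b * \<rho> ^ n"
            using r(1) C by (intro mult_right_mono mult_left_mono) auto
          then show "dist (\<Prod>N<n. conv_factor A V N k) (?F k) < e"
            unfolding dist_norm using bound[of k n] elim by linarith
        qed
      qed
    qed
  qed
  have "(\<lambda>N. conv_factor A V N k) has_prod ?F k" for k
  proof (rule convergent_prod_tendsto_imp_has_prod[OF convergent_prod_conv_factor])
    have "(\<lambda>n. \<Prod>N<n. conv_factor A V N k) \<longlonglongrightarrow> ?F k"
      using tendsto_uniform_limitI[OF unif[of "{k}"], of k] by simp
    then show "(\<lambda>n. \<Prod>N\<le>n. conv_factor A V N k) \<longlonglongrightarrow> ?F k"
      by (simp add: LIMSEQ_lessThan_iff_atMost)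
  qed
  moreover have "integrable lebesgue (\<lambda>x. complex_of_real (f x))"
    using prob_density_integrable[OF f] by (intro integrable_completion[THEN iffD2] integrable_of_real) auto
  ultimately show ?thesis unfolding has_infinite_convolution_def using unif by blast
qed

lemma W_borel [measurable]: "W \<in> sets borel"
  using compact_W by (rule borel_compact)

section \<open>Existence of a fixed point by compactness\<close>

lemma fixed_point_exists:
  obtains c f where "prob_density c f" "continuous_on UNIV f" "avg f = f"
proof -
  let ?f0 = "\<lambda>x. indicator W x / measure lborel W"
  define c where "c = max (1 / measure lborel W) (1 / \<mu>)"
  have c: "1 / \<mu> \<le> c" "1 / measure lborel W \<le> c" by (auto simp: c_def)
  have f0: "prob_density c ?f0"
    unfolding prob_density_def
  proof (intro conjI allI impI)
    show "?f0 \<in> borel_measurable borel" by measurable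
    show "0 \<le> ?f0 x" for x by simp
    show "?f0 x \<le> c" for x using c(2) measure_W_pos by (auto simp: indicator_def intro: order_trans[OF _ c(2)])
    show "(\<integral>x. ?f0 x \<partial>lborel) = 1" using measure_W_pos by simp
  qed (auto simp: indicator_def)
  define h where "h n = (avg ^^ n) ?f0" for n
  have h: "prob_density c (h n)" for n unfolding h_def by (rule prob_density_avg_iterate[OF f0 c(1)])
  have hSuc: "h (Suc n) = avg (h n)" for n by (simp add: h_def)
  \<comment> \<open>The starting density is a normalised indicator and not continuous;
    equicontinuity sets in with the first application of \<open>avg\<close>, hence
    \<open>Suc\<close>.\<close>
  obtain g k where g: "continuous_on W g" "strict_mono (k :: nat \<Rightarrow> nat)"
    "\<And>e. 0 < e \<Longrightarrow> \<exists>N. \<forall>n x. n \<ge> N \<and> x \<in> W \<longrightarrow> norm (h (Suc (k n)) x - g x) < e"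
  proof (rule Arzela_Ascoli[OF compact_W, where \<F>="\<lambda>n. h (Suc n)" and M=c])
    show "norm (h (Suc n) x) \<le> c" for n x using h[of "Suc n"] by (simp add: prob_density_def)
    show "\<exists>d>0. \<forall>n y. y \<in> W \<and> norm (x - y) < d \<longrightarrow> norm (h (Suc n) x - h (Suc n) y) < e"
      if e: "0 < e" for x e
    proof -
      obtain d where "0 < d" "\<And>f y y'. prob_density c f \<Longrightarrow> norm (y - y') < d \<Longrightarrow> \<bar>avg f y - avg f y'\<bar> < e"
        by (rule avg_equicontinuous[OF e]) (rule that, assumption+)
      then show ?thesis unfolding hSuc using h by auto
    qed
  qed (rule that, assumption+)
  define f where "f x = (if x \<in> W then g x else 0)" for x
  have lim: "(\<lambda>n. h (Suc (k n)) x) \<longlonglongrightarrow> f x" for x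
  proof (cases "x \<in> W")
    case True
    show ?thesis
    proof (rule LIMSEQ_I)
      fix e :: real assume "0 < e"
      then obtain N where "\<forall>n x. n \<ge> N \<and> x \<in> W \<longrightarrow> norm (h (Suc (k n)) x - g x) < e" using g(3) by blast
      then show "\<exists>N. \<forall>n\<ge>N. norm (h (Suc (k n)) x - f x) < e" using True by (auto simp: f_def)
    qed
  next
    case False
    then show ?thesis using h by (simp add: f_def prob_density_def)
  qed
  \<comment> \<open>Continuity of g on W says nothing across the boundary of W. The modulus of the
    iterates is valid on the whole space and passes to the pointwise limit as \<le> e/2, hence <
    e.\<close>
  have fc: "continuous_on UNIV f"
    unfolding continuous_on_iff
  proof (intro ballI allI impI)
    fix x and e :: real assume e: "0 < e"
    then have "0 < e / 2" by simp
    then obtain d where d: "0 < d" "\<And>f y y'. prob_density c f \<Longrightarrow> norm (y - y') < d \<Longrightarrow> \<bar>avg f y - avg f y'\<bar> < e / 2"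
      by (rule avg_equicontinuous) (rule that, assumption+)
    have "dist (f x') (f x) < e" if "dist x' x < d" for x'
    proof -
      have "(\<lambda>n. \<bar>h (Suc (k n)) x' - h (Suc (k n)) x\<bar>) \<longlonglongrightarrow> \<bar>f x' - f x\<bar>"
        by (intro tendsto_intros lim)
      moreover have "\<bar>h (Suc (k n)) x' - h (Suc (k n)) x\<bar> \<le> e / 2" for n
        unfolding hSuc using d(2)[OF h] that by (simp add: dist_norm less_imp_le)
      ultimately have "\<bar>f x' - f x\<bar> \<le> e / 2" by (intro LIMSEQ_le_const2[where X="\<lambda>n. \<bar>h (Suc (k n)) x' - h (Suc (k n)) x\<bar>"]) auto
      then show ?thesis using e by (simp add: dist_real_def)
    qed
    then show "\<exists>d>0. \<forall>x'\<in>UNIV. dist x' x < d \<longrightarrow> dist (f x') (f x) < e" using d(1) by blast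
  qed
  have fm: "f \<in> borel_measurable borel" using fc by (rule borel_measurable_continuous_onI)
  have hm: "h n \<in> borel_measurable borel" for n using h by (simp add: prob_density_def)
  have dom: "(\<lambda>n. \<integral>x. wave q x * complex_of_real (h (Suc (k n)) x) \<partial>lborel) \<longlonglongrightarrow> (\<integral>x. wave q x * complex_of_real (f x) \<partial>lborel)" for q
  proof (rule integral_dominated_convergence[where w="\<lambda>x. c * indicator W x"])
    show "integrable lborel (\<lambda>x. c * indicator W x :: real)"
      using compact_W by (intro integrable_mult_right integrable_real_indicator emeasure_bounded_finite)
        (auto simp: compact_imp_bounded)
    show "AE x in lborel. (\<lambda>n. wave q x * complex_of_real (h (Suc (k n)) x)) \<longlonglongrightarrow> wave q x * complex_of_real (f x)"
      by (intro AE_I2 tendsto_intros lim)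
    show "AE x in lborel. norm (wave q x * complex_of_real (h (Suc (k n)) x)) \<le> c * indicator W x" for n
    proof (rule AE_I2)
      fix x
      show "norm (wave q x * complex_of_real (h (Suc (k n)) x)) \<le> c * indicator W x"
        using h[of "Suc (k n)"] by (cases "x \<in> W") (auto simp: norm_mult prob_density_def)
    qed
  qed (use fm hm in measurable)
  have fourier_h: "fourier (\<lambda>x. complex_of_real (h n x)) q = (\<integral>x. wave q x * complex_of_real (h n x) \<partial>lborel)" for n q
    using hm by (intro fourier_wave) measurable
  have fourier_f: "fourier (\<lambda>x. complex_of_real (f x)) q = (\<integral>x. wave q x * complex_of_real (f x) \<partial>lborel)" for q
    using fm by (intro fourier_wave) measurable
  have "(\<integral>x. f x \<partial>lborel) = 1"
  proof -
    have "fourier (\<lambda>x. complex_of_real (h n x)) 0 = 1" for n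
      using fourier_zero[OF hm] h by (simp add: prob_density_def)
    then have "(\<lambda>n. 1) \<longlonglongrightarrow> fourier (\<lambda>x. complex_of_real (f x)) 0"
      using dom[of 0] unfolding fourier_f fourier_h[symmetric] by simp
    then have "fourier (\<lambda>x. complex_of_real (f x)) 0 = 1" by (simp add: LIMSEQ_const_iff)
    then show ?thesis using fourier_zero[OF fm] by (simp only: of_real_eq_1_iff)
  qed
  moreover have "0 \<le> f x \<and> f x \<le> c" for x
  proof
    have hb: "0 \<le> h n x" "h n x \<le> c" for n using h by (auto simp: prob_density_def)
    show "0 \<le> f x" by (rule LIMSEQ_le_const[OF lim]) (use hb in auto)
    show "f x \<le> c" by (rule LIMSEQ_le_const2[OF lim]) (use hb in auto)
  qed
  ultimately have f: "prob_density c f"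
    using fm by (auto simp: prob_density_def f_def)
  obtain r where r: "0 < r" "\<And>c f k. prob_density c f \<Longrightarrow>
     norm (fourier (\<lambda>x. complex_of_real (f x)) k - 1) \<le> 2 * pi * r * norm k"
    by (rule prob_density_fourier_near_one) (rule that, assumption+)
  \<comment> \<open>The transform of the n-th iterate is the n-th partial product times the
    transform of the starting density at a point tending to 0, so the transforms of the whole
    sequence converge to the product; dominated convergence along the subsequence identifies this
    limit with the transform of f.\<close>
  have P: "(\<lambda>n. \<Prod>N<n. conv_factor A V N q) \<longlonglongrightarrow> fourier (\<lambda>x. complex_of_real (f x)) q" for q
  proof -
    have "(\<lambda>n. \<Prod>N\<le>n. conv_factor A V N q) \<longlonglongrightarrow> prodinf (\<lambda>N. conv_factor A V N q)"
      by (rule convergent_prod_LIMSEQ[OF convergent_prod_conv_factor])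
    then have p: "(\<lambda>n. \<Prod>N<n. conv_factor A V N q) \<longlonglongrightarrow> prodinf (\<lambda>N. conv_factor A V N q)"
      by (simp add: LIMSEQ_lessThan_iff_atMost)
    have "(\<lambda>n. fourier (\<lambda>x. complex_of_real (?f0 x)) ((adjoint A ^^ n) q) - 1) \<longlonglongrightarrow> 0"
    proof (rule Lim_null_comparison)
      show "(\<lambda>n. 2 * pi * r * norm ((adjoint A ^^ n) q)) \<longlonglongrightarrow> 0"
        using tendsto_mult[OF tendsto_const adjoint_power_tendsto[of q], of "2 * pi * r"] by simp
    qed (use r(2)[OF f0] in simp)
    then have "(\<lambda>n. fourier (\<lambda>x. complex_of_real (?f0 x)) ((adjoint A ^^ n) q)) \<longlonglongrightarrow> 1"
      by (simp only: LIM_zero_iff)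
    from tendsto_mult[OF p this]
    have "(\<lambda>n. fourier (\<lambda>x. complex_of_real (h n x)) q) \<longlonglongrightarrow> prodinf (\<lambda>N. conv_factor A V N q)"
      unfolding h_def fourier_avg_iterate[OF f0 c(1)] by (simp only: mult_1_right)
    moreover have "strict_mono (\<lambda>n. Suc (k n))" using g(2) by (simp add: strict_mono_def)
    ultimately have "(\<lambda>n. fourier (\<lambda>x. complex_of_real (h (Suc (k n)) x)) q) \<longlonglongrightarrow> prodinf (\<lambda>N. conv_factor A V N q)"
      using LIMSEQ_subseq_LIMSEQ[where f="\<lambda>n. Suc (k n)"] by (force simp: o_def)
    then have "prodinf (\<lambda>N. conv_factor A V N q) = fourier (\<lambda>x. complex_of_real (f x)) q"
      using dom[of q] unfolding fourier_f fourier_h[symmetric] by (rule LIMSEQ_unique)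
    then show ?thesis using p by simp
  qed
  obtain R where R: "0 < R" "W \<subseteq> cball 0 R" by (rule compact_subset_cball[OF compact_W])
  \<comment> \<open>The product at \<open>adjoint A q\<close> together with the factor of index 0 is
    the product at q. So \<open>avg f\<close> and f have the same transform, and both are continuous
    with support in W.\<close>
  have "(\<lambda>x. complex_of_real (avg f x)) = (\<lambda>x. complex_of_real (f x))"
  proof (rule fourier_injective[where R=R])
    show "fourier (\<lambda>x. complex_of_real (avg f x)) q = fourier (\<lambda>x. complex_of_real (f x)) q" for q
    proof -
      have "(\<lambda>n. conv_factor A V 0 q * (\<Prod>N<n. conv_factor A V N (adjoint A q))) \<longlonglongrightarrow>
         conv_factor A V 0 q * fourier (\<lambda>x. complex_of_real (f x)) (adjoint A q)"
        by (intro tendsto_intros P)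
      also have "(\<lambda>n. conv_factor A V 0 q * (\<Prod>N<n. conv_factor A V N (adjoint A q)))
         = (\<lambda>n. \<Prod>N<Suc n. conv_factor A V N q)"
        unfolding conv_factor_shift by (simp only: prod.lessThan_Suc_shift)
      finally have "(\<lambda>n. \<Prod>N<Suc n. conv_factor A V N q) \<longlonglongrightarrow> fourier (\<lambda>x. complex_of_real (avg f x)) q"
        unfolding fourier_avg[OF f] .
      then have "(\<lambda>n. \<Prod>N<n. conv_factor A V N q) \<longlonglongrightarrow> fourier (\<lambda>x. complex_of_real (avg f x)) q"
        by (rule LIMSEQ_imp_Suc)
      then show ?thesis using P[of q] by (rule LIMSEQ_unique)
    qed
    show "continuous_on UNIV (\<lambda>x. complex_of_real (avg f x))" "continuous_on UNIV (\<lambda>x. complex_of_real (f x))"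
      using avg_continuous[OF f] fc by (auto intro: continuous_on_of_real)
    have fW: "f x = 0" if "x \<notin> W" for x using that by (simp add: f_def)
    show "complex_of_real (avg f x) = 0" "complex_of_real (f x) = 0" if "x \<notin> cball 0 R" for x
    proof -
      have "x \<notin> W" using that R(2) by blast
      then show "complex_of_real (avg f x) = 0" "complex_of_real (f x) = 0"
        using avg_support[of f x] fW by auto
    qed
  qed
  then have "avg f = f" by (simp add: fun_eq_iff)
  then show thesis using that f fc by blast
qed

section \<open>Translation between invariant densities and fixed points\<close>

lemma window_functions_support:
  assumes "f \<in> window_functions W" "x \<notin> W" shows "f x = 0"
  using assms closure_subset[of "{y. f y \<noteq> 0}"] by (auto simp: window_functions_def)

lemma window_functionsI:
  assumes "continuous_on UNIV f" "\<And>x. x \<notin> W \<Longrightarrow> f x = 0" shows "f \<in> window_functions W"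
  unfolding window_functions_def
  using assms closure_minimal[of "{y. f y \<noteq> 0}" W] compact_imp_closed[OF compact_W] by blast

lemma infinite_convolution_unique:
  assumes f: "f \<in> window_functions W" "has_infinite_convolution A V f"
    and g: "g \<in> window_functions W" "has_infinite_convolution A V g"
  shows "f = g"
proof -
  obtain R where R: "0 < R" "W \<subseteq> cball 0 R" by (rule compact_subset_cball[OF compact_W])
  show ?thesis
  proof (rule fourier_injective[where R=R])
    show "fourier f k = fourier g k" for k
      using f(2) g(2) has_prod_unique2 unfolding has_infinite_convolution_def by blast
    show "f x = 0" "g x = 0" if "x \<notin> cball 0 R" for x
    proof -
      have "x \<notin> W" using that R(2) by blast
      then show "f x = 0" "g x = 0" using window_functions_support f(1) g(1) by auto
    qed
  qed (use f(1) g(1) in \<open>auto simp: window_functions_def\<close>)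
qed

text \<open>Equidistribution is applied to g and to the constant 1, which counts the points;
  \<open>count_scale\<close> cancels in the quotient.\<close>

lemma window_mean:
  assumes S: "compact S" "frontier S \<in> null_sets lborel" "0 < measure lborel S" and g: "continuous_on UNIV g"
  shows "((\<lambda>s. 1 / real (card (truncate (model_points M S) s)) * (\<Sum>x\<in>truncate (model_points M S) s. g (star M x)))
     \<longlongrightarrow> (\<integral>x. indicator S x * g x \<partial>lborel) / measure lborel S) at_top"
proof -
  let ?T = "truncate (model_points M S)"
  have l1: "((\<lambda>s. (\<Sum>x\<in>?T s. g (star M x)) / count_scale s) \<longlongrightarrow> (\<integral>x. indicator S x * g x \<partial>lborel)) at_top"
    by (rule window_equidistribution[OF S(1,2) g])
  have "((\<lambda>s. (\<Sum>x\<in>?T s. 1) / count_scale s) \<longlongrightarrow> (\<integral>x. indicator S x * 1 \<partial>lborel)) at_top"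
    by (rule window_equidistribution[OF S(1,2)]) simp
  then have l2: "((\<lambda>s. real (card (?T s)) / count_scale s) \<longlongrightarrow> measure lborel S) at_top"
    using S(1) by (simp add: borel_compact)
  have "((\<lambda>s. ((\<Sum>x\<in>?T s. g (star M x)) / count_scale s) / (real (card (?T s)) / count_scale s)) \<longlongrightarrow>
      (\<integral>x. indicator S x * g x \<partial>lborel) / measure lborel S) at_top"
    using S(3) by (intro tendsto_divide l1 l2) simp
  then show ?thesis
  proof (rule Lim_transform_eventually)
    show "\<forall>\<^sub>F s in at_top. (\<Sum>x\<in>?T s. g (star M x)) / count_scale s / (real (card (?T s)) / count_scale s)
       = 1 / real (card (?T s)) * (\<Sum>x\<in>?T s. g (star M x))"
      using count_scale_pos by eventually_elim simp
  qed
qed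

text \<open>The real counterpart of \<open>pullback\<close>. The volume factor makes the mean of
  \<open>lift f\<close> over the model set equal to the integral of f, so that condition (3) becomes
  total mass 1.\<close>

definition lift :: "(real^'n \<Rightarrow> real) \<Rightarrow> real^'m \<Rightarrow> real" where
  "lift f x = (if x \<in> model_points M W then measure lborel W * f (star M x) else 0)"

lemma lift_phys:
  assumes "\<And>x. x \<notin> W \<Longrightarrow> f x = 0" "x \<in> L"
  shows "lift f x = measure lborel W * f (star M x)"
  using assms by (auto simp: lift_def model_points_def)

lemma lift_pullback: "(\<lambda>x. complex_of_real (lift f x)) = pullback M W (\<lambda>x. complex_of_real (f x))"
  by (simp add: lift_def pullback_def fun_eq_iff)

lemma lift_mean:
  assumes f: "continuous_on UNIV f" "\<And>x. x \<notin> W \<Longrightarrow> f x = 0"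
  shows "((\<lambda>s. 1 / real (card (truncate (model_points M W) s)) * (\<Sum>x\<in>truncate (model_points M W) s. lift f x))
     \<longlongrightarrow> (\<integral>x. f x \<partial>lborel)) at_top"
proof -
  have "(\<Sum>x\<in>truncate (model_points M W) s. lift f x) = (\<Sum>x\<in>truncate (model_points M W) s. measure lborel W * f (star M x))" for s
    by (rule sum.cong) (auto simp: truncate_def lift_def)
  moreover have "(\<integral>x. indicator W x * (measure lborel W * f x) \<partial>lborel) / measure lborel W = (\<integral>x. f x \<partial>lborel)"
  proof -
    have "(\<lambda>x. indicator W x * (measure lborel W * f x)) = (\<lambda>x. measure lborel W * f x)"
      using f(2) by (auto simp: indicator_def fun_eq_iff)
    then show ?thesis using measure_W_pos by simp
  qed
  moreover have "continuous_on UNIV (\<lambda>x. measure lborel W * f x)" using f(1) by (intro continuous_intros)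
  ultimately show ?thesis
    using window_mean[OF compact_W frontier_W measure_W_pos, of "\<lambda>x. measure lborel W * f x"] by simp
qed

text \<open>For x and v in L, the inverse affine map sends x to a point of L with star
  \<open>B (star M x - star M v)\<close>, B being the inverse of A. The summand is therefore a
  continuous function of \<open>star M v\<close>, and \<open>window_mean\<close> over V gives the
  limit.\<close>

lemma lift_average:
  assumes f: "continuous_on UNIV f" "\<And>x. x \<notin> W \<Longrightarrow> f x = 0" and x: "x \<in> L"
  shows "((\<lambda>s. jac / real (card (truncate (model_points M V) s))
      * (\<Sum>v\<in>truncate (model_points M V) s. lift f (inv (affine_map Q v) x)))
     \<longlongrightarrow> measure lborel W * avg f (star M x)) at_top"
proof -
  obtain q where q: "q \<noteq> 0" "linear Q" "\<And>x. norm (Q x) = \<bar>q\<bar> * norm x" "\<bar>det (matrix Q)\<bar> = \<bar>q\<bar> ^ CARD('m)" "bij Q"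
    by (rule similarity_data) (rule that, assumption+)
  obtain B where B: "linear B" "\<And>x. A (B x) = x" "\<And>x. B (A x) = x"
    using linear_injective_isomorphism[OF linear_A inj_A] by blast
  have contB: "continuous_on S B" for S using B(1) by (simp add: linear_continuous_on linear_conv_bounded_linear)
  have mf [measurable]: "f \<in> borel_measurable borel" using f(1) by (rule borel_measurable_continuous_onI)
  have mB [measurable]: "B \<in> borel_measurable borel" using contB by (rule borel_measurable_continuous_onI)
  let ?y = "star M x"
  let ?g = "\<lambda>u. measure lborel W * f (B (?y - u))"
  have gc: "continuous_on UNIV ?g"
    by (intro continuous_intros continuous_on_compose2[OF f(1)] continuous_on_compose2[OF contB[of UNIV]]) auto
  have summand: "lift f (inv (affine_map Q v) x) = ?g (star M v)" if "v \<in> L" for v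
  proof -
    have "x - v \<in> Q ` L" using diff_phys[OF x that] Q_image by simp
    then obtain z where z: "z \<in> L" "x - v = Q z" by blast
    have "inj (affine_map Q v)" using q(5) by (auto simp: affine_map_def inj_def bij_def)
    moreover have "affine_map Q v z = x" using z(2) by (simp add: affine_map_def algebra_simps)
    ultimately have "inv (affine_map Q v) x = z" by (metis inv_f_f)
    moreover have "A (star M z) = ?y - star M v" using star_Q[OF z(1)] z(2) star_diff[OF x that] by simp
    then have "star M z = B (?y - star M v)" using B(3) by metis
    ultimately show ?thesis using lift_phys[OF f(2) z(1)] by simp
  qed
  have sum: "(\<Sum>v\<in>truncate (model_points M V) s. lift f (inv (affine_map Q v) x))
     = (\<Sum>v\<in>truncate (model_points M V) s. ?g (star M v))" for s
    by (rule sum.cong[OF refl]) (rule summand, simp add: truncate_def model_points_def)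
  have "((\<lambda>s. jac * (1 / real (card (truncate (model_points M V) s)) * (\<Sum>v\<in>truncate (model_points M V) s. ?g (star M v))))
     \<longlongrightarrow> jac * ((\<integral>u. indicator V u * ?g u \<partial>lborel) / \<mu>)) at_top"
    by (intro tendsto_mult tendsto_const window_mean[OF compact_V frontier_V measure_V_pos gc])
  moreover have "jac * ((\<integral>u. indicator V u * ?g u \<partial>lborel) / \<mu>) = measure lborel W * avg f ?y"
  proof -
    let ?G = "\<lambda>u. indicator V u * f (B (?y - u)) :: real" and ?F = "\<lambda>z. indicator V (?y - z) * f (B z) :: real"
    \<comment> \<open>Substituting z = A w produces the factor \<open>jac\<close>, the very factor
      in front of the average; the reflection u = \<open>?y - z\<close> then yields the integral
      found as the limit.\<close>
    have "(\<integral>w. indicator V (?y - A w) * f w \<partial>lborel) = (\<integral>w. ?F (A w) \<partial>lborel)" using B(3) by simp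
    also have "\<dots> = jac * (\<integral>z. ?F z \<partial>lborel)" by (rule integral_compose_A) measurable
    also have "(\<integral>z. ?F z \<partial>lborel) = (\<integral>u. ?G u \<partial>lborel)"
      using lborel_integral_reflect[of ?G ?y] by simp
    finally have "measure lborel W * avg f ?y = jac * ((measure lborel W * (\<integral>u. ?G u \<partial>lborel)) / \<mu>)"
      by (simp add: avg_def)
    also have "measure lborel W * (\<integral>u. ?G u \<partial>lborel) = (\<integral>u. indicator V u * ?g u \<partial>lborel)"
      by (subst integral_mult_right_zero[symmetric]) (simp add: mult_ac)
    finally show ?thesis by simp
  qed
  ultimately show ?thesis unfolding sum by simp
qed

lemma continuous_eq_on_star:
  fixes f g :: "real^'n \<Rightarrow> 'c::t2_space"
  assumes "continuous_on UNIV f" "continuous_on UNIV g" "\<And>x. x \<in> L \<Longrightarrow> f (star M x) = g (star M x)"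
  shows "f = g"
proof
  fix y
  have "closure (star M ` L) \<subseteq> {y. f y = g y}"
    using assms by (intro closure_minimal closed_Collect_eq) auto
  moreover have "\<exists>x\<in>L. dist (star M x) y < e" if "0 < e" for e
    using star_dense[OF that, of y] by blast
  then have "y \<in> closure (star M ` L)" by (auto simp: closure_approachable)
  ultimately show "f y = g y" by blast
qed

lemma lift_invariant_density:
  assumes f: "prob_density c f" "continuous_on UNIV f" "avg f = f"
  shows "invariant_density M W Q A (lift f)"
proof -
  have W0: "f x = 0" if "x \<notin> W" for x using f(1) that by (simp add: prob_density_def)
  have nn: "0 \<le> f x" for x using f(1) by (simp add: prob_density_def)
  have "has_average M (model_points M V) Q (lift f) (lift f)"
    unfolding has_average_def
  proof
    fix x assume x: "x \<in> L"
    show "((\<lambda>s. jac / real (card (truncate (model_points M V) s))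
      * (\<Sum>v\<in>truncate (model_points M V) s. lift f (inv (affine_map Q v) x))) \<longlongrightarrow> lift f x) at_top"
      using lift_average[OF f(2) W0 x] lift_phys[OF W0 x] f(3) by simp
  qed
  moreover have "((\<lambda>s. 1 / real (card (truncate (model_points M W) s)) * (\<Sum>x\<in>truncate (model_points M W) s. lift f x)) \<longlongrightarrow> 1) at_top"
    using lift_mean[OF f(2) W0] f(1) by (simp add: prob_density_def)
  ultimately show ?thesis
    unfolding invariant_density_def using nn by (auto simp: lift_def)
qed

text \<open>The density determines its window function only at the stars of L. These are dense, so
  reality aside, sign and the equation \<open>avg f = f\<close> carry over to all of internal space
  by continuity.\<close>

lemma invariant_density_fixed_point:
  assumes p: "invariant_density M W Q A p" "(\<lambda>x. complex_of_real (p x)) \<in> model_functions M W"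
  obtains c f where "prob_density c f" "continuous_on UNIV f" "avg f = f" "p = lift f"
proof -
  obtain g where g: "g \<in> window_functions W" "(\<lambda>x. complex_of_real (p x)) = pullback M W g"
    using p(2) by (auto simp: model_functions_def)
  have gc: "continuous_on UNIV g" using g(1) by (simp add: window_functions_def)
  have gW: "g x = 0" if "x \<notin> W" for x by (rule window_functions_support[OF g(1) that])
  have gp: "of_real (p x) = of_real (measure lborel W) * g (star M x)" if "x \<in> L" for x
  proof -
    have "complex_of_real (p x) = pullback M W g x" using g(2) by (rule fun_cong)
    then show ?thesis using that gW by (auto simp: pullback_def model_points_def)
  qed
  have p_nn: "0 \<le> p x" for x using p(1) by (cases "x \<in> model_points M W") (auto simp: invariant_density_def)
  have g_star: "g (star M x) = of_real (p x / measure lborel W)" if "x \<in> L" for x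
    using gp[OF that] measure_W_pos by (simp add: field_simps)
  define f where "f y = Re (g y)" for y
  have fc: "continuous_on UNIV f" unfolding f_def using gc by (intro continuous_intros)
  have fW: "f x = 0" if "x \<notin> W" for x using gW[OF that] by (simp add: f_def)
  \<comment> \<open>Non-negativity in the form of an equation between continuous functions, which
    can be checked on the dense set of stars.\<close>
  have absf: "(\<lambda>y. \<bar>f y\<bar>) = f"
    by (rule continuous_eq_on_star) (use fc g_star p_nn measure_W_pos in \<open>auto simp: f_def intro!: continuous_intros\<close>)
  have nn: "0 \<le> f y" for y using fun_cong[OF absf, of y] by (metis abs_ge_zero)
  have plift: "p = lift f"
  proof
    fix x
    show "p x = lift f x"
    proof (cases "x \<in> model_points M W")
      case True
      then have "x \<in> L" by (simp add: model_points_def)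
      then show ?thesis using g_star[of x] True measure_W_pos by (simp add: lift_def f_def)
    next
      case False
      then show ?thesis using p(1) by (simp add: lift_def invariant_density_def)
    qed
  qed
  \<comment> \<open>The mean of \<open>lift f\<close> converges to the integral of f and, by
    condition (3), to 1.\<close>
  have int: "(\<integral>x. f x \<partial>lborel) = 1"
  proof (rule tendsto_unique[OF _ lift_mean[OF fc fW]])
    show "((\<lambda>s. 1 / real (card (truncate (model_points M W) s)) * (\<Sum>x\<in>truncate (model_points M W) s. lift f x)) \<longlongrightarrow> 1) at_top"
      using p(1) unfolding invariant_density_def plift by blast
  qed simp_all
  obtain R where R: "0 < R" "W \<subseteq> cball 0 R" by (rule compact_subset_cball[OF compact_W])
  obtain b where b: "0 < b" "\<And>x. \<bar>f x\<bar> \<le> b"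
  proof (rule bounded_continuous_bounded_support[OF fc, of R])
    show "f x = 0" if "x \<notin> cball 0 R" for x
    proof (rule fW)
      show "x \<notin> W" using that R(2) by blast
    qed
  qed (rule that, assumption+)
  have fb: "f x \<le> b" for x using b(2)[of x] by (rule order_trans[OF abs_ge_self])
  have f: "prob_density b f"
    using borel_measurable_continuous_onI[OF fc] nn fb fW int by (simp add: prob_density_def)
  \<comment> \<open>The average at x converges to \<open>avg f (star M x)\<close> times the volume
    of W and, by invariance, to the density at x.\<close>
  have "avg f = f"
  proof (rule continuous_eq_on_star[OF avg_continuous[OF f] fc])
    fix x assume x: "x \<in> L"
    have "((\<lambda>s. jac / real (card (truncate (model_points M V) s))
      * (\<Sum>v\<in>truncate (model_points M V) s. lift f (inv (affine_map Q v) x))) \<longlongrightarrow> lift f x) at_top"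
      using p(1) x unfolding invariant_density_def has_average_def plift by blast
    then have "measure lborel W * avg f (star M x) = lift f x"
      using lift_average[OF fc fW x] by (intro tendsto_unique[OF trivial_limit_at_top_linorder])
    then show "avg f (star M x) = f (star M x)"
      using lift_phys[OF fW x] measure_W_pos by simp
  qed
  then show thesis using that f fc plift by blast
qed

end

theorem proposition2:
  fixes M :: "((real^'m) \<times> (real^'n)) set"
    and \<Omega> :: "(real^'n) set"
    and Q :: "real^'m \<Rightarrow> real^'m"
    and A :: "real^'n \<Rightarrow> real^'n"
  assumes "cut_and_project_scheme M"
    and "model_window \<Omega>"
    and "0 \<in> model_points M \<Omega>"
    and "0 \<in> interior \<Omega>"
    and "linear_similarity Q"
    and "Q ` phys_lattice M = phys_lattice M"
    and "is_star_map M Q A"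
    and "\<And>c. complex_eigenvalue A c \<Longrightarrow> cmod c < 1"
    and "interior (translation_window A \<Omega>) \<noteq> {}"
    and "frontier (translation_window A \<Omega>) \<in> null_sets lebesgue"
  shows "(\<exists>!p. invariant_density M \<Omega> Q A p \<and>
               (\<lambda>x. complex_of_real (p x)) \<in> model_functions M \<Omega>) \<and>
         (\<exists>!f. f \<in> window_functions \<Omega> \<and>
               has_infinite_convolution A (translation_window A \<Omega>) f) \<and>
         (\<forall>p f. invariant_density M \<Omega> Q A p \<longrightarrow>
               (\<lambda>x. complex_of_real (p x)) \<in> model_functions M \<Omega> \<longrightarrow>
               f \<in> window_functions \<Omega> \<longrightarrow>
               has_infinite_convolution A (translation_window A \<Omega>) f \<longrightarrow>
               (\<lambda>x. complex_of_real (p x)) = pullback M \<Omega> f)"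
proof -
  interpret compatible_similarity M \<Omega> Q A
    using assms by unfold_locales
  obtain c f where f: "prob_density c f" "continuous_on UNIV f" "avg f = f"
    by (rule fixed_point_exists)
  let ?f = "\<lambda>x. complex_of_real (f x)"
  have window: "(\<lambda>x. complex_of_real (g x)) \<in> window_functions \<Omega>"
    if "prob_density b g" "continuous_on UNIV g" for b g
    using that by (intro window_functionsI continuous_on_of_real) (auto simp: prob_density_def)
  have conv: "has_infinite_convolution A V ?f"
    by (rule fixed_point_has_infinite_convolution[OF f(1,3)])
  have unique: "h = ?f" if "h \<in> window_functions \<Omega>" "has_infinite_convolution A V h" for h
    by (rule infinite_convolution_unique[OF that window[OF f(1,2)] conv])
  \<comment> \<open>Any admissible density is the lift of a fixed point of \<open>avg\<close>, whose
    transform is the infinite product; so that fixed point is f.\<close>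
  have density: "p = lift f"
    if p: "invariant_density M \<Omega> Q A p" "(\<lambda>x. complex_of_real (p x)) \<in> model_functions M \<Omega>" for p
  proof -
    obtain b g where g: "prob_density b g" "continuous_on UNIV g" "avg g = g" "p = lift g"
      by (rule invariant_density_fixed_point[OF p])
    have "(\<lambda>x. complex_of_real (g x)) = ?f"
      by (rule unique[OF window[OF g(1,2)] fixed_point_has_infinite_convolution[OF g(1,3)]])
    then have "g = f" by (simp add: fun_eq_iff)
    then show ?thesis using g(4) by simp
  qed
  have inv: "invariant_density M \<Omega> Q A (lift f)" by (rule lift_invariant_density[OF f])
  have model: "(\<lambda>x. complex_of_real (lift f x)) \<in> model_functions M \<Omega>"
    unfolding lift_pullback model_functions_def using window[OF f(1,2)] by (rule imageI)
  show ?thesis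
  proof (intro conjI allI impI)
    show "\<exists>!p. invariant_density M \<Omega> Q A p \<and> (\<lambda>x. complex_of_real (p x)) \<in> model_functions M \<Omega>"
      using inv model density by blast
    show "\<exists>!f. f \<in> window_functions \<Omega> \<and> has_infinite_convolution A V f"
      using window[OF f(1,2)] conv unique by blast
    fix p h
    assume "invariant_density M \<Omega> Q A p" "(\<lambda>x. complex_of_real (p x)) \<in> model_functions M \<Omega>"
      "h \<in> window_functions \<Omega>" "has_infinite_convolution A V h"
    then have "p = lift f" "h = ?f" using density unique by blast+
    then show "(\<lambda>x. complex_of_real (p x)) = pullback M \<Omega> h"
      by (simp only: lift_pullback)
  qed
qed

end
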